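(* Let $\Omega\subset\mathbb{R}^n$ be a bounded open set, let $1<p<\infty$, let $\sigma_0,\sigma_1\in L^\infty_+(\Omega)$, and let $f\in W^{1,p}(\Omega)$. Then $$(p-1)\int_\Omega\frac{\sigma_0}{\sigma_1^{1/(p-1)}}\Big(\sigma_1^{\frac1{p-1}}-\sigma_0^{\frac1{p-1}}\Big)|\nabla u_0|^p\,dx\;\le\;\big((\Lambda_{\sigma_1}-\Lambda_{\sigma_0})f,f\big)\;\le\;\int_\Omega(\sigma_1-\sigma_0)|\nabla u_0|^p\,dx,$$ where $u_0\in W^{1,p}(\Omega)$ is the weak solution of $\mathrm{div}(\sigma_0|\nabla u_0|^{p-2}\nabla u_0)=0$ in $\Omega$ with $u_0|_{\partial\Omega}=f$, i.e. $u_0-f\in W^{1,p}_0(\Omega)$.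
   Context: All functions are real valued. $L^\infty_+(\Omega)=\{\gamma\in L^\infty(\Omega):\gamma>\varepsilon \text{ a.e. for some } \varepsilon>0\}$. Dirichlet-to-Neumann (DN) map: let $X=W^{1,p}(\Omega)/W^{1,p}_0(\Omega)$ with dual $X'$. For $\gamma\in L^\infty_+(\Omega)$ and $f\in W^{1,p}(\Omega)$ there is a unique weak solution $u\in W^{1,p}(\Omega)$ of $\mathrm{div}(\gamma|\nabla u|^{p-2}\nabla u)=0$ in $\Omega$ with $u-f\in W^{1,p}_0(\Omega)$. The nonlinear map $\Lambda_\gamma:X\to X'$ is defined by $$(\Lambda_\gamma f,g)=\int_\Omega\gamma|\nabla u|^{p-2}\nabla u\cdot\nabla v\,dx,$$ where $u$ is this solution and $v\in W^{1,p}(\Omega)$ is any function with $v-g\in W_0^{1,p}(\Omega)$; a function in $W^{1,p}(\Omega)$ is identified with its class in $X$, and $(\Lambda_{\sigma_1}-\Lambda_{\sigma_0})f=\Lambda_{\sigma_1}f-\Lambda_{\sigma_0}f$. *)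

theory Defs
  imports "HOL-Analysis.Analysis"
begin

definition gradient :: "('a::euclidean_space \<Rightarrow> real) \<Rightarrow> 'a \<Rightarrow> 'a" where
  "gradient \<phi> x = (THE D. GDERIV \<phi> x :> D)"

primrec times_cont_diff :: "nat \<Rightarrow> ('a::euclidean_space \<Rightarrow> real) \<Rightarrow> bool" where
  "times_cont_diff 0 \<phi> \<longleftrightarrow> continuous_on UNIV \<phi>"
| "times_cont_diff (Suc k) \<phi> \<longleftrightarrow>
     (\<forall>x. \<phi> differentiable (at x)) \<and>
     (\<forall>b\<in>Basis. times_cont_diff k (\<lambda>x. gradient \<phi> x \<bullet> b))"

(* C_c^\<infinity>(\<Omega>); its elements are extended by zero to the whole space. *)
definition test_functions :: "('a::euclidean_space) set \<Rightarrow> ('a \<Rightarrow> real) set" where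
  "test_functions \<Omega> =
     {\<phi>. (\<forall>k. times_cont_diff k \<phi>) \<and>
         compact (closure {x. \<phi> x \<noteq> 0}) \<and> closure {x. \<phi> x \<noteq> 0} \<subseteq> \<Omega>}"

(* Elements of the function spaces below are representatives, i.e. functions on the whole
   space of which only the values almost everywhere on \<Omega> matter. *)

definition Lp_on :: "('a::euclidean_space) set \<Rightarrow> real \<Rightarrow> ('a \<Rightarrow> 'b::euclidean_space) set" where
  "Lp_on \<Omega> p =
     {g. g \<in> borel_measurable (lebesgue_on \<Omega>) \<and>
         integrable (lebesgue_on \<Omega>) (\<lambda>x. norm (g x) powr p)}"

definition Linf_plus :: "('a::euclidean_space) set \<Rightarrow> ('a \<Rightarrow> real) set" where
  "Linf_plus \<Omega> =
     {\<gamma>. \<gamma> \<in> borel_measurable (lebesgue_on \<Omega>) \<and>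
         (\<exists>C. AE x in lebesgue_on \<Omega>. \<bar>\<gamma> x\<bar> \<le> C) \<and>
         (\<exists>\<epsilon>>0. AE x in lebesgue_on \<Omega>. \<gamma> x > \<epsilon>)}"

definition locally_integrable_on ::
    "('a::euclidean_space \<Rightarrow> 'b::euclidean_space) \<Rightarrow> 'a set \<Rightarrow> bool" where
  "locally_integrable_on g \<Omega> \<longleftrightarrow>
     (\<forall>K. compact K \<and> K \<subseteq> \<Omega> \<longrightarrow> integrable (lebesgue_on K) g)"

definition has_weak_gradient ::
    "('a::euclidean_space) set \<Rightarrow> ('a \<Rightarrow> real) \<Rightarrow> ('a \<Rightarrow> 'a) \<Rightarrow> bool" where
  "has_weak_gradient \<Omega> u G \<longleftrightarrow>
     locally_integrable_on u \<Omega> \<and> locally_integrable_on G \<Omega> \<and>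
     (\<forall>\<phi>\<in>test_functions \<Omega>.
        (LINT x|lebesgue_on \<Omega>. u x *\<^sub>R gradient \<phi> x) = - (LINT x|lebesgue_on \<Omega>. \<phi> x *\<^sub>R G x))"

(* For open \<Omega> the weak gradient is unique up to null sets; this picks a representative. *)
definition weak_grad :: "('a::euclidean_space) set \<Rightarrow> ('a \<Rightarrow> real) \<Rightarrow> 'a \<Rightarrow> 'a" where
  "weak_grad \<Omega> u = (SOME G. has_weak_gradient \<Omega> u G)"

definition sobolev :: "('a::euclidean_space) set \<Rightarrow> real \<Rightarrow> ('a \<Rightarrow> real) set" where
  "sobolev \<Omega> p = {u \<in> Lp_on \<Omega> p. \<exists>G\<in>Lp_on \<Omega> p. has_weak_gradient \<Omega> u G}"

definition sobolev_norm :: "('a::euclidean_space) set \<Rightarrow> real \<Rightarrow> ('a \<Rightarrow> real) \<Rightarrow> real" where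
  "sobolev_norm \<Omega> p u =
     ((LINT x|lebesgue_on \<Omega>. \<bar>u x\<bar> powr p) +
      (LINT x|lebesgue_on \<Omega>. norm (weak_grad \<Omega> u x) powr p)) powr (1 / p)"

definition sobolev0 :: "('a::euclidean_space) set \<Rightarrow> real \<Rightarrow> ('a \<Rightarrow> real) set" where
  "sobolev0 \<Omega> p =
     {u \<in> sobolev \<Omega> p.
        \<exists>\<phi>. (\<forall>k::nat. \<phi> k \<in> test_functions \<Omega>) \<and>
            (\<lambda>k. sobolev_norm \<Omega> p (\<lambda>x. u x - \<phi> k x)) \<longlonglongrightarrow> 0}"

definition boundary_rel ::
    "('a::euclidean_space) set \<Rightarrow> real \<Rightarrow> (('a \<Rightarrow> real) \<times> ('a \<Rightarrow> real)) set" where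
  "boundary_rel \<Omega> p =
     {(u, v). u \<in> sobolev \<Omega> p \<and> v \<in> sobolev \<Omega> p \<and> (\<lambda>x. u x - v x) \<in> sobolev0 \<Omega> p}"

(* X = W^{1,p}(\<Omega>) / W^{1,p}_0(\<Omega>) *)
definition boundary_space :: "('a::euclidean_space) set \<Rightarrow> real \<Rightarrow> ('a \<Rightarrow> real) set set" where
  "boundary_space \<Omega> p = sobolev \<Omega> p // boundary_rel \<Omega> p"

definition boundary_class ::
    "('a::euclidean_space) set \<Rightarrow> real \<Rightarrow> ('a \<Rightarrow> real) \<Rightarrow> ('a \<Rightarrow> real) set" where
  "boundary_class \<Omega> p f = boundary_rel \<Omega> p `` {f}"

(* |\<nabla>u|^{p-2} \<nabla>u; this is 0 where \<nabla>u = 0, also for p < 2. *)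
definition p_flux :: "('a::euclidean_space) set \<Rightarrow> real \<Rightarrow> ('a \<Rightarrow> real) \<Rightarrow> 'a \<Rightarrow> 'a" where
  "p_flux \<Omega> p u x = (norm (weak_grad \<Omega> u x) powr (p - 2)) *\<^sub>R weak_grad \<Omega> u x"

definition weak_solution ::
    "('a::euclidean_space) set \<Rightarrow> real \<Rightarrow> ('a \<Rightarrow> real) \<Rightarrow> ('a \<Rightarrow> real) \<Rightarrow> bool" where
  "weak_solution \<Omega> p \<gamma> u \<longleftrightarrow>
     u \<in> sobolev \<Omega> p \<and>
     (\<forall>\<phi>\<in>test_functions \<Omega>.
        (LINT x|lebesgue_on \<Omega>. \<gamma> x * (p_flux \<Omega> p u x \<bullet> gradient \<phi> x)) = 0)"

(* The DN map on X. The functional DN_map \<Omega> p \<gamma> F lies in X', with the dual pairing being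
   application. In the description, u ranges over the (essentially unique) weak solutions with
   boundary data F, and v over all representatives of G. *)
definition DN_map ::
    "('a::euclidean_space) set \<Rightarrow> real \<Rightarrow> ('a \<Rightarrow> real) \<Rightarrow>
     ('a \<Rightarrow> real) set \<Rightarrow> ('a \<Rightarrow> real) set \<Rightarrow> real" where
  "DN_map \<Omega> p \<gamma> =
     (\<lambda>F\<in>boundary_space \<Omega> p. \<lambda>G\<in>boundary_space \<Omega> p.
        THE c. \<exists>u v. weak_solution \<Omega> p \<gamma> u \<and> u \<in> F \<and> v \<in> G \<and>
          c = (LINT x|lebesgue_on \<Omega>. \<gamma> x * (p_flux \<Omega> p u x \<bullet> weak_grad \<Omega> v x)))"

end

theory Submission
  imports Defs "HOL-Computational_Algebra.Polynomial"
begin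

text \<open>
The key observation is that on the diagonal the Dirichlet-to-Neumann map is an energy: if \<open>u\<close> is
the weak solution for the weight \<open>\<sigma>\<close> with boundary data \<open>f\<close>, then its pairing of \<open>f\<close> with \<open>f\<close>
equals \<open>\<integral> \<sigma> \<bar>\<nabla>u\<bar>\<^sup>p\<close>, and this is the least energy of all functions with that boundary data
(\<open>DN_map_diagonal\<close>, \<open>weak_solution_minimizes_energy\<close>). Minimality follows from the convexity
inequality \<open>\<bar>b\<bar>\<^sup>p \<ge> \<bar>a\<bar>\<^sup>p + p \<bar>a\<bar>\<^sup>p\<^sup>-\<^sup>2 a \<bullet> (b - a)\<close> (\<open>norm_powr_tangent\<close>), whose linear term integrates to
\<open>0\<close> when \<open>a\<close> is the gradient of a solution and \<open>b - a\<close> that of an element of \<open>W\<^sub>0\<close>.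

Let \<open>u1\<close> be the solution for \<open>\<sigma>1\<close>. The upper estimate holds because \<open>u0\<close> competes with \<open>u1\<close> in the
minimization of the \<open>\<sigma>1\<close>-energy. For the lower estimate the convexity inequality is used with
\<open>b = \<nabla>u1\<close> and \<open>a = r \<nabla>u0\<close>, where \<open>r\<^sup>p\<^sup>-\<^sup>1 = \<sigma>0 / \<sigma>1\<close>. After multiplication by \<open>\<sigma>1\<close> the vector
multiplying \<open>b\<close> is \<open>p\<close> times the flux of \<open>u0\<close>, so integration and the equation for \<open>u0\<close> leave exactly
the claimed lower bound (\<open>weighted_norm_powr_tangent\<close>).

The map is defined by a definite description, so the argument presupposes that \<open>u1\<close> exists
(\<open>weak_solution_exists\<close>). It is obtained by the direct method: uniform convexity of the \<open>p\<close>-th power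
makes the gradients of a minimizing sequence a Cauchy sequence (\<open>uniform_convexity_powr\<close>,
\<open>minimizing_sequence_gradients_Cauchy\<close>), the Poincare inequality carries this over to the functions
(\<open>Poincare_test_functions\<close>), and the limit satisfies the Euler-Lagrange equation (\<open>euler_lagrange\<close>).

Weak gradients are arbitrary representatives, and all identities between them hold almost everywhere
by the fundamental lemma of the calculus of variations
(\<open>fundamental_lemma_calculus_of_variations\<close>). It is proved with smooth bumps that increase to the
indicator functions of boxes.
\<close>

section \<open>Gradients and repeated differentiability\<close>

lemma gradient_eqI:
  assumes "(f has_derivative (\<lambda>h. h \<bullet> D)) (at x)"
  shows "gradient f x = D"
  unfolding gradient_def gderiv_def
proof (rule the_equality)
  fix E assume "(f has_derivative (\<lambda>h. h \<bullet> E)) (at x)"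
  then have "(\<lambda>h. h \<bullet> E) = (\<lambda>h. h \<bullet> D)"
    using assms has_derivative_unique by blast
  then show "E = D"
    by (metis inner_commute vector_eq_rdot)
qed (use assms in auto)

lemma has_derivative_gradient:
  assumes "f differentiable (at x)"
  shows "(f has_derivative (\<lambda>h. h \<bullet> gradient f x)) (at x)"
proof -
  obtain f' where f': "(f has_derivative f') (at x)"
    using assms by (auto simp: differentiable_def)
  then interpret linear f' by (rule has_derivative_linear)
  have "f' h = h \<bullet> (\<Sum>b\<in>Basis. f' b *\<^sub>R b)" for h
  proof -
    have "f' h = f' (\<Sum>b\<in>Basis. (h \<bullet> b) *\<^sub>R b)" by (simp add: euclidean_representation)
    also have "\<dots> = (\<Sum>b\<in>Basis. (h \<bullet> b) * f' b)" by (simp add: sum scaleR)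
    finally show ?thesis by (simp add: inner_sum_right mult.commute)
  qed
  then have "f' = (\<lambda>h. h \<bullet> (\<Sum>b\<in>Basis. f' b *\<^sub>R b))" by blast
  then show ?thesis using f' gradient_eqI by metis
qed

lemma gradient_add:
  assumes "f differentiable (at x)" "g differentiable (at x)"
  shows "gradient (\<lambda>x. f x + g x) x = gradient f x + gradient g x"
  using has_derivative_add[OF has_derivative_gradient[OF assms(1)] has_derivative_gradient[OF assms(2)]]
  by (intro gradient_eqI) (simp add: inner_add_right)

lemma gradient_mult:
  assumes "f differentiable (at x)" "g differentiable (at x)"
  shows "gradient (\<lambda>x. f x * g x) x = f x *\<^sub>R gradient g x + g x *\<^sub>R gradient f x"
  using has_derivative_mult[OF has_derivative_gradient[OF assms(1)] has_derivative_gradient[OF assms(2)]]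
  by (intro gradient_eqI) (simp add: inner_add_right mult.commute)

lemma gradient_const: "gradient (\<lambda>x. c) x = 0"
  by (rule gradient_eqI) simp

lemma gradient_cmult:
  assumes "f differentiable (at x)"
  shows "gradient (\<lambda>x. c * f x) x = c *\<^sub>R gradient f x"
  using gradient_mult[of "\<lambda>x. c" x f] assms by (simp add: gradient_const)

lemma times_cont_diff_const: "times_cont_diff k (\<lambda>x. c)"
  by (induction k arbitrary: c) (auto simp: gradient_const)

lemma times_cont_diff_Suc_imp: "times_cont_diff (Suc k) f \<Longrightarrow> times_cont_diff k f"
proof (induction k arbitrary: f)
  case 0
  then show ?case
    by (auto intro!: continuous_at_imp_continuous_on differentiable_imp_continuous_within)
next
  case (Suc k)
  then show ?case by (metis times_cont_diff.simps(2))
qed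

lemma times_cont_diff_add:
  "times_cont_diff k f \<Longrightarrow> times_cont_diff k g \<Longrightarrow> times_cont_diff k (\<lambda>x. f x + g x)"
proof (induction k arbitrary: f g)
  case 0
  then show ?case by (auto intro: continuous_intros)
next
  case (Suc k)
  then have "(\<lambda>x. gradient (\<lambda>x. f x + g x) x \<bullet> b) = (\<lambda>x. gradient f x \<bullet> b + gradient g x \<bullet> b)" for b
    by (auto simp: gradient_add inner_add_left)
  with Suc show ?case by auto
qed

lemma times_cont_diff_mult:
  "times_cont_diff k f \<Longrightarrow> times_cont_diff k g \<Longrightarrow> times_cont_diff k (\<lambda>x. f x * g x)"
proof (induction k arbitrary: f g)
  case 0
  then show ?case by (auto intro: continuous_intros)
next
  case (Suc k)
  then have "(\<lambda>x. gradient (\<lambda>x. f x * g x) x \<bullet> b)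
      = (\<lambda>x. f x * (gradient g x \<bullet> b) + g x * (gradient f x \<bullet> b))" for b
    by (auto simp: gradient_mult inner_add_left)
  moreover have "times_cont_diff k f" "times_cont_diff k g"
    using Suc.prems times_cont_diff_Suc_imp by blast+
  ultimately show ?case
    using Suc by (auto intro!: times_cont_diff_add)
qed

lemma times_cont_diff_prod:
  "finite I \<Longrightarrow> (\<And>i. i \<in> I \<Longrightarrow> times_cont_diff k (f i)) \<Longrightarrow> times_cont_diff k (\<lambda>x. \<Prod>i\<in>I. f i x)"
  by (induction I rule: finite_induct) (auto simp: times_cont_diff_const times_cont_diff_mult)

section \<open>Smooth bumps and test functions\<close>

text \<open>With \<open>P = 1\<close> this is the classical smooth function \<open>exp (- 1 / t)\<close>, continued by \<open>0\<close>. The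
polynomial factor makes the family closed under differentiation.\<close>
definition flat :: "real poly \<Rightarrow> real \<Rightarrow> real" where
  "flat P t = (if t \<le> 0 then 0 else poly P (1 / t) * exp (- (1 / t)))"

lemma poly_times_exp_tendsto_0: "((\<lambda>s::real. poly P s * exp (- s)) \<longlongrightarrow> 0) at_top"
proof -
  have "((\<lambda>s::real. \<Sum>i\<le>degree P. coeff P i * (s ^ i / exp s)) \<longlongrightarrow> (\<Sum>i\<le>degree P. coeff P i * 0)) at_top"
    by (intro tendsto_intros tendsto_power_div_exp_0)
  then show ?thesis
    by (simp add: poly_altdef sum_distrib_right exp_minus divide_inverse mult.assoc)
qed

lemma has_real_derivative_flat:
  "(flat P has_real_derivative flat ([:0, 0, 1:] * (P - pderiv P)) t) (at t)"
proof -
  consider "t < 0" | "t = 0" | "t > 0" by linarith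
  then show ?thesis
  proof cases
    case 1
    have "((\<lambda>t. 0) has_real_derivative 0) (at t)" by simp
    moreover have "\<forall>\<^sub>F s in nhds t. flat P s = 0"
      using eventually_nhds_in_open[of "{..<0}" t] 1
      by (auto elim!: eventually_mono simp: flat_def)
    ultimately show ?thesis
      using 1 by (subst DERIV_cong_ev[where g="\<lambda>_. 0"]) (auto simp: flat_def)
  next
    case 2
    have "((\<lambda>s. flat P s / s) \<longlongrightarrow> 0) (at_right 0)"
    proof -
      have "((\<lambda>s. poly (pCons 0 P) (inverse s) * exp (- inverse s)) \<longlongrightarrow> 0) (at_right (0::real))"
        by (rule filterlim_compose[OF poly_times_exp_tendsto_0 filterlim_inverse_at_top_right])
      moreover have "\<forall>\<^sub>F s in at_right 0. poly (pCons 0 P) (inverse s) * exp (- inverse s) = flat P s / s"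
        by (auto simp: eventually_at_filter flat_def field_simps)
      ultimately show ?thesis by (rule Lim_transform_eventually)
    qed
    moreover have "((\<lambda>s. flat P s / s) \<longlongrightarrow> 0) (at_left 0)"
    proof -
      have "\<forall>\<^sub>F s in at_left 0. 0 = flat P s / s"
        by (auto simp: eventually_at_filter flat_def)
      then show ?thesis by (rule Lim_transform_eventually[OF tendsto_const])
    qed
    ultimately have "((\<lambda>s. flat P s / s) \<longlongrightarrow> 0) (at 0)"
      by (simp add: filterlim_at_split)
    then show ?thesis
      using 2 by (simp add: has_field_derivative_iff flat_def)
  next
    case 3
    have "((\<lambda>t. poly P (1 / t) * exp (- (1 / t))) has_real_derivative
        flat ([:0, 0, 1:] * (P - pderiv P)) t) (at t)"
      using 3
      by (auto intro!: derivative_eq_intros simp: flat_def field_simps power2_eq_square)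
    moreover have "\<forall>\<^sub>F s in nhds t. flat P s = poly P (1 / s) * exp (- (1 / s))"
      using eventually_nhds_in_open[of "{0<..}" t] 3
      by (auto elim!: eventually_mono simp: flat_def)
    ultimately show ?thesis
      by (subst DERIV_cong_ev[where g="\<lambda>s. poly P (1 / s) * exp (- (1 / s))"]) auto
  qed
qed

text \<open>The partial derivatives are again of the form \<open>flat Q\<close> along the same affine function, so the
induction has to run over all polynomials at once.\<close>
lemma times_cont_diff_flat:
  fixes a :: "'a::euclidean_space"
  shows "times_cont_diff k (\<lambda>x. flat P (a \<bullet> x + c))"
proof (induction k arbitrary: P)
  case 0
  have "isCont (flat P) t" for t
    using has_real_derivative_flat DERIV_isCont by blast
  then have "continuous_on UNIV (flat P)"
    by (simp add: continuous_at_imp_continuous_on)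
  then show ?case
    by (auto intro!: continuous_on_compose2[of UNIV "flat P"] continuous_intros)
next
  case (Suc k)
  let ?Q = "[:0, 0, 1:] * (P - pderiv P)"
  have der: "((\<lambda>x. flat P (a \<bullet> x + c)) has_derivative (\<lambda>h. h \<bullet> (flat ?Q (a \<bullet> x + c) *\<^sub>R a))) (at x)" for x
  proof -
    have "((\<lambda>x. a \<bullet> x + c) has_derivative (\<lambda>h. a \<bullet> h)) (at x)"
      by (auto intro!: derivative_eq_intros)
    from has_derivative_compose[OF this
        has_real_derivative_flat[of P "a \<bullet> x + c", unfolded has_field_derivative_def]]
    show ?thesis by (simp add: inner_commute)
  qed
  then have "gradient (\<lambda>x. flat P (a \<bullet> x + c)) x = flat ?Q (a \<bullet> x + c) *\<^sub>R a" for x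
    by (rule gradient_eqI)
  then have "(\<lambda>x. gradient (\<lambda>x. flat P (a \<bullet> x + c)) x \<bullet> b) = (\<lambda>x. (a \<bullet> b) * flat ?Q (a \<bullet> x + c))" for b
    by auto
  then show ?case
    using der by (auto simp: differentiable_def intro!: times_cont_diff_mult times_cont_diff_const Suc)
qed

lemma
  assumes "\<phi> \<in> test_functions \<Omega>"
  shows test_function_differentiable: "\<phi> differentiable (at x)"
    and continuous_on_test_function: "continuous_on UNIV \<phi>"
    and continuous_on_gradient_test_function: "continuous_on UNIV (gradient \<phi>)"
    and test_function_support: "\<exists>K. compact K \<and> K \<subseteq> \<Omega> \<and> (\<forall>x. x \<notin> K \<longrightarrow> \<phi> x = 0 \<and> gradient \<phi> x = 0)"
proof -
  have k: "times_cont_diff k \<phi>" for k using assms by (auto simp: test_functions_def)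
  show d: "\<phi> differentiable (at x)" for x using k[of "Suc 0"] by auto
  show "continuous_on UNIV \<phi>" using k[of 0] by auto
  show "continuous_on UNIV (gradient \<phi>)"
  proof (rule continuous_on_componentwise[THEN iffD2], rule ballI)
    fix b :: 'a assume "b \<in> Basis"
    with k[of "Suc 0"] show "continuous_on UNIV (\<lambda>x. gradient \<phi> x \<bullet> b)" by simp
  qed
  let ?K = "closure {x. \<phi> x \<noteq> 0}"
  have z: "\<phi> x = 0" if "x \<notin> ?K" for x
    using that closure_subset[of "{x. \<phi> x \<noteq> 0}"] by auto
  have "gradient \<phi> x = 0" if "x \<notin> ?K" for x
  proof (rule gradient_eqI)
    have "((\<lambda>_. 0) has_derivative (\<lambda>h. h \<bullet> 0)) (at x)" by simp
    then show "(\<phi> has_derivative (\<lambda>h. h \<bullet> 0)) (at x)"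
    proof (rule has_derivative_transform_within_open)
      show "open (- ?K)" by (rule open_Compl) (rule closed_closure)
      show "x \<in> - ?K" using that by blast
      show "0 = \<phi> y" if "y \<in> - ?K" for y
        using that by (intro z[symmetric]) blast
    qed
  qed
  with z have "\<forall>x. x \<notin> ?K \<longrightarrow> \<phi> x = 0 \<and> gradient \<phi> x = 0" by blast
  then show "\<exists>K. compact K \<and> K \<subseteq> \<Omega> \<and> (\<forall>x. x \<notin> K \<longrightarrow> \<phi> x = 0 \<and> gradient \<phi> x = 0)"
    using assms unfolding test_functions_def by blast
qed

lemma test_functions_lincomb:
  assumes "\<phi> \<in> test_functions \<Omega>" "\<psi> \<in> test_functions \<Omega>"
  shows "(\<lambda>x. a * \<phi> x + b * \<psi> x) \<in> test_functions \<Omega>"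
proof -
  let ?C = "closure {x. \<phi> x \<noteq> 0} \<union> closure {x. \<psi> x \<noteq> 0}"
  have C: "compact ?C" "?C \<subseteq> \<Omega>" "closed ?C" 
    using assms by (auto simp: test_functions_def)
  have "closure {x. a * \<phi> x + b * \<psi> x \<noteq> 0} \<subseteq> ?C"
  proof (rule closure_minimal[OF _ C(3)], safe)
    fix x assume "a * \<phi> x + b * \<psi> x \<noteq> 0" "x \<notin> closure {x. \<psi> x \<noteq> 0}"
    then show "x \<in> closure {x. \<phi> x \<noteq> 0}"
      by (metis (mono_tags, lifting) add.right_neutral closure_subset mem_Collect_eq mult_zero_right subset_iff)
  qed
  then have "closure {x. a * \<phi> x + b * \<psi> x \<noteq> 0} \<subseteq> \<Omega>" "compact (closure {x. a * \<phi> x + b * \<psi> x \<noteq> 0})"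
    using C by (blast, meson bounded_subset closed_closure compact_eq_bounded_closed)
  then show ?thesis
    using assms by (auto simp: test_functions_def intro!: times_cont_diff_add times_cont_diff_mult times_cont_diff_const)
qed

lemma gradient_test_lincomb:
  assumes "\<phi> \<in> test_functions \<Omega>" "\<psi> \<in> test_functions \<Omega>"
  shows "gradient (\<lambda>x. a * \<phi> x + b * \<psi> x) x = a *\<^sub>R gradient \<phi> x + b *\<^sub>R gradient \<psi> x"
  using test_function_differentiable[OF assms(1), of x] test_function_differentiable[OF assms(2), of x]
  by (subst gradient_add) (auto simp: gradient_cmult)

text \<open>The scaling factor \<open>c\<close> does not change the support but pushes the values towards \<open>1\<close> inside the box.\<close>
lemma box_bump_in_test_functions:
  fixes a b :: "'a::euclidean_space"
  assumes "cbox a b \<subseteq> \<Omega>" "0 < c"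
  shows "(\<lambda>x. \<Prod>i\<in>Basis. flat 1 (c * (x \<bullet> i - a \<bullet> i)) * flat 1 (c * (b \<bullet> i - x \<bullet> i))) \<in> test_functions \<Omega>"
    (is "?\<phi> \<in> _")
proof -
  have z: "x \<in> box a b" if "?\<phi> x \<noteq> 0" for x
  proof -
    have "\<forall>i\<in>Basis. flat 1 (c * (x \<bullet> i - a \<bullet> i)) \<noteq> 0 \<and> flat 1 (c * (b \<bullet> i - x \<bullet> i)) \<noteq> 0"
      using that by auto
    then have "\<forall>i\<in>Basis. 0 < c * (x \<bullet> i - a \<bullet> i) \<and> 0 < c * (b \<bullet> i - x \<bullet> i)"
      unfolding flat_def by (meson not_less)
    then show ?thesis using \<open>0 < c\<close> by (simp add: mem_box zero_less_mult_iff)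
  qed
  have cl: "closure {x. ?\<phi> x \<noteq> 0} \<subseteq> cbox a b"
    by (rule closure_minimal) (use z box_subset_cbox in auto)
  have "times_cont_diff k ?\<phi>" for k
  proof (intro times_cont_diff_prod times_cont_diff_mult finite_Basis)
    fix i :: 'a
    have "c * (x \<bullet> i - a \<bullet> i) = (c *\<^sub>R i) \<bullet> x + (- c * (a \<bullet> i))" "c * (b \<bullet> i - x \<bullet> i) = (- c *\<^sub>R i) \<bullet> x + c * (b \<bullet> i)" for x
      by (auto simp: algebra_simps inner_commute)
    then show "times_cont_diff k (\<lambda>x. flat 1 (c * (x \<bullet> i - a \<bullet> i)))" "times_cont_diff k (\<lambda>x. flat 1 (c * (b \<bullet> i - x \<bullet> i)))"
      by (simp_all only: times_cont_diff_flat)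
  qed
  moreover have "compact (closure {x. ?\<phi> x \<noteq> 0})"
    using cl by (meson bounded_cbox bounded_subset closed_closure compact_eq_bounded_closed)
  ultimately show ?thesis using cl assms by (auto simp: test_functions_def)
qed

lemma box_bump_limit:
  fixes a b x :: "'a::euclidean_space"
  shows "(\<lambda>k. \<Prod>i\<in>Basis. flat 1 (real (Suc k) * (x \<bullet> i - a \<bullet> i)) * flat 1 (real (Suc k) * (b \<bullet> i - x \<bullet> i)))
     \<longlonglongrightarrow> indicat_real (box a b) x"
proof -
  have lim: "(\<lambda>k. flat 1 (real (Suc k) * t)) \<longlonglongrightarrow> (if t > 0 then 1 else 0)" for t
  proof (cases "t > 0")
    case True
    have "(\<lambda>k. exp (- (inverse (real (Suc k)) * inverse t))) \<longlonglongrightarrow> exp (- (0 * inverse t))"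
      by (intro tendsto_intros LIMSEQ_inverse_real_of_nat)
    then show ?thesis using True
      by (simp add: flat_def divide_inverse mult_le_0_iff not_le del: of_nat_Suc)
  qed (auto simp: flat_def mult_le_0_iff)
  have "(\<lambda>k. \<Prod>i\<in>Basis. flat 1 (real (Suc k) * (x \<bullet> i - a \<bullet> i)) * flat 1 (real (Suc k) * (b \<bullet> i - x \<bullet> i)))
     \<longlonglongrightarrow> (\<Prod>i\<in>Basis. (if x \<bullet> i - a \<bullet> i > 0 then 1 else 0) * (if b \<bullet> i - x \<bullet> i > 0 then 1 else 0))"
    by (intro tendsto_intros lim)
  also have "(\<Prod>i\<in>Basis. (if x \<bullet> i - a \<bullet> i > 0 then 1 else 0) * (if b \<bullet> i - x \<bullet> i > 0 then 1 else 0)) = indicat_real (box a b) x"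
    by (auto simp: indicator_def mem_box intro!: prod.neutral)
  finally show ?thesis .
qed

lemma flat_1_bounds: "0 \<le> flat 1 t" "flat 1 t \<le> 1"
  by (auto simp: flat_def)

section \<open>Integration by parts\<close>

lemma integrable_lborel_compact_support:
  fixes h :: "'a::euclidean_space \<Rightarrow> 'b::euclidean_space"
  assumes "continuous_on UNIV h" "compact K" "\<And>x. x \<notin> K \<Longrightarrow> h x = 0"
  shows "integrable lborel h"
proof -
  have "integrable lborel (\<lambda>x. indicator K x *\<^sub>R h x)"
    using assms continuous_on_subset by (intro borel_integrable_compact) blast+
  moreover have "(\<lambda>x. indicator K x *\<^sub>R h x) = h"
    using assms(3) by (auto simp: indicator_def fun_eq_iff)
  ultimately show ?thesis by simp
qed

lemma integrable_lebesgue_on_compact_support: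
  fixes h :: "'a::euclidean_space \<Rightarrow> 'b::euclidean_space"
  assumes "continuous_on UNIV h" "compact K" "\<And>x. x \<notin> K \<Longrightarrow> h x = 0" "S \<in> sets lebesgue"
  shows "integrable (lebesgue_on S) h"
proof -
  have "integrable lebesgue h"
    using integrable_lborel_compact_support[OF assms(1-3)]
    by (subst integrable_completion) auto
  then have "integrable lebesgue (\<lambda>x. indicator S x *\<^sub>R h x)"
    using integrable_mult_indicator[of S lebesgue h] assms(4) by blast
  then show ?thesis using assms(4) by (subst integrable_restrict_space) auto
qed

lemma integral_lebesgue_on_eq_lborel:
  fixes h :: "'a::euclidean_space \<Rightarrow> 'b::euclidean_space"
  assumes "h \<in> borel_measurable borel" "S \<in> sets lebesgue" "\<And>x. x \<notin> S \<Longrightarrow> h x = 0"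
  shows "integral\<^sup>L (lebesgue_on S) h = integral\<^sup>L lborel h"
proof -
  have "integral\<^sup>L (lebesgue_on S) h = (LINT x|lebesgue. indicator S x *\<^sub>R h x)"
    using assms(2) by (subst integral_restrict_space) auto
  also have "(\<lambda>x. indicator S x *\<^sub>R h x) = h"
    using assms(3) by (auto simp: indicator_def fun_eq_iff)
  also have "integral\<^sup>L lebesgue h = integral\<^sup>L lborel h"
    using assms(1) by (subst integral_completion) auto
  finally show ?thesis .
qed

text \<open>Translation invariance replaces Fubini: the difference quotients of \<open>h\<close> in direction \<open>b\<close> have
integral \<open>0\<close>, and by the mean value theorem they are bounded by a multiple of the indicator of
a fixed ball, so dominated convergence passes to the derivative. Only \<open>C\<^sup>1\<close> regularity enters;
the proof of the Poincare inequality needs this, because there \<open>h\<close> contains \<open>\<bar>\<phi>\<bar> powr p\<close>.\<close>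
lemma integral_directional_derivative_eq_0:
  fixes h :: "'a::euclidean_space \<Rightarrow> real"
  assumes der: "\<And>x. (h has_derivative (\<lambda>v. v \<bullet> D x)) (at x)"
    and cont: "continuous_on UNIV D"
    and K: "compact K" "\<And>x. x \<notin> K \<Longrightarrow> h x = 0" "\<And>x. x \<notin> K \<Longrightarrow> D x = 0"
  shows "integral\<^sup>L lborel (\<lambda>x. D x \<bullet> b) = 0"
proof -
  define t where "t n = inverse (real (Suc n))" for n
  have t: "0 < t n" "t n \<le> 1" for n by (auto simp: t_def inverse_le_1_iff)
  have t0: "t \<longlonglongrightarrow> 0" unfolding t_def by (rule LIMSEQ_inverse_real_of_nat)
  define s where "s n x = (h (x + t n *\<^sub>R b) - h x) / t n" for n x
  have hc: "continuous_on UNIV h"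
    using der by (meson continuous_at_imp_continuous_on has_derivative_continuous)
  have hm: "h \<in> borel_measurable borel" "D \<in> borel_measurable borel"
    using hc cont by (auto intro: borel_measurable_continuous_onI)
  have hi: "integrable lborel h"
    by (rule integrable_lborel_compact_support[OF hc K(1,2)])
  have tr: "integrable lborel (\<lambda>x. h (x + c))" "integral\<^sup>L lborel (\<lambda>x. h (x + c)) = integral\<^sup>L lborel h" for c
  proof -
    have "integrable (distr lborel borel ((+) c)) h" using hi by (simp add: lborel_distr_plus)
    then show "integrable lborel (\<lambda>x. h (x + c))"
      using hm by (subst (asm) integrable_distr_eq) (auto simp: add.commute)
    have "integral\<^sup>L lborel h = integral\<^sup>L (distr lborel borel ((+) c)) h" by (simp add: lborel_distr_plus)
    also have "\<dots> = integral\<^sup>L lborel (\<lambda>x. h (c + x))"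
      using hm by (subst integral_distr) auto
    finally show "integral\<^sup>L lborel (\<lambda>x. h (x + c)) = integral\<^sup>L lborel h" by (simp add: add.commute)
  qed
  obtain R where R: "\<And>x. x \<in> K \<Longrightarrow> norm x \<le> R"
    using compact_imp_bounded[OF K(1)] by (auto simp: bounded_iff)
  have "compact (D ` K)" using cont K(1) compact_continuous_image continuous_on_subset by blast
  then obtain M0 where M0: "\<And>x. x \<in> K \<Longrightarrow> norm (D x) \<le> M0"
    using compact_imp_bounded by (fastforce simp: bounded_iff)
  define M where "M = max M0 0"
  have M: "norm (D x) \<le> M" for x
    using M0[of x] K(3)[of x] by (cases "x \<in> K") (auto simp: M_def)
  have bnd: "norm (s n x) \<le> indicator (cball 0 (R + norm b)) x * (M * norm b)" for n x
  proof (cases "x \<in> cball 0 (R + norm b)")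
    case True
    have "norm (h (x + t n *\<^sub>R b) - h x) \<le> M * norm (x + t n *\<^sub>R b - x)"
    proof (rule differentiable_bound[where S=UNIV and f' = "\<lambda>x v. v \<bullet> D x"])
      show "onorm (\<lambda>v. v \<bullet> D y) \<le> M" for y
      proof (rule onorm_le)
        fix v show "norm (v \<bullet> D y) \<le> M * norm v"
          using M[of y] Cauchy_Schwarz_ineq2[of v "D y"] mult_left_mono[of "norm (D y)" M "norm v"]
          by (simp add: mult.commute)
      qed
    qed (use der in auto)
    then show ?thesis using True t[of n]
      by (simp add: s_def divide_simps abs_mult mult.assoc mult.commute mult.left_commute)
  next
    case False
    then have "x \<notin> K" "x + t n *\<^sub>R b \<notin> K"
    proof -
      show "x \<notin> K" using R[of x] False by (auto simp: not_le) (smt (verit) norm_ge_zero)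
      show "x + t n *\<^sub>R b \<notin> K"
      proof
        assume "x + t n *\<^sub>R b \<in> K"
        then have "norm (x + t n *\<^sub>R b) \<le> R" by (rule R)
        moreover have "norm (t n *\<^sub>R b) \<le> norm b" using t[of n] by (simp add: mult_left_le_one_le)
        ultimately show False using False norm_triangle_ineq4[of "x + t n *\<^sub>R b" "t n *\<^sub>R b"] by auto
      qed
    qed
    then show ?thesis using K(2) False by (auto simp: s_def)
  qed
  have "(\<lambda>n. integral\<^sup>L lborel (s n)) \<longlonglongrightarrow> integral\<^sup>L lborel (\<lambda>x. D x \<bullet> b)"
  proof (rule integral_dominated_convergence)
    show "integrable lborel (\<lambda>x::'a. indicator (cball 0 (R + norm b)) x * (M * norm b))"
    proof (intro integrable_mult_left impI integrable_real_indicator)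
      show "emeasure lborel (cball (0::'a) (R + norm b)) < \<infinity>"
        by (rule emeasure_lborel_cball_finite)
    qed simp
    show "AE x in lborel. norm (s n x) \<le> indicator (cball 0 (R + norm b)) x * (M * norm b)" for n
      using bnd by simp
    show "AE x in lborel. (\<lambda>n. s n x) \<longlonglongrightarrow> D x \<bullet> b"
    proof (rule AE_I2)
      fix x
      have "((\<lambda>\<tau>. h (x + \<tau> *\<^sub>R b)) has_derivative (\<lambda>\<tau>. (\<tau> *\<^sub>R b) \<bullet> D x)) (at 0)"
      proof -
        have "((\<lambda>\<tau>. x + \<tau> *\<^sub>R b) has_derivative (\<lambda>\<tau>. \<tau> *\<^sub>R b)) (at 0)"
          by (auto intro!: derivative_eq_intros)
        from has_derivative_compose[OF this, of h "\<lambda>v. v \<bullet> D x"] der[of x] show ?thesis by simp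
      qed
      then have "((\<lambda>\<tau>. h (x + \<tau> *\<^sub>R b)) has_real_derivative (D x \<bullet> b)) (at 0)"
        by (simp add: has_field_derivative_def inner_commute mult_commute_abs)
      then have "((\<lambda>\<tau>. (h (x + \<tau> *\<^sub>R b) - h x) / \<tau>) \<longlongrightarrow> D x \<bullet> b) (at 0)"
        by (simp add: has_field_derivative_iff)
      moreover have "filterlim t (at 0) sequentially"
        using t0 t(1) by (intro filterlim_atI) (auto intro!: always_eventually simp: less_imp_neq[symmetric] simp del: of_nat_Suc)
      ultimately show "(\<lambda>n. s n x) \<longlonglongrightarrow> D x \<bullet> b"
        unfolding s_def by (rule filterlim_compose)
    qed
    show "s n \<in> borel_measurable lborel" for n
      unfolding s_def using hm by measurable
    show "(\<lambda>x. D x \<bullet> b) \<in> borel_measurable lborel" using hm by measurable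
  qed
  moreover have "integral\<^sup>L lborel (s n) = 0" for n
    unfolding s_def using tr hi by simp
  ultimately show ?thesis by (simp add: LIMSEQ_const_iff)
qed

text \<open>Both summands together are the gradient of the compactly supported product, so this is
integration by parts for two test functions.\<close>
lemma gradient_mult_integral_0:
  fixes \<phi> \<psi> :: "'a::euclidean_space \<Rightarrow> real"
  assumes "\<phi> \<in> test_functions \<Omega>" "\<psi> \<in> test_functions \<Omega>"
  shows "(LINT x|lborel. (\<phi> x *\<^sub>R gradient \<psi> x + \<psi> x *\<^sub>R gradient \<phi> x) \<bullet> b) = 0"
proof -
  obtain K where K: "compact K" "\<And>x. x \<notin> K \<Longrightarrow> \<phi> x = 0" "\<And>x. x \<notin> K \<Longrightarrow> gradient \<phi> x = 0"
    using test_function_support[OF assms(1)] by blast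
  show ?thesis
  proof (rule integral_directional_derivative_eq_0[where h = "\<lambda>x. \<phi> x * \<psi> x" and K = K])
    fix x
    note has_derivative_mult[OF has_derivative_gradient[OF test_function_differentiable[OF assms(1)]]
        has_derivative_gradient[OF test_function_differentiable[OF assms(2)]], of x]
    then show "((\<lambda>x. \<phi> x * \<psi> x) has_derivative (\<lambda>v. v \<bullet> (\<phi> x *\<^sub>R gradient \<psi> x + \<psi> x *\<^sub>R gradient \<phi> x))) (at x)"
      by (simp add: inner_add_right mult.commute)
  qed (use K in \<open>auto intro!: continuous_intros continuous_on_test_function[OF assms(1)] continuous_on_test_function[OF assms(2)]
       continuous_on_gradient_test_function[OF assms(1)] continuous_on_gradient_test_function[OF assms(2)]\<close>)
qed

lemma locally_integrable_continuous:
  fixes h :: "'a::euclidean_space \<Rightarrow> 'b::euclidean_space"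
  shows "continuous_on UNIV h \<Longrightarrow> locally_integrable_on h \<Omega>"
  unfolding locally_integrable_on_def
proof safe
  fix K assume *: "continuous_on UNIV h" "compact K" "K \<subseteq> \<Omega>"
  have "integrable lborel (\<lambda>x. indicator K x *\<^sub>R h x)"
    using * continuous_on_subset by (intro borel_integrable_compact) blast+
  moreover have "K \<in> sets borel" using *(2) by (simp add: compact_imp_closed)
  ultimately show "integrable (lebesgue_on K) h"
    by (subst integrable_restrict_space, simp, subst integrable_completion) 
      (auto simp: borel_measurable_integrable)
qed

lemma test_function_has_weak_gradient:
  fixes \<phi> :: "'a::euclidean_space \<Rightarrow> real"
  assumes \<phi>: "\<phi> \<in> test_functions \<Omega>" and \<Omega>: "open \<Omega>"
  shows "has_weak_gradient \<Omega> \<phi> (gradient \<phi>)"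
  unfolding has_weak_gradient_def
proof (intro conjI ballI)
  let ?M = "lebesgue_on \<Omega>"
  show "locally_integrable_on \<phi> \<Omega>" "locally_integrable_on (gradient \<phi>) \<Omega>"
    using continuous_on_test_function[OF \<phi>] continuous_on_gradient_test_function[OF \<phi>]
    by (auto intro: locally_integrable_continuous)
  fix \<psi> assume \<psi>: "\<psi> \<in> test_functions \<Omega>"
  have meas: "\<Omega> \<in> sets lebesgue" using \<Omega> by simp
  obtain K where K: "compact K" "K \<subseteq> \<Omega>" "\<And>x. x \<notin> K \<Longrightarrow> \<phi> x = 0" "\<And>x. x \<notin> K \<Longrightarrow> gradient \<phi> x = 0"
    using test_function_support[OF \<phi>] by blast
  note c = continuous_on_test_function[OF \<phi>] continuous_on_test_function[OF \<psi>]
       continuous_on_gradient_test_function[OF \<phi>] continuous_on_gradient_test_function[OF \<psi>]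
  have c1: "continuous_on UNIV (\<lambda>x. \<phi> x *\<^sub>R gradient \<psi> x)" "continuous_on UNIV (\<lambda>x. \<psi> x *\<^sub>R gradient \<phi> x)"
    using c by (auto intro: continuous_intros)
  have i: "integrable ?M (\<lambda>x. \<phi> x *\<^sub>R gradient \<psi> x)" "integrable ?M (\<lambda>x. \<psi> x *\<^sub>R gradient \<phi> x)"
    using c1 K meas by (auto intro!: integrable_lebesgue_on_compact_support[where K=K])
  have "(LINT x|?M. \<phi> x *\<^sub>R gradient \<psi> x) + (LINT x|?M. \<psi> x *\<^sub>R gradient \<phi> x)
      = (LINT x|?M. \<phi> x *\<^sub>R gradient \<psi> x + \<psi> x *\<^sub>R gradient \<phi> x)"
    using i by simp
  also have "\<dots> = (LINT x|lborel. \<phi> x *\<^sub>R gradient \<psi> x + \<psi> x *\<^sub>R gradient \<phi> x)"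
  proof (rule integral_lebesgue_on_eq_lborel)
    show "(\<lambda>x. \<phi> x *\<^sub>R gradient \<psi> x + \<psi> x *\<^sub>R gradient \<phi> x) \<in> borel_measurable borel"
      by (intro borel_measurable_continuous_onI continuous_on_add c1)
    show "\<phi> x *\<^sub>R gradient \<psi> x + \<psi> x *\<^sub>R gradient \<phi> x = 0" if "x \<notin> \<Omega>" for x
    proof -
      have "x \<notin> K" using K(2) that by blast
      then show ?thesis using K(3,4) by simp
    qed
  qed (rule meas)
  also have "\<dots> = 0"
  proof (rule euclidean_eqI)
    fix b :: 'a
    have "integrable lborel (\<lambda>x. \<phi> x *\<^sub>R gradient \<psi> x + \<psi> x *\<^sub>R gradient \<phi> x)"
      using K(1,3,4) by (intro integrable_lborel_compact_support[where K=K] continuous_on_add c1) auto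
    then have "(LINT x|lborel. \<phi> x *\<^sub>R gradient \<psi> x + \<psi> x *\<^sub>R gradient \<phi> x) \<bullet> b
      = (LINT x|lborel. (\<phi> x *\<^sub>R gradient \<psi> x + \<psi> x *\<^sub>R gradient \<phi> x) \<bullet> b)"
      by (simp only: integral_inner_left)
    with gradient_mult_integral_0[OF \<phi> \<psi>, of b]
    show "(LINT x|lborel. \<phi> x *\<^sub>R gradient \<psi> x + \<psi> x *\<^sub>R gradient \<phi> x) \<bullet> b = 0 \<bullet> b"
      by simp
  qed
  finally show "(LINT x|?M. \<phi> x *\<^sub>R gradient \<psi> x) = - (LINT x|?M. \<psi> x *\<^sub>R gradient \<phi> x)"
    by (simp add: eq_neg_iff_add_eq_0)
qed

section \<open>The fundamental lemma of the calculus of variations\<close>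

text \<open>The sets over which \<open>g\<close> has integral \<open>0\<close> form a Dynkin system that contains the intersection-stable
generator of boxes, hence all Borel sets and, up to null sets, all Lebesgue sets.\<close>
lemma AE_zero_if_box_integrals_zero:
  fixes g :: "'a::euclidean_space \<Rightarrow> 'b::euclidean_space"
  assumes g: "integrable lebesgue g"
    and box: "\<And>a b. (LINT x|lebesgue. indicator (box a b) x *\<^sub>R g x) = 0"
  shows "AE x in lebesgue. g x = 0"
proof -
  have gi: "integrable lebesgue (\<lambda>x. indicator A x *\<^sub>R g x)" if "A \<in> sets lebesgue" for A
    using that g by (rule integrable_mult_indicator)
  have whole: "integral\<^sup>L lebesgue g = 0"
  proof -
    let ?B = "\<lambda>n::nat. box (- (real n *\<^sub>R One)) (real n *\<^sub>R One) :: 'a set"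
    have "(\<lambda>n. LINT x|lebesgue. indicator (?B n) x *\<^sub>R g x) \<longlonglongrightarrow> integral\<^sup>L lebesgue g"
    proof (rule integral_dominated_convergence[where w = "\<lambda>x. norm (g x)"])
      show "AE x in lebesgue. (\<lambda>n. indicator (?B n) x *\<^sub>R g x) \<longlonglongrightarrow> g x"
      proof (rule AE_I2)
        fix x :: 'a
        obtain N :: nat where N: "norm x < real N" using reals_Archimedean2 by blast
        have "x \<in> ?B n" if "n \<ge> N" for n
        proof -
          have "\<bar>x \<bullet> i\<bar> < real n" if "i \<in> Basis" for i
            using Basis_le_norm[OF that, of x] N \<open>n \<ge> N\<close> by linarith
          then show ?thesis by (auto simp: mem_box abs_less_iff) (smt (verit))
        qed
        then have "\<forall>\<^sub>F n in sequentially. g x = indicator (?B n) x *\<^sub>R g x"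
          by (intro eventually_sequentiallyI[of N]) auto
        then show "(\<lambda>n. indicator (?B n) x *\<^sub>R g x) \<longlonglongrightarrow> g x"
          by (rule Lim_transform_eventually[OF tendsto_const])
      qed
      show "(\<lambda>x. indicator (?B n) x *\<^sub>R g x) \<in> borel_measurable lebesgue" for n
        by (rule borel_measurable_integrable[OF gi]) simp
    qed (use g in \<open>auto simp: indicator_def\<close>)
    then show ?thesis using box by (simp add: LIMSEQ_const_iff)
  qed
  have borel: "(LINT x|lebesgue. indicator A x *\<^sub>R g x) = 0" if "A \<in> sets borel" for A
  proof -
    let ?G = "range (\<lambda>(a, b). box a b::'a set)"
    have A: "A \<in> sigma_sets UNIV ?G" using that by (simp add: borel_eq_box)
    have leb: "A \<in> sets lebesgue" if "A \<in> sigma_sets UNIV ?G" for A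
    proof -
      have "A \<in> sets borel" using that by (simp add: borel_eq_box)
      then show ?thesis by simp
    qed
    have "Int_stable ?G" "?G \<subseteq> Pow UNIV" by (auto simp: Int_stable_def box_Int_box)
    then show ?thesis using A
    proof (induction rule: sigma_sets_induct_disjoint)
      case (basic A)
      then show ?case using box by auto
    next
      case (compl A)
      have "(\<lambda>x. indicator (UNIV - A) x *\<^sub>R g x) = (\<lambda>x. g x - indicator A x *\<^sub>R g x)"
        by (auto simp: indicator_def)
      then show ?case using compl gi[OF leb] g whole by simp
    next
      case (union A)
      have m: "range A \<subseteq> sets lebesgue" using union leb by blast
      have "set_lebesgue_integral lebesgue (\<Union> (range A)) g = (\<Sum>i. set_lebesgue_integral lebesgue (A i) g)"
      proof (rule lebesgue_integral_countable_add)
        show "A i \<inter> A j = {}" if "i \<noteq> j" for i j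
          using union(1) that by (auto simp: disjoint_family_on_def)
        show "set_integrable lebesgue (\<Union> (range A)) g"
          unfolding set_integrable_def using m by (intro gi) blast
      qed (use m in auto)
      then show ?case using union(3) by (simp add: set_lebesgue_integral_def)
    qed auto
  qed
  show ?thesis
  proof (rule sigma_finite_measure.density_zero)
    show "sigma_finite_measure (lebesgue :: 'a measure)"
    proof
      let ?B = "(\<lambda>n::nat. cball (0::'a) (real n)) ` UNIV"
      have "x \<in> \<Union>?B" for x :: 'a
        using reals_Archimedean2[of "norm x"] by (auto intro: less_imp_le)
      then show "\<exists>A. countable A \<and> A \<subseteq> sets (lebesgue :: 'a measure) \<and> \<Union>A = space lebesgue \<and>
          (\<forall>a\<in>A. emeasure lebesgue a \<noteq> \<infinity>)"
        using emeasure_lborel_cball_finite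
        by (intro exI[of _ ?B]) (auto simp: emeasure_completion less_top)
    qed
    fix A :: "'a set" assume "A \<in> sets lebesgue"
    then obtain S N N' where A: "A = S \<union> N" "N \<subseteq> N'" "N' \<in> null_sets lborel" "S \<in> sets lborel"
      by (auto elim: sets_completionE)
    have "N' \<in> null_sets lebesgue" using A(3) by (simp add: null_sets_completionI)
    then have "AE x in lebesgue. x \<notin> N'" by (simp add: AE_not_in)
    then have "AE x in lebesgue. indicator A x *\<^sub>R g x = indicator S x *\<^sub>R g x"
      by eventually_elim (use A(1,2) in \<open>auto simp: indicator_def\<close>)
    then have "(LINT x|lebesgue. indicator A x *\<^sub>R g x) = (LINT x|lebesgue. indicator S x *\<^sub>R g x)"
      using g gi \<open>A \<in> sets lebesgue\<close> A(4) by (intro integral_cong_AE) (auto intro!: borel_measurable_integrable gi)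
    then show "set_lebesgue_integral lebesgue A g = 0"
      using borel[of S] A(4) by (simp add: set_lebesgue_integral_def)
  qed (rule g)
qed

lemma integrable_lebesgue_on_supersetI:
  fixes f :: "'a::euclidean_space \<Rightarrow> 'b::euclidean_space"
  assumes "integrable (lebesgue_on K) f" "\<And>x. x \<notin> K \<Longrightarrow> f x = 0"
    "K \<in> sets lebesgue" "S \<in> sets lebesgue" "K \<subseteq> S"
  shows "integrable (lebesgue_on S) f"
proof -
  have "integrable lebesgue (\<lambda>x. indicator K x *\<^sub>R f x)"
    using assms by (simp add: integrable_restrict_space)
  also have "(\<lambda>x. indicator K x *\<^sub>R f x) = (\<lambda>x. indicator S x *\<^sub>R f x)"
    using assms(2,5) by (auto simp: indicator_def fun_eq_iff)
  finally show ?thesis using assms by (simp add: integrable_restrict_space)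
qed

lemma compact_in_sets_lebesgue: "compact (K :: 'a::euclidean_space set) \<Longrightarrow> K \<in> sets lebesgue"
  by (simp add: compact_imp_closed)

lemma integrable_continuous_scaleR_locally_integrable:
  fixes G :: "'a::euclidean_space \<Rightarrow> 'b::euclidean_space" and \<phi> :: "'a \<Rightarrow> real"
  assumes "locally_integrable_on G \<Omega>" "continuous_on UNIV \<phi>"
    "compact K" "K \<subseteq> \<Omega>" "\<And>x. x \<notin> K \<Longrightarrow> \<phi> x = 0" "open \<Omega>"
  shows "integrable (lebesgue_on \<Omega>) (\<lambda>x. \<phi> x *\<^sub>R G x)"
proof (rule integrable_lebesgue_on_supersetI[where K=K])
  have G: "integrable (lebesgue_on K) G"
    using assms by (auto simp: locally_integrable_on_def)
  have "compact (\<phi> ` K)" using assms compact_continuous_image continuous_on_subset by blast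
  then obtain M where M: "\<And>x. x \<in> K \<Longrightarrow> \<bar>\<phi> x\<bar> \<le> M"
    using compact_imp_bounded by (fastforce simp: bounded_iff)
  have "\<phi> \<in> borel_measurable borel" using assms(2) by (rule borel_measurable_continuous_onI)
  then have m: "\<phi> \<in> borel_measurable (lebesgue_on K)"
    by (simp add: measurable_completion measurable_restrict_space1)
  show "integrable (lebesgue_on K) (\<lambda>x. \<phi> x *\<^sub>R G x)"
  proof (rule Bochner_Integration.integrable_bound[OF integrable_scaleR_right[OF G, of M]])
    show "AE x in lebesgue_on K. norm (\<phi> x *\<^sub>R G x) \<le> norm (M *\<^sub>R G x)"
      using M by (intro AE_I2) (auto intro!: mult_right_mono dest: order_trans[OF M abs_ge_self])
  qed (use m G in measurable)
qed (use assms compact_in_sets_lebesgue in auto)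

lemma integrable_locally_integrable_scaleR_continuous:
  fixes u :: "'a::euclidean_space \<Rightarrow> real" and \<psi> :: "'a \<Rightarrow> 'b::euclidean_space"
  assumes "locally_integrable_on u \<Omega>" "continuous_on UNIV \<psi>"
    "compact K" "K \<subseteq> \<Omega>" "\<And>x. x \<notin> K \<Longrightarrow> \<psi> x = 0" "open \<Omega>"
  shows "integrable (lebesgue_on \<Omega>) (\<lambda>x. u x *\<^sub>R \<psi> x)"
proof -
  have "integrable (lebesgue_on \<Omega>) (\<lambda>x. ((\<psi> x \<bullet> b) *\<^sub>R u x) *\<^sub>R b)" for b
    using assms by (intro integrable_scaleR_left integrable_continuous_scaleR_locally_integrable[where K=K])
      (auto intro!: continuous_intros)
  then have "integrable (lebesgue_on \<Omega>) (\<lambda>x. \<Sum>b\<in>Basis. ((\<psi> x \<bullet> b) *\<^sub>R u x) *\<^sub>R b)"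
    by simp
  moreover have "(\<Sum>b\<in>Basis. ((\<psi> x \<bullet> b) *\<^sub>R u x) *\<^sub>R b) = u x *\<^sub>R \<psi> x" for x
  proof -
    have "(\<Sum>b\<in>Basis. ((\<psi> x \<bullet> b) *\<^sub>R u x) *\<^sub>R b) = u x *\<^sub>R (\<Sum>b\<in>Basis. (\<psi> x \<bullet> b) *\<^sub>R b)"
      by (simp add: scaleR_sum_right mult.commute)
    then show ?thesis by (simp add: euclidean_representation)
  qed
  ultimately show ?thesis by simp
qed

lemma integrable_test_scaleR:
  assumes "locally_integrable_on G \<Omega>" "\<phi> \<in> test_functions \<Omega>" "open \<Omega>"
  shows "integrable (lebesgue_on \<Omega>) (\<lambda>x. \<phi> x *\<^sub>R G x)"
proof -
  obtain K where "compact K" "K \<subseteq> \<Omega>" "\<And>x. x \<notin> K \<Longrightarrow> \<phi> x = 0"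
    using test_function_support[OF assms(2)] by blast
  then show ?thesis
    using assms continuous_on_test_function[OF assms(2)]
    by (intro integrable_continuous_scaleR_locally_integrable)
qed

lemma integrable_scaleR_gradient_test:
  assumes "locally_integrable_on u \<Omega>" "\<phi> \<in> test_functions \<Omega>" "open \<Omega>"
  shows "integrable (lebesgue_on \<Omega>) (\<lambda>x. u x *\<^sub>R gradient \<phi> x)"
proof -
  obtain K where "compact K" "K \<subseteq> \<Omega>" "\<And>x. x \<notin> K \<Longrightarrow> gradient \<phi> x = 0"
    using test_function_support[OF assms(2)] by blast
  then show ?thesis
    using assms continuous_on_gradient_test_function[OF assms(2)]
    by (intro integrable_locally_integrable_scaleR_continuous)
qed

text \<open>The smooth bumps on the box converge boundedly to its indicator function.\<close>
lemma box_integral_zero_if_test_integrals_zero: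
  fixes G :: "'a::euclidean_space \<Rightarrow> 'b::euclidean_space"
  assumes G: "locally_integrable_on G \<Omega>" and \<Omega>: "open \<Omega>"
    and zero: "\<And>\<phi>. \<phi> \<in> test_functions \<Omega> \<Longrightarrow> (LINT x|lebesgue_on \<Omega>. \<phi> x *\<^sub>R G x) = 0"
    and ab: "cbox a b \<subseteq> \<Omega>"
  shows "(LINT x|lebesgue. indicator (box a b) x *\<^sub>R G x) = 0"
proof -
  have cb: "cbox a b \<in> sets lebesgue" by simp
  have Gi: "integrable lebesgue (\<lambda>x. indicator (cbox a b) x *\<^sub>R G x)"
    using G ab cb unfolding locally_integrable_on_def
    by (subst integrable_restrict_space[symmetric]) auto
  define \<phi> where "\<phi> k x = (\<Prod>i\<in>Basis. flat 1 (real (Suc k) * (x \<bullet> i - a \<bullet> i)) * flat 1 (real (Suc k) * (b \<bullet> i - x \<bullet> i)))"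
    for k and x :: 'a
  have \<phi>: "\<phi> k \<in> test_functions \<Omega>" for k
    unfolding \<phi>_def by (rule box_bump_in_test_functions[OF ab]) simp
  have bd: "0 \<le> \<phi> k x" "\<phi> k x \<le> 1" for k x
    unfolding \<phi>_def using flat_1_bounds
    by (auto intro!: prod_nonneg prod_le_1 mult_le_one)
  have out: "\<phi> k x = 0" if xab: "x \<notin> cbox a b" for k x
  proof -
    obtain i where i: "i \<in> Basis" "\<not> (a \<bullet> i \<le> x \<bullet> i \<and> x \<bullet> i \<le> b \<bullet> i)"
      using xab unfolding mem_box by blast
    have "flat 1 (real (Suc k) * (x \<bullet> i - a \<bullet> i)) * flat 1 (real (Suc k) * (b \<bullet> i - x \<bullet> i)) = 0"
      using i(2) by (auto simp: flat_def mult_le_0_iff not_le)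
    then show ?thesis unfolding \<phi>_def using i(1) by (intro prod_zero) auto
  qed
  have eq: "indicator \<Omega> x *\<^sub>R (\<phi> k x *\<^sub>R G x) = \<phi> k x *\<^sub>R (indicator (cbox a b) x *\<^sub>R G x)" for k x
    using out[of x k] ab by (auto simp: indicator_def)
  have "(\<lambda>k. LINT x|lebesgue. indicator \<Omega> x *\<^sub>R (\<phi> k x *\<^sub>R G x))
      \<longlonglongrightarrow> (LINT x|lebesgue. indicator (box a b) x *\<^sub>R (indicator (cbox a b) x *\<^sub>R G x))"
  proof (rule integral_dominated_convergence)
    show "integrable lebesgue (\<lambda>x. norm (indicator (cbox a b) x *\<^sub>R G x))"
      using Gi by (rule integrable_norm)
    show "AE x in lebesgue. (\<lambda>k. indicator \<Omega> x *\<^sub>R (\<phi> k x *\<^sub>R G x)) \<longlonglongrightarrow> indicator (box a b) x *\<^sub>R (indicator (cbox a b) x *\<^sub>R G x)"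
      unfolding eq unfolding \<phi>_def by (intro AE_I2 tendsto_scaleR box_bump_limit tendsto_const)
    show "AE x in lebesgue. norm (indicator \<Omega> x *\<^sub>R (\<phi> k x *\<^sub>R G x)) \<le> norm (indicator (cbox a b) x *\<^sub>R G x)" for k
      unfolding eq norm_scaleR[of "\<phi> k _"] abs_of_nonneg[OF bd(1)]
      by (intro AE_I2 mult_left_le_one_le norm_ge_zero bd)
    show "(\<lambda>x. indicator (box a b) x *\<^sub>R (indicator (cbox a b) x *\<^sub>R G x)) \<in> borel_measurable lebesgue"
      by (intro borel_measurable_integrable integrable_mult_indicator Gi) simp
    show "(\<lambda>x. indicator \<Omega> x *\<^sub>R (\<phi> k x *\<^sub>R G x)) \<in> borel_measurable lebesgue" for k
      using borel_measurable_integrable[OF integrable_test_scaleR[OF G \<phi> \<Omega>, of k]] \<Omega>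
      by (subst (asm) borel_measurable_restrict_space_iff) auto
  qed
  moreover have "(LINT x|lebesgue. indicator \<Omega> x *\<^sub>R (\<phi> k x *\<^sub>R G x)) = 0" for k
    using zero[OF \<phi>, of k] \<Omega> integral_restrict_space[of \<Omega> lebesgue "\<lambda>x. \<phi> k x *\<^sub>R G x"] by simp
  moreover have "(\<lambda>x. indicator (box a b) x *\<^sub>R (indicator (cbox a b) x *\<^sub>R G x)) = (\<lambda>x. indicator (box a b) x *\<^sub>R G x)"
    using box_subset_cbox[of a b] by (auto simp: indicator_def fun_eq_iff)
  ultimately have "(\<lambda>k::nat. 0) \<longlonglongrightarrow> (LINT x|lebesgue. indicator (box a b) x *\<^sub>R G x)" by (simp only:)
  then show ?thesis by (simp only: LIMSEQ_const_iff)
qed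

text \<open>A test on boxes compactly contained in \<open>\<Omega>\<close> suffices locally, and \<open>\<Omega>\<close> is a countable union of
such boxes. The intersection of two boxes is a box, so cutting \<open>G\<close> off outside one of them
makes the global statement about box integrals applicable.\<close>
theorem fundamental_lemma_calculus_of_variations:
  fixes G :: "'a::euclidean_space \<Rightarrow> 'b::euclidean_space"
  assumes G: "locally_integrable_on G \<Omega>" and \<Omega>: "open \<Omega>"
    and zero: "\<And>\<phi>. \<phi> \<in> test_functions \<Omega> \<Longrightarrow> (LINT x|lebesgue_on \<Omega>. \<phi> x *\<^sub>R G x) = 0"
  shows "AE x in lebesgue_on \<Omega>. G x = 0"
proof -
  have local: "AE x in lebesgue. x \<in> cbox c d \<longrightarrow> G x = 0" if cd: "cbox c d \<subseteq> \<Omega>" for c d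
  proof -
    have int: "integrable lebesgue (\<lambda>x. indicator (box c d) x *\<^sub>R G x)"
    proof -
      have "integrable lebesgue (\<lambda>x. indicator (cbox c d) x *\<^sub>R G x)"
        using G cd unfolding locally_integrable_on_def
        by (subst integrable_restrict_space[symmetric]) auto
      then have "integrable lebesgue (\<lambda>x. indicator (box c d) x *\<^sub>R (indicator (cbox c d) x *\<^sub>R G x))"
        by (rule integrable_mult_indicator[rotated]) simp
      moreover have "(\<lambda>x. indicator (box c d) x *\<^sub>R (indicator (cbox c d) x *\<^sub>R G x)) = (\<lambda>x. indicator (box c d) x *\<^sub>R G x)"
        using box_subset_cbox[of c d] by (auto simp: indicator_def fun_eq_iff)
      ultimately show ?thesis by (simp only:)
    qed
    have "AE x in lebesgue. indicator (box c d) x *\<^sub>R G x = 0"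
    proof (rule AE_zero_if_box_integrals_zero[OF int])
      fix a b :: 'a
      obtain a' b' where ab: "box a b \<inter> box c d = box a' b'"
        by (simp add: Int_interval box_Int_box)
      show "(LINT x|lebesgue. indicator (box a b) x *\<^sub>R (indicator (box c d) x *\<^sub>R G x)) = 0"
      proof (cases "box a' b' = {}")
        case True
        then have "(\<lambda>x. indicator (box a b) x *\<^sub>R (indicator (box c d) x *\<^sub>R G x)) = (\<lambda>x. 0)"
          using ab by (auto simp: indicator_def fun_eq_iff)
        then show ?thesis by (simp only: integral_zero)
      next
        case False
        have "box a' b' \<subseteq> cbox c d" using ab box_subset_cbox by blast
        then have "closure (box a' b') \<subseteq> cbox c d"
          by (rule closure_minimal) (rule closed_cbox)
        then have "cbox a' b' \<subseteq> \<Omega>"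
          using cd unfolding closure_box[OF False] by (rule order_trans)
        then have "(LINT x|lebesgue. indicator (box a' b') x *\<^sub>R G x) = 0"
          using zero by (intro box_integral_zero_if_test_integrals_zero[OF G \<Omega>]) auto
        moreover have "(\<lambda>x. indicator (box a b) x *\<^sub>R (indicator (box c d) x *\<^sub>R G x)) = (\<lambda>x. indicator (box a' b') x *\<^sub>R G x)"
          unfolding ab[symmetric] by (auto simp: indicator_def fun_eq_iff)
        ultimately show ?thesis by (simp only:)
      qed
    qed
    moreover have "AE x in lebesgue. x \<notin> cbox c d - box c d"
      using negligible_frontier_interval[of c d] by (intro AE_not_in) (simp add: negligible_iff_null_sets)
    ultimately show ?thesis by eventually_elim auto
  qed
  obtain D where D: "countable D" "D \<subseteq> Pow \<Omega>" "\<And>X. X \<in> D \<Longrightarrow> \<exists>a b. X = cbox a b" "\<Union>D = \<Omega>"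
    using open_countable_Union_open_cbox[OF \<Omega>] by metis
  have "AE x in lebesgue. \<forall>X\<in>D. x \<in> X \<longrightarrow> G x = 0"
    unfolding AE_ball_countable[OF D(1)]
  proof
    fix X assume "X \<in> D"
    then obtain a b where "X = cbox a b" "X \<subseteq> \<Omega>" using D by blast
    then show "AE x in lebesgue. x \<in> X \<longrightarrow> G x = 0" using local by blast
  qed
  then have "AE x in lebesgue. x \<in> \<Omega> \<longrightarrow> G x = 0"
    by eventually_elim (use D(4) in blast)
  then show ?thesis using \<Omega> by (simp add: AE_restrict_space_iff)
qed

section \<open>Weak gradients and Sobolev functions\<close>

lemma locally_integrable_lincomb:
  "locally_integrable_on G \<Omega> \<Longrightarrow> locally_integrable_on H \<Omega> \<Longrightarrow> locally_integrable_on (\<lambda>x. a *\<^sub>R G x + b *\<^sub>R H x) \<Omega>"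
  unfolding locally_integrable_on_def by auto

lemma has_weak_gradient_lincomb:
  assumes \<Omega>: "open \<Omega>" and u: "has_weak_gradient \<Omega> u G" and v: "has_weak_gradient \<Omega> v H"
  shows "has_weak_gradient \<Omega> (\<lambda>x. a * u x + b * v x) (\<lambda>x. a *\<^sub>R G x + b *\<^sub>R H x)"
  unfolding has_weak_gradient_def
proof (intro conjI ballI)
  let ?M = "lebesgue_on \<Omega>"
  have l: "locally_integrable_on u \<Omega>" "locally_integrable_on v \<Omega>" "locally_integrable_on G \<Omega>" "locally_integrable_on H \<Omega>"
    using u v by (auto simp: has_weak_gradient_def)
  then show "locally_integrable_on (\<lambda>x. a * u x + b * v x) \<Omega>" "locally_integrable_on (\<lambda>x. a *\<^sub>R G x + b *\<^sub>R H x) \<Omega>"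
    using locally_integrable_lincomb[of u \<Omega> v a b] locally_integrable_lincomb[of G \<Omega> H a b] by auto
  fix \<phi> assume \<phi>: "\<phi> \<in> test_functions \<Omega>"
  have i: "integrable ?M (\<lambda>x. u x *\<^sub>R gradient \<phi> x)" "integrable ?M (\<lambda>x. v x *\<^sub>R gradient \<phi> x)"
    "integrable ?M (\<lambda>x. \<phi> x *\<^sub>R G x)" "integrable ?M (\<lambda>x. \<phi> x *\<^sub>R H x)"
    using l \<phi> \<Omega> by (auto intro: integrable_test_scaleR integrable_scaleR_gradient_test)
  have "(LINT x|?M. (a * u x + b * v x) *\<^sub>R gradient \<phi> x)
     = (LINT x|?M. a *\<^sub>R (u x *\<^sub>R gradient \<phi> x) + b *\<^sub>R (v x *\<^sub>R gradient \<phi> x))"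
    by (simp add: scaleR_add_left)
  also have "\<dots> = a *\<^sub>R (LINT x|?M. u x *\<^sub>R gradient \<phi> x) + b *\<^sub>R (LINT x|?M. v x *\<^sub>R gradient \<phi> x)"
    using i by (simp only: Bochner_Integration.integral_add integrable_scaleR_right integral_scaleR_right)
  also have "\<dots> = - (a *\<^sub>R (LINT x|?M. \<phi> x *\<^sub>R G x) + b *\<^sub>R (LINT x|?M. \<phi> x *\<^sub>R H x))"
    using u v \<phi> by (simp add: has_weak_gradient_def)
  also have "a *\<^sub>R (LINT x|?M. \<phi> x *\<^sub>R G x) + b *\<^sub>R (LINT x|?M. \<phi> x *\<^sub>R H x)
     = (LINT x|?M. a *\<^sub>R (\<phi> x *\<^sub>R G x) + b *\<^sub>R (\<phi> x *\<^sub>R H x))"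
    using i by (simp only: Bochner_Integration.integral_add integrable_scaleR_right integral_scaleR_right)
  also have "\<dots> = (LINT x|?M. \<phi> x *\<^sub>R (a *\<^sub>R G x + b *\<^sub>R H x))"
    by (simp add: scaleR_add_right mult.commute)
  finally show "(LINT x|?M. (a * u x + b * v x) *\<^sub>R gradient \<phi> x)
     = - (LINT x|?M. \<phi> x *\<^sub>R (a *\<^sub>R G x + b *\<^sub>R H x))" .
qed

lemma has_weak_gradient_unique:
  assumes \<Omega>: "open \<Omega>" and G: "has_weak_gradient \<Omega> u G" and H: "has_weak_gradient \<Omega> u H"
  shows "AE x in lebesgue_on \<Omega>. G x = H x"
proof -
  have "has_weak_gradient \<Omega> (\<lambda>x. 1 * u x + (-1) * u x) (\<lambda>x. 1 *\<^sub>R G x + (-1) *\<^sub>R H x)"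
    by (rule has_weak_gradient_lincomb[OF \<Omega> G H])
  then have "AE x in lebesgue_on \<Omega>. G x - H x = 0"
    by (intro fundamental_lemma_calculus_of_variations[OF _ \<Omega>]) (auto simp: has_weak_gradient_def)
  then show ?thesis by simp
qed

lemma has_weak_gradient_weak_grad:
  "has_weak_gradient \<Omega> u G \<Longrightarrow> has_weak_gradient \<Omega> u (weak_grad \<Omega> u)"
  unfolding weak_grad_def by (rule someI[where P = "has_weak_gradient \<Omega> u"])

lemma borel_measurable_lebesgue_on_AE:
  fixes G :: "'a::euclidean_space \<Rightarrow> 'b::euclidean_space"
  assumes "G \<in> borel_measurable (lebesgue_on \<Omega>)" "AE x in lebesgue_on \<Omega>. G x = H x" "\<Omega> \<in> sets lebesgue"
  shows "H \<in> borel_measurable (lebesgue_on \<Omega>)"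
proof -
  have "(\<lambda>x. indicator \<Omega> x *\<^sub>R G x) \<in> borel_measurable lebesgue"
    using assms by (subst (asm) borel_measurable_restrict_space_iff) auto
  moreover have "AE x in lebesgue. indicator \<Omega> x *\<^sub>R G x = indicator \<Omega> x *\<^sub>R H x"
    using assms(2,3) by (subst (asm) AE_restrict_space_iff) (auto elim!: eventually_mono simp: indicator_def)
  ultimately have "(\<lambda>x. indicator \<Omega> x *\<^sub>R H x) \<in> borel_measurable lebesgue"
    by (rule borel_measurable_AE)
  then show ?thesis using assms(3) by (subst borel_measurable_restrict_space_iff) auto
qed

lemma Lp_on_cong_AE:
  assumes "G \<in> Lp_on \<Omega> p" "AE x in lebesgue_on \<Omega>. G x = H x" "\<Omega> \<in> sets lebesgue"
  shows "H \<in> Lp_on \<Omega> p"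
proof -
  have H: "H \<in> borel_measurable (lebesgue_on \<Omega>)"
    using assms borel_measurable_lebesgue_on_AE by (auto simp: Lp_on_def)
  have "integrable (lebesgue_on \<Omega>) (\<lambda>x. norm (H x) powr p) \<longleftrightarrow> integrable (lebesgue_on \<Omega>) (\<lambda>x. norm (G x) powr p)"
    using H assms by (intro integrable_cong_AE) (auto simp: Lp_on_def)
  with H assms(1) show ?thesis by (auto simp: Lp_on_def)
qed

lemma norm_add_powr_le:
  fixes a b :: "'a::real_normed_vector"
  assumes "0 < p"
  shows "norm (a + b) powr p \<le> 2 powr p * (norm a powr p + norm b powr p)"
proof -
  have "norm (a + b) powr p \<le> (2 * max (norm a) (norm b)) powr p"
    using assms norm_triangle_ineq[of a b] by (intro powr_mono2) auto
  also have "\<dots> = 2 powr p * max (norm a) (norm b) powr p" by (simp add: powr_mult)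
  also have "max (norm a) (norm b) powr p \<le> norm a powr p + norm b powr p"
    by (cases "norm a \<le> norm b") (auto simp: max_def)
  finally show ?thesis by simp
qed

lemma Lp_on_scaleR:
  assumes "G \<in> Lp_on \<Omega> p"
  shows "(\<lambda>x. a *\<^sub>R G x) \<in> Lp_on \<Omega> p"
  using assms by (auto simp: Lp_on_def powr_mult)

lemma Lp_on_add:
  assumes "0 < p" "G \<in> Lp_on \<Omega> p" "H \<in> Lp_on \<Omega> p"
  shows "(\<lambda>x. G x + H x) \<in> Lp_on \<Omega> p"
proof -
  let ?M = "lebesgue_on \<Omega>"
  have m: "G \<in> borel_measurable ?M" "H \<in> borel_measurable ?M"
    and i: "integrable ?M (\<lambda>x. norm (G x) powr p)" "integrable ?M (\<lambda>x. norm (H x) powr p)"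
    using assms by (auto simp: Lp_on_def)
  have "integrable ?M (\<lambda>x. 2 powr p * (norm (G x) powr p + norm (H x) powr p))"
    using i by simp
  then have "integrable ?M (\<lambda>x. norm (G x + H x) powr p)"
    by (rule Bochner_Integration.integrable_bound) (use m norm_add_powr_le[OF assms(1)] in auto)
  with m show ?thesis by (auto simp: Lp_on_def)
qed

lemma Lp_on_lincomb:
  assumes "0 < p" "G \<in> Lp_on \<Omega> p" "H \<in> Lp_on \<Omega> p"
  shows "(\<lambda>x. a *\<^sub>R G x + b *\<^sub>R H x) \<in> Lp_on \<Omega> p"
  using assms by (intro Lp_on_add Lp_on_scaleR)

lemma le_one_plus_powr:
  fixes t :: real
  assumes "0 \<le> t" "1 \<le> p"
  shows "t \<le> 1 + t powr p"
proof (cases "t \<le> 1")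
  case False
  then have "t powr 1 \<le> t powr p" using assms by (intro powr_mono) auto
  then show ?thesis using False by simp
qed (simp add: add_increasing2)

lemma Lp_on_imp_locally_integrable:
  assumes "1 \<le> p" "G \<in> Lp_on \<Omega> p" "open \<Omega>"
  shows "locally_integrable_on G \<Omega>"
  unfolding locally_integrable_on_def
proof safe
  fix K assume K: "compact K" "K \<subseteq> \<Omega>"
  have mK: "K \<in> sets lebesgue" using K by (simp add: compact_in_sets_lebesgue)
  have m: "G \<in> borel_measurable (lebesgue_on K)"
  proof (rule measurable_restrict_mono)
    show "G \<in> borel_measurable (lebesgue_on \<Omega>)" using assms(2) unfolding Lp_on_def by blast
    show "K \<subseteq> \<Omega>" by (rule K(2))
  qed
  have "integrable (lebesgue_on K) (\<lambda>x. norm (G x) powr p)"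
  proof -
    have "integrable lebesgue (\<lambda>x. indicator \<Omega> x *\<^sub>R norm (G x) powr p)"
      using assms by (auto simp: Lp_on_def integrable_restrict_space)
    from integrable_mult_indicator[OF mK this]
    have "integrable lebesgue (\<lambda>x. indicator K x *\<^sub>R (indicator \<Omega> x *\<^sub>R norm (G x) powr p))" .
    also have "(\<lambda>x. indicator K x *\<^sub>R (indicator \<Omega> x *\<^sub>R norm (G x) powr p)) = (\<lambda>x. indicator K x *\<^sub>R norm (G x) powr p)"
      using K(2) by (auto simp: indicator_def fun_eq_iff)
    finally show ?thesis using mK by (simp add: integrable_restrict_space)
  qed
  moreover have "integrable (lebesgue_on K) (\<lambda>x. 1::real)"
    using borel_integrable_compact[OF K(1), of "\<lambda>x. 1::real"] mK K(1)
    by (simp add: integrable_restrict_space integrable_completion compact_imp_closed)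
  ultimately have "integrable (lebesgue_on K) (\<lambda>x. 1 + norm (G x) powr p)" by simp
  then show "integrable (lebesgue_on K) G"
    by (rule Bochner_Integration.integrable_bound) (use m le_one_plus_powr[OF _ assms(1)] in auto)
qed

text \<open>The chosen representative \<open>weak_grad \<Omega> u\<close> need not be the witness from the definition of the
Sobolev space, but by uniqueness it agrees with it almost everywhere.\<close>
lemma sobolevD:
  assumes "open \<Omega>" "u \<in> sobolev \<Omega> p"
  shows "u \<in> Lp_on \<Omega> p" "weak_grad \<Omega> u \<in> Lp_on \<Omega> p" "has_weak_gradient \<Omega> u (weak_grad \<Omega> u)"
proof -
  obtain G where G: "G \<in> Lp_on \<Omega> p" "has_weak_gradient \<Omega> u G"
    using assms(2) by (auto simp: sobolev_def)
  show "u \<in> Lp_on \<Omega> p" using assms(2) by (simp add: sobolev_def)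
  show w: "has_weak_gradient \<Omega> u (weak_grad \<Omega> u)"
    by (rule has_weak_gradient_weak_grad[OF G(2)])
  show "weak_grad \<Omega> u \<in> Lp_on \<Omega> p"
    using Lp_on_cong_AE[OF G(1) has_weak_gradient_unique[OF assms(1) G(2) w]] assms(1) by simp
qed

lemma sobolevI:
  assumes "open \<Omega>" "u \<in> Lp_on \<Omega> p" "G \<in> Lp_on \<Omega> p" "has_weak_gradient \<Omega> u G"
  shows "u \<in> sobolev \<Omega> p" "AE x in lebesgue_on \<Omega>. weak_grad \<Omega> u x = G x"
proof -
  show "u \<in> sobolev \<Omega> p" using assms by (auto simp: sobolev_def)
  show "AE x in lebesgue_on \<Omega>. weak_grad \<Omega> u x = G x"
    using has_weak_gradient_unique[OF assms(1) has_weak_gradient_weak_grad[OF assms(4)] assms(4)] .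
qed

lemma sobolev_lincomb:
  assumes "open \<Omega>" "0 < p" "u \<in> sobolev \<Omega> p" "v \<in> sobolev \<Omega> p"
  shows "(\<lambda>x. a * u x + b * v x) \<in> sobolev \<Omega> p"
    and "AE x in lebesgue_on \<Omega>. weak_grad \<Omega> (\<lambda>x. a * u x + b * v x) x = a *\<^sub>R weak_grad \<Omega> u x + b *\<^sub>R weak_grad \<Omega> v x"
proof -
  note u = sobolevD[OF assms(1,3)] and v = sobolevD[OF assms(1,4)]
  have *: "(\<lambda>x. a * u x + b * v x) \<in> Lp_on \<Omega> p"
    using Lp_on_lincomb[OF assms(2) u(1) v(1), of a b] by simp
  note ** = sobolevI[OF assms(1) * Lp_on_lincomb[OF assms(2) u(2) v(2), of a b]
      has_weak_gradient_lincomb[OF assms(1) u(3) v(3)]]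
  show "(\<lambda>x. a * u x + b * v x) \<in> sobolev \<Omega> p" 
    "AE x in lebesgue_on \<Omega>. weak_grad \<Omega> (\<lambda>x. a * u x + b * v x) x = a *\<^sub>R weak_grad \<Omega> u x + b *\<^sub>R weak_grad \<Omega> v x"
    by (rule **)+
qed

lemma test_function_Lp:
  assumes "open \<Omega>" "0 < p" "\<phi> \<in> test_functions \<Omega>"
  shows "\<phi> \<in> Lp_on \<Omega> p" "gradient \<phi> \<in> Lp_on \<Omega> p"
proof -
  obtain K where K: "compact K" "\<And>x. x \<notin> K \<Longrightarrow> \<phi> x = 0" "\<And>x. x \<notin> K \<Longrightarrow> gradient \<phi> x = 0"
    using test_function_support[OF assms(3)] by blast
  note c = continuous_on_test_function[OF assms(3)] continuous_on_gradient_test_function[OF assms(3)]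
  have m: "\<phi> \<in> borel_measurable (lebesgue_on \<Omega>)" "gradient \<phi> \<in> borel_measurable (lebesgue_on \<Omega>)"
    using c[THEN borel_measurable_continuous_onI] 
    by (simp_all add: measurable_completion measurable_restrict_space1)
  have c': "continuous_on UNIV (\<lambda>x. \<bar>\<phi> x\<bar> powr p)" "continuous_on UNIV (\<lambda>x. norm (gradient \<phi> x) powr p)"
    using assms(2) by (intro continuous_on_powr' continuous_on_rabs continuous_on_norm c continuous_on_const; simp)+
  have "integrable (lebesgue_on \<Omega>) (\<lambda>x. \<bar>\<phi> x\<bar> powr p)" "integrable (lebesgue_on \<Omega>) (\<lambda>x. norm (gradient \<phi> x) powr p)"
    using assms(1) by (intro integrable_lebesgue_on_compact_support[OF _ K(1)] c'; simp add: K(2,3))+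
  with m show "\<phi> \<in> Lp_on \<Omega> p" "gradient \<phi> \<in> Lp_on \<Omega> p"
    by (auto simp: Lp_on_def)
qed

lemma test_function_sobolev:
  assumes "open \<Omega>" "0 < p" "\<phi> \<in> test_functions \<Omega>"
  shows "\<phi> \<in> sobolev \<Omega> p" "AE x in lebesgue_on \<Omega>. weak_grad \<Omega> \<phi> x = gradient \<phi> x"
  using sobolevI[OF assms(1) test_function_Lp[OF assms] test_function_has_weak_gradient[OF assms(3,1)]] by auto

section \<open>Convexity of powers of the norm\<close>

text \<open>The graph of \<open>t \<mapsto> t powr p\<close> lies above its tangent at \<open>s\<close>; this is Young's inequality for the
product of \<open>t\<close> and \<open>s powr (p - 1)\<close>.\<close>
lemma powr_tangent:
  fixes s t p :: real
  assumes "1 < p" "0 \<le> s" "0 \<le> t"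
  shows "s powr p + p * s powr (p - 1) * (t - s) \<le> t powr p"
proof -
  let ?q = "p / (p - 1)"
  have "t * s powr (p - 1) \<le> t powr p / p + (s powr (p - 1)) powr ?q / ?q"
    using assms by (intro Youngs_inequality) (auto simp: field_simps)
  then have "p * (t * s powr (p - 1)) \<le> p * (t powr p / p + s powr p * (p - 1) / p)"
    using assms by (intro mult_left_mono) (auto simp: powr_powr)
  also have "\<dots> = t powr p + (p - 1) * s powr p" using assms by (simp add: field_simps)
  finally have "p * (t * s powr (p - 1)) \<le> t powr p + (p - 1) * s powr p" .
  moreover have "s powr (p - 1) * s = s powr p"
    using assms by (simp add: powr_mult_base mult.commute)
  ultimately show ?thesis by (simp add: algebra_simps)
qed

text \<open>Strictness comes from passing through the midpoint \<open>m\<close>: the slope at \<open>m\<close> differs from the slope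
at \<open>s\<close>, and the two tangent inequalities add up with a gain.\<close>
lemma powr_tangent_strict:
  fixes s t p :: real
  assumes "1 < p" "0 \<le> s" "0 \<le> t" "s \<noteq> t"
  shows "s powr p + p * s powr (p - 1) * (t - s) < t powr p"
proof -
  define m where "m = (s + t) / 2"
  have m: "0 \<le> m" "m - s = (t - s) / 2" "t - m = (t - s) / 2" using assms by (auto simp: m_def field_simps)
  have "0 < (m powr (p - 1) - s powr (p - 1)) * (t - m)"
  proof (cases "s < t")
    case True
    then have "s powr (p - 1) < m powr (p - 1)" using assms by (intro powr_less_mono2) (auto simp: m_def)
    then show ?thesis using True m by simp
  next
    case False
    then have "m powr (p - 1) < s powr (p - 1)" using assms by (intro powr_less_mono2) (auto simp: m_def)
    then show ?thesis using False assms m by (simp add: mult_neg_neg)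
  qed
  then have "0 < p * ((m powr (p - 1) - s powr (p - 1)) * (t - m))" using assms by simp
  moreover have "s powr p + p * s powr (p - 1) * (m - s) \<le> m powr p" "m powr p + p * m powr (p - 1) * (t - m) \<le> t powr p"
    using assms m by (auto intro: powr_tangent)
  moreover have "p * s powr (p - 1) * (t - s) = p * s powr (p - 1) * (m - s) + p * s powr (p - 1) * (t - m)"
    by (simp add: algebra_simps)
  ultimately show ?thesis by (simp add: algebra_simps)
qed

lemma powr_midpoint_le:
  fixes s t p :: real
  assumes "1 < p" "0 \<le> s" "0 \<le> t"
  shows "((s + t) / 2) powr p \<le> (s powr p + t powr p) / 2"
    and "((s + t) / 2) powr p = (s powr p + t powr p) / 2 \<Longrightarrow> s = t"
proof -
  let ?m = "(s + t) / 2"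
  have "p * ?m powr (p - 1) * (s - ?m) + p * ?m powr (p - 1) * (t - ?m) = 0"
    by (simp add: field_simps)
  moreover have "?m powr p + p * ?m powr (p - 1) * (s - ?m) \<le> s powr p" "?m powr p + p * ?m powr (p - 1) * (t - ?m) \<le> t powr p"
    using assms by (auto intro!: powr_tangent)
  ultimately show le: "?m powr p \<le> (s powr p + t powr p) / 2" by argo
  show "s = t" if "?m powr p = (s powr p + t powr p) / 2"
  proof (rule ccontr)
    assume "s \<noteq> t"
    then have "?m powr p + p * ?m powr (p - 1) * (s - ?m) < s powr p"
      using assms by (intro powr_tangent_strict) auto
    moreover have "?m powr p + p * ?m powr (p - 1) * (t - ?m) \<le> t powr p"
      using assms by (intro powr_tangent) auto
    moreover have "p * ?m powr (p - 1) * (s - ?m) + p * ?m powr (p - 1) * (t - ?m) = 0"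
      by (simp add: field_simps)
    ultimately show False using that by argo
  qed
qed

text \<open>Up to the factor \<open>p\<close> this is the gradient of \<open>norm a powr p\<close>; for \<open>a = 0\<close> it is \<open>0\<close> whatever
\<open>p\<close> is.\<close>
definition duality_map :: "real \<Rightarrow> 'a::real_inner \<Rightarrow> 'a" where
  "duality_map p a = norm a powr (p - 2) *\<^sub>R a"

lemma norm_duality_map: "norm (duality_map p a) = norm a powr (p - 1)"
proof (cases "a = 0")
  case False
  then have "norm a powr (p - 2) * norm a = norm a powr (p - 1)"
    using powr_add[of "norm a" "p - 2" 1] by simp
  then show ?thesis by (simp add: duality_map_def)
qed (simp add: duality_map_def)

lemma duality_map_inner_self: "duality_map p a \<bullet> a = norm a powr p"
proof (cases "a = 0")
  case False
  have "norm a powr (p - 2) * (norm a)\<^sup>2 = norm a powr p"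
    using False powr_add[of "norm a" "p - 2" 2] by simp
  then show ?thesis by (simp add: duality_map_def dot_square_norm)
qed (simp add: duality_map_def)

lemma duality_map_inner_le: "\<bar>duality_map p a \<bullet> b\<bar> \<le> norm a powr (p - 1) * norm b"
  using Cauchy_Schwarz_ineq2[of "duality_map p a" b] by (simp add: norm_duality_map)

text \<open>The convexity inequality on which everything rests: minimality of weak solutions, the
Euler-Lagrange equation and both estimates of the Dirichlet-to-Neumann map come from it.\<close>
lemma norm_powr_tangent:
  fixes a b :: "'a::real_inner"
  assumes "1 < p"
  shows "norm a powr p + p * (duality_map p a \<bullet> (b - a)) \<le> norm b powr p"
proof -
  have "p * (duality_map p a \<bullet> b) \<le> p * (norm a powr (p - 1) * norm b)"
    using duality_map_inner_le[of p a b] assms by (intro mult_left_mono) auto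
  moreover have e: "norm a powr (p - 1) * norm a = norm a powr p"
    using assms by (simp add: powr_mult_base mult.commute)
  moreover have "norm a powr p + p * norm a powr (p - 1) * (norm b - norm a) \<le> norm b powr p"
    using assms by (intro powr_tangent) auto
  moreover have "p * norm a powr (p - 1) * (norm b - norm a)
      = p * (norm a powr (p - 1) * norm b) - p * (norm a powr (p - 1) * norm a)"
    by (simp add: algebra_simps)
  moreover have "p * (duality_map p a \<bullet> (b - a)) = p * (duality_map p a \<bullet> b) - p * norm a powr p"
    by (simp add: inner_diff_right duality_map_inner_self right_diff_distrib)
  ultimately show ?thesis unfolding e by linarith
qed

lemma isCont_duality_map:
  assumes "1 < p"
  shows "isCont (duality_map p) (a::'a::real_inner)"
proof (cases "a = 0")
  case True
  have "((\<lambda>x::'a. norm x powr (p - 1)) \<longlongrightarrow> norm (0::'a) powr (p - 1)) (at 0)"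
    using assms by (intro tendsto_powr' tendsto_intros) auto
  then have "((\<lambda>x. norm (duality_map p (x::'a))) \<longlongrightarrow> 0) (at 0)"
    using assms by (simp add: norm_duality_map)
  then have "(duality_map p \<longlongrightarrow> (0::'a)) (at 0)" by (rule tendsto_norm_zero_cancel)
  moreover have "duality_map p (0::'a) = 0" by (simp add: duality_map_def)
  ultimately show ?thesis using True by (simp add: isCont_def)
next
  case False
  then show ?thesis unfolding duality_map_def by (intro continuous_intros) auto
qed

lemma borel_measurable_duality_map:
  fixes f :: "_ \<Rightarrow> 'b::euclidean_space"
  assumes "f \<in> borel_measurable M"
  shows "(\<lambda>x. duality_map p (f x)) \<in> borel_measurable M"
  unfolding duality_map_def using assms by measurable

lemma powr_inj_nonneg:
  fixes s t p :: real
  assumes "0 < p" "0 \<le> s" "0 \<le> t" "s powr p = t powr p"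
  shows "s = t"
proof (rule ccontr)
  assume "s \<noteq> t"
  then consider "s < t" | "t < s" by linarith
  then show False
  proof cases
    case 1
    from powr_less_mono2[OF assms(1,2) this] assms(4) show False by simp
  next
    case 2
    from powr_less_mono2[OF assms(1,3) this] assms(4) show False by simp
  qed
qed

text \<open>Equality forces \<open>norm a = norm b\<close> by strict convexity of the power, and then equality in the
triangle inequality, which makes \<open>a\<close> and \<open>b\<close> parallel.\<close>
lemma norm_powr_midpoint:
  fixes a b :: "'a::real_inner"
  assumes "1 < p"
  shows "norm ((1/2) *\<^sub>R (a + b)) powr p \<le> (norm a powr p + norm b powr p) / 2"
    and "norm ((1/2) *\<^sub>R (a + b)) powr p = (norm a powr p + norm b powr p) / 2 \<Longrightarrow> a = b"
proof -
  have le: "norm ((1/2) *\<^sub>R (a + b)) \<le> (norm a + norm b) / 2"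
    using norm_triangle_ineq[of a b] by simp
  have p: "0 \<le> p" using assms by simp
  have le': "norm ((1/2) *\<^sub>R (a + b)) powr p \<le> ((norm a + norm b) / 2) powr p"
    by (rule powr_mono2[OF p norm_ge_zero le])
  note mid = powr_midpoint_le[OF assms norm_ge_zero[of a] norm_ge_zero[of b]]
  show "norm ((1/2) *\<^sub>R (a + b)) powr p \<le> (norm a powr p + norm b powr p) / 2"
    using le' mid(1) by linarith
  assume eq: "norm ((1/2) *\<^sub>R (a + b)) powr p = (norm a powr p + norm b powr p) / 2"
  then have "((norm a + norm b) / 2) powr p = (norm a powr p + norm b powr p) / 2"
    using le' mid(1) by linarith
  then have ab: "norm a = norm b" by (rule mid(2))
  with eq have "norm ((1/2) *\<^sub>R (a + b)) powr p = norm a powr p" by simp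
  then have "norm ((1/2) *\<^sub>R (a + b)) = norm a"
    by (rule powr_inj_nonneg[rotated 3]) (use assms in auto)
  then have "norm (a + b) = norm a + norm b" using ab by simp
  then have "norm a *\<^sub>R b = norm b *\<^sub>R a" by (simp add: norm_triangle_eq)
  then show "a = b" using ab by (cases "a = 0") auto
qed

text \<open>A quantitative form of uniform convexity that works for all \<open>p > 1\<close> alike, in contrast to
Clarkson's inequalities. Both sides are homogeneous of degree \<open>p\<close>, so it suffices to look at the
compact set where the two powers add up to \<open>1\<close>. There the convexity defect has a positive minimum on
the part where \<open>a\<close> and \<open>b\<close> are far apart, and elsewhere the \<open>\<epsilon>\<close>-term is enough. The affine
form of the estimate can be integrated as it stands.\<close>
lemma uniform_convexity_powr:
  fixes p \<epsilon> :: real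
  assumes p: "1 < p" and \<epsilon>: "0 < \<epsilon>"
  obtains C where "0 \<le> C" "\<And>a b :: 'a::euclidean_space.
    norm (a - b) powr p \<le> \<epsilon> * (norm a powr p + norm b powr p)
      + C * ((norm a powr p + norm b powr p) / 2 - norm ((1/2) *\<^sub>R (a + b)) powr p)"
proof -
  define N where "N z = norm (fst z) powr p + norm (snd z) powr p" for z :: "'a \<times> 'a"
  define d where "d z = N z / 2 - norm ((1/2) *\<^sub>R (fst z + snd z)) powr p" for z :: "'a \<times> 'a"
  define T where "T = {z. N z = 1} \<inter> {z. \<epsilon> \<le> norm (fst z - snd z) powr p}"
  have c: "continuous_on UNIV N" "continuous_on UNIV (\<lambda>z::'a\<times>'a. norm (fst z - snd z) powr p)" "continuous_on UNIV d"
    unfolding N_def d_def using p by (intro continuous_on_powr' continuous_intros; simp)+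
  have d0: "0 \<le> d z" for z unfolding d_def N_def using norm_powr_midpoint(1)[OF p, of "fst z" "snd z"] by simp
  have "compact T"
    unfolding compact_eq_bounded_closed
  proof
    have "closed {z. N z = 1}" "closed {z::'a \<times> 'a. \<epsilon> \<le> norm (fst z - snd z) powr p}"
      using c by (auto intro!: closed_Collect_eq closed_Collect_le continuous_intros)
    then show "closed T" unfolding T_def by (rule closed_Int)
    show "bounded T" unfolding bounded_iff
    proof (intro exI ballI)
      fix z assume "z \<in> T"
      then have N1: "norm (fst z) powr p + norm (snd z) powr p = 1" by (simp add: T_def N_def)
      have "t \<le> 1" if "0 \<le> t" "t powr p \<le> 1" for t :: real
      proof (rule ccontr)
        assume "\<not> t \<le> 1"
        then have "1 powr p < t powr p" using p by (intro powr_less_mono2) auto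
        with that show False by simp
      qed
      then have "norm (fst z) \<le> 1" "norm (snd z) \<le> 1"
        using N1 powr_ge_zero[of "norm (fst z)" p] powr_ge_zero[of "norm (snd z)" p] 
        by (smt (verit) norm_ge_zero)+
      then show "norm z \<le> 2" using norm_Pair_le[of "fst z" "snd z"] by simp
    qed
  qed
  have "\<exists>m>0. \<forall>z\<in>T. m \<le> d z"
  proof (cases "T = {}")
    case False
    obtain z where z: "z \<in> T" "\<forall>w\<in>T. d z \<le> d w"
      using continuous_attains_inf[OF \<open>compact T\<close> False continuous_on_subset[OF c(3)]] by auto
    have "d z \<noteq> 0"
    proof
      assume "d z = 0"
      then have "norm ((1/2) *\<^sub>R (fst z + snd z)) powr p = (norm (fst z) powr p + norm (snd z) powr p) / 2"
        unfolding d_def N_def by linarith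
      then have "fst z = snd z" by (rule norm_powr_midpoint(2)[OF p])
      then show False using z(1) \<epsilon> p by (simp add: T_def)
    qed
    then have "0 < d z" using d0[of z] by simp
    then show ?thesis using z(2) by blast
  next
    case True
    then show ?thesis using zero_less_one by blast
  qed
  then obtain m where m: "0 < m" "\<And>z. z \<in> T \<Longrightarrow> m \<le> d z" by blast
  \<comment> \<open>On \<open>T\<close> the left-hand side is at most \<open>2 powr p\<close>, and the convexity defect \<open>d\<close> at least \<open>m\<close>.\<close>
  define C where "C = 2 powr p / m"
  have C0: "0 \<le> C" using m(1) by (simp add: C_def)
  have bound: "norm (a - b) powr p \<le> 2 powr p * (norm a powr p + norm b powr p)" for a b :: 'a
    using norm_add_powr_le[of p a "-b"] p by simp
  have unit: "norm (fst z - snd z) powr p \<le> \<epsilon> + C * d z" if N1: "N z = 1" for z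
  proof (cases "z \<in> T")
    case True
    have "norm (fst z - snd z) powr p \<le> 2 powr p"
      using bound[of "fst z" "snd z"] N1 by (simp add: N_def)
    also have "\<dots> \<le> 2 powr p * (d z / m)"
      using m(1) m(2)[OF True] by (simp add: le_divide_eq)
    finally show ?thesis using \<epsilon> by (simp add: C_def)
  next
    case False
    then have "norm (fst z - snd z) powr p \<le> \<epsilon>" using N1 by (simp add: T_def)
    then show ?thesis using C0 d0[of z] by (simp add: add_increasing2)
  qed
  have "norm (a - b) powr p \<le> \<epsilon> * N (a, b) + C * d (a, b)" for a b :: 'a
  proof (cases "N (a, b) = 0")
    case True
    then have "norm a powr p = 0" "norm b powr p = 0"
      unfolding N_def fst_conv snd_conv using powr_ge_zero[of "norm a" p] powr_ge_zero[of "norm b" p] by linarith+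
    then have "a = 0" "b = 0" by auto
    then show ?thesis using p by (simp add: N_def d_def)
  next
    case False
    define r where "r = N (a, b) powr (- 1 / p)"
    have Npos: "0 < N (a, b)" using False powr_ge_zero[of "norm a" p] powr_ge_zero[of "norm b" p]
      unfolding N_def fst_conv snd_conv by linarith
    have r: "0 < r" "r powr p * N (a, b) = 1"
    proof -
      show "0 < r" using Npos by (simp add: r_def)
      have "r powr p = N (a, b) powr (- 1)" using p by (simp add: r_def powr_powr)
      then show "r powr p * N (a, b) = 1" using Npos by (simp add: powr_minus powr_one)
    qed
    have sc: "norm (r *\<^sub>R v) powr p = r powr p * norm v powr p" for v :: 'a
      using r(1) by (simp add: powr_mult)
    have Nr: "N (r *\<^sub>R a, r *\<^sub>R b) = r powr p * N (a, b)"
      by (simp add: N_def sc algebra_simps del: norm_scaleR)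
    have dr: "d (r *\<^sub>R a, r *\<^sub>R b) = r powr p * d (a, b)"
    proof -
      have "(1/2) *\<^sub>R (r *\<^sub>R a + r *\<^sub>R b) = r *\<^sub>R ((1/2) *\<^sub>R (a + b))" by (simp add: algebra_simps)
      then show ?thesis by (simp only: d_def Nr fst_conv snd_conv sc) (simp add: algebra_simps)
    qed
    have "norm (r *\<^sub>R a - r *\<^sub>R b) powr p \<le> \<epsilon> + C * d (r *\<^sub>R a, r *\<^sub>R b)"
      using unit[of "(r *\<^sub>R a, r *\<^sub>R b)"] r(2) Nr by simp
    then have "r powr p * norm (a - b) powr p \<le> \<epsilon> + C * (r powr p * d (a, b))"
      unfolding dr scaleR_diff_right[symmetric] sc .
    also have "\<dots> = r powr p * (\<epsilon> * N (a, b) + C * d (a, b))"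
      using r(2) by (simp add: algebra_simps)
    finally show ?thesis using r(1) by (simp add: mult_le_cancel_left)
  qed
  then show ?thesis using that C0 by (simp add: N_def d_def)
qed

section \<open>Convergence in the p-th mean\<close>

text \<open>The free weight \<open>t\<close> makes this a substitute for Hoelder's inequality in limit arguments: the first
summand becomes small with \<open>t\<close>, the second one afterwards.\<close>
lemma powr_young_weighted:
  fixes a b t p :: real
  assumes "1 < p" "0 \<le> a" "0 \<le> b" "0 < t"
  shows "a powr (p - 1) * b \<le> t * a powr p + t powr (1 - p) * b powr p"
proof (cases "b \<le> t * a")
  case True
  have "a powr (p - 1) * b \<le> a powr (p - 1) * (t * a)" using True by (intro mult_left_mono) auto
  also have "\<dots> = t * a powr p" using assms by (simp add: powr_mult_base mult.commute mult.left_commute)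
  finally show ?thesis by (simp add: add_increasing2)
next
  case False
  then have "a powr (p - 1) \<le> (b / t) powr (p - 1)"
    using assms by (intro powr_mono2) (auto simp: field_simps)
  then have "a powr (p - 1) * b \<le> (b / t) powr (p - 1) * b" using assms by (intro mult_right_mono) auto
  also have "(b / t) powr (p - 1) = t powr (1 - p) * b powr (p - 1)"
    using assms powr_minus_divide[of t "p - 1"] by (simp add: powr_divide)
  also have "t powr (1 - p) * b powr (p - 1) * b = t powr (1 - p) * b powr p"
    using assms by (simp add: powr_mult_base mult.commute mult.left_commute)
  finally show ?thesis using assms by (simp add: add_increasing)
qed

lemma integral_tendsto_0_if_powr_tendsto_0:
  fixes h :: "nat \<Rightarrow> 'x \<Rightarrow> 'b::{banach, second_countable_topology}" and a :: "'x \<Rightarrow> real"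
  assumes p: "1 < p" and C: "0 \<le> C"
    and a: "\<And>x. 0 \<le> a x" "integrable M (\<lambda>x. a x powr p)"
    and b: "\<And>k x. 0 \<le> b k x" "\<And>k. integrable M (\<lambda>x. b k x powr p)" "(\<lambda>k. LINT x|M. b k x powr p) \<longlonglongrightarrow> 0"
    and h: "\<And>k. h k \<in> borel_measurable M" "\<And>k. AE x in M. norm (h k x) \<le> C * (a x powr (p - 1) * b k x)"
  shows "(\<lambda>k. integral\<^sup>L M (h k)) \<longlonglongrightarrow> 0"
proof (rule tendsto_norm_zero_cancel, rule LIMSEQ_I)
  let ?A = "LINT x|M. a x powr p"
  fix e :: real assume e: "0 < e"
  have A0: "0 \<le> ?A" by (intro integral_nonneg_AE) auto
  \<comment> \<open>The weight \<open>t\<close> keeps the first summand of the Young bound below \<open>e / 2\<close> for all \<open>k\<close>.\<close>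
  define t where "t = e / (2 * (C * ?A + 1))"
  have CA: "0 \<le> C * ?A" using C A0 by simp
  then have t: "0 < t" using e by (simp add: t_def)
  have tA: "C * (t * ?A) < e"
  proof -
    have "C * (t * ?A) = e * (C * ?A) / (2 * (C * ?A + 1))" by (simp add: t_def)
    also have "\<dots> < e" using e CA by (simp add: divide_less_eq)
    finally show ?thesis .
  qed
  have "(\<lambda>k. C * (t * ?A + t powr (1 - p) * (LINT x|M. b k x powr p))) \<longlonglongrightarrow> C * (t * ?A + t powr (1 - p) * 0)"
    by (intro tendsto_intros b(3))
  then have "\<forall>\<^sub>F k in sequentially. C * (t * ?A + t powr (1 - p) * (LINT x|M. b k x powr p)) < e"
    using tA by (intro order_tendstoD) auto
  then obtain n where n: "\<And>k. k \<ge> n \<Longrightarrow> C * (t * ?A + t powr (1 - p) * (LINT x|M. b k x powr p)) < e"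
    by (auto simp: eventually_sequentially)
  show "\<exists>no. \<forall>k\<ge>no. norm (norm (integral\<^sup>L M (h k)) - 0) < e"
  proof (intro exI allI impI)
    fix k assume "k \<ge> n"
    have int: "integrable M (\<lambda>x. C * (t * a x powr p + t powr (1 - p) * b k x powr p))"
      using a(2) b(2) by simp
    have le: "AE x in M. norm (h k x) \<le> C * (t * a x powr p + t powr (1 - p) * b k x powr p)"
      using h(2)[of k]
    proof eventually_elim
      case (elim x)
      also have "C * (a x powr (p - 1) * b k x) \<le> C * (t * a x powr p + t powr (1 - p) * b k x powr p)"
        using powr_young_weighted[OF p a(1) b(1) t] C by (intro mult_left_mono) auto
      finally show ?case .
    qed
    have hi: "integrable M (h k)"
      by (rule Bochner_Integration.integrable_bound[OF int h(1)])
        (use le in eventually_elim, smt (verit) real_norm_def)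
    have "norm (integral\<^sup>L M (h k)) \<le> (LINT x|M. norm (h k x))" by (rule integral_norm_bound)
    also have "\<dots> \<le> (LINT x|M. C * (t * a x powr p + t powr (1 - p) * b k x powr p))"
      using hi int le by (intro integral_mono_AE) auto
    also have "\<dots> = C * (t * ?A + t powr (1 - p) * (LINT x|M. b k x powr p))"
      using a(2) b(2) by simp
    also have "\<dots> < e" using n \<open>k \<ge> n\<close> by blast
    finally show "norm (norm (integral\<^sup>L M (h k)) - 0) < e" by simp
  qed
qed

text \<open>Along a subsequence the consecutive distances decay so fast that, by Markov's inequality and
Borel-Cantelli, almost every point eventually sees increments below \<open>(1/2) ^ n\<close>.\<close>
lemma Lp_Cauchy_AE_convergent_subsequence:
  fixes g :: "nat \<Rightarrow> 'x \<Rightarrow> 'b::euclidean_space"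
  assumes p: "0 < p" and m: "\<And>k. g k \<in> borel_measurable M"
    and i: "\<And>j k. integrable M (\<lambda>x. norm (g j x - g k x) powr p)"
    and cauchy: "\<And>e. 0 < e \<Longrightarrow> \<exists>N. \<forall>j\<ge>N. \<forall>k\<ge>N. (LINT x|M. norm (g j x - g k x) powr p) < e"
  obtains r where "\<And>n. n \<le> r n" "AE x in M. convergent (\<lambda>n. g (r n) x)"
proof -
  \<comment> \<open>The second factor cancels in Markov's inequality for increments of size \<open>(1/2) ^ n\<close>, the first is summable.\<close>
  define e where "e n = (1/2) ^ n * ((1/2) ^ n) powr p" for n :: nat
  have "\<forall>n. \<exists>N. \<forall>j\<ge>N. \<forall>k\<ge>N. (LINT x|M. norm (g j x - g k x) powr p) < e n"
    by (intro allI cauchy) (simp add: e_def)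
  then obtain N where N: "\<And>n j k. j \<ge> N n \<Longrightarrow> k \<ge> N n \<Longrightarrow> (LINT x|M. norm (g j x - g k x) powr p) < e n"
    by metis
  \<comment> \<open>Summing up makes \<open>r\<close> monotone, so \<open>r n\<close> and \<open>r (Suc n)\<close> are both at least \<open>N n\<close>.\<close>
  define r where "r n = (\<Sum>k\<le>n. N k) + n" for n
  have rN: "N n \<le> r n" for n by (simp add: r_def lessThan_Suc_atMost[symmetric])
  have rN': "N n \<le> r (Suc n)" for n using rN[of n] by (simp add: r_def)
  define A where "A n = {x \<in> space M. ((1/2) ^ n) powr p \<le> norm (g (r (Suc n)) x - g (r n) x) powr p}" for n
  have Am: "A n \<in> sets M" for n unfolding A_def using m by measurable
  have Ae: "emeasure M (A n) \<le> ennreal ((1/2) ^ n)" for n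
  proof -
    have "emeasure M (A n) \<le> ennreal ((1 / ((1/2) ^ n) powr p) * (LINT x|M. norm (g (r (Suc n)) x - g (r n) x) powr p))"
      unfolding A_def by (rule integral_Markov_inequality) (use i in auto)
    also have "\<dots> \<le> ennreal ((1 / ((1/2) ^ n) powr p) * e n)"
      using N[OF rN' rN, of n] by (intro ennreal_leI mult_left_mono) auto
    also have "(1 / ((1/2) ^ n) powr p) * e n = (1/2) ^ n" by (simp add: e_def)
    finally show ?thesis .
  qed
  have "AE x in M. eventually (\<lambda>n. x \<in> space M - A n) sequentially"
  proof (rule borel_cantelli_AE1[OF Am])
    show "emeasure M (A n) < \<infinity>" for n using Ae[of n] by (simp add: order_le_less_trans)
    have le: "measure M (A n) \<le> (1/2) ^ n" for n
      using Ae[of n] unfolding measure_def by (intro enn2real_leI) auto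
    show "summable (\<lambda>n. measure M (A n))"
    proof (rule summable_comparison_test'[where N = 0])
      show "summable (\<lambda>n. (1/2::real) ^ n)" by (rule summable_geometric) simp
      show "norm (measure M (A n)) \<le> (1/2) ^ n" for n
        using le[of n] by (simp only: real_norm_def abs_of_nonneg[OF measure_nonneg])
    qed
  qed
  then have "AE x in M. convergent (\<lambda>n. g (r n) x)"
  proof eventually_elim
    case (elim x)
    have "\<forall>\<^sub>F n in sequentially. norm (g (r (Suc n)) x - g (r n) x) \<le> (1/2) ^ n"
      using elim
    proof eventually_elim
      case (elim n)
      then have "norm (g (r (Suc n)) x - g (r n) x) powr p < ((1/2) ^ n) powr p" by (auto simp: A_def)
      moreover have "((1/2) ^ n) powr p \<le> norm (g (r (Suc n)) x - g (r n) x) powr p"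
        if "(1/2) ^ n \<le> norm (g (r (Suc n)) x - g (r n) x)"
        using p that by (intro powr_mono2) auto
      ultimately show ?case by linarith
    qed
    then have "summable (\<lambda>n. g (r (Suc n)) x - g (r n) x)"
      by (rule summable_comparison_test_ev) (simp add: summable_geometric)
    then have "convergent (\<lambda>n. \<Sum>k<n. g (r (Suc k)) x - g (r k) x)"
      by (simp add: summable_iff_convergent)
    then have "convergent (\<lambda>n. g (r n) x - g (r 0) x)"
      by (simp add: sum_lessThan_telescope[of "\<lambda>k. g (r k) x"])
    from convergent_add[OF this convergent_const[of "g (r 0) x"]] show ?case by simp
  qed
  then show ?thesis using that[of r] by (simp add: r_def)
qed

text \<open>The pointwise limit of the subsequence is the limit in the \<open>p\<close>-th mean, by Fatou's lemma.\<close>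
theorem Lp_complete:
  fixes g :: "nat \<Rightarrow> 'x \<Rightarrow> 'b::euclidean_space"
  assumes p: "0 < p" and m: "\<And>k. g k \<in> borel_measurable M"
    and i: "\<And>j k. integrable M (\<lambda>x. norm (g j x - g k x) powr p)"
    and cauchy: "\<And>e. 0 < e \<Longrightarrow> \<exists>N. \<forall>j\<ge>N. \<forall>k\<ge>N. (LINT x|M. norm (g j x - g k x) powr p) < e"
  obtains G where "G \<in> borel_measurable M" "\<And>k. integrable M (\<lambda>x. norm (g k x - G x) powr p)"
    "(\<lambda>k. LINT x|M. norm (g k x - G x) powr p) \<longlonglongrightarrow> 0"
proof -
  obtain r where r: "\<And>n. n \<le> r n" "AE x in M. convergent (\<lambda>n. g (r n) x)"
    using Lp_Cauchy_AE_convergent_subsequence[OF assms] by blast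
  define G where "G x = lim (\<lambda>n. g (r n) x)" for x
  have Gm: "G \<in> borel_measurable M" unfolding G_def using m by (intro borel_measurable_lim_metric)
  have lim: "AE x in M. (\<lambda>n. g (r n) x) \<longlonglongrightarrow> G x"
    using r(2) by eventually_elim (simp add: G_def convergent_LIMSEQ_iff)
  have fatou: "(\<integral>\<^sup>+x. norm (g j x - G x) powr p \<partial>M) \<le> ennreal e"
    if e: "0 < e" and N: "\<forall>j\<ge>N. \<forall>k\<ge>N. (LINT x|M. norm (g j x - g k x) powr p) < e" and j: "N \<le> j" for e N j
  proof -
    have "(\<integral>\<^sup>+x. norm (g j x - G x) powr p \<partial>M) = (\<integral>\<^sup>+x. liminf (\<lambda>n. ennreal (norm (g j x - g (r n) x) powr p)) \<partial>M)"
    proof (rule nn_integral_cong_AE)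
      show "AE x in M. ennreal (norm (g j x - G x) powr p) = liminf (\<lambda>n. ennreal (norm (g j x - g (r n) x) powr p))"
        using lim
      proof eventually_elim
        case (elim x)
        have "(\<lambda>n. norm (g j x - g (r n) x) powr p) \<longlonglongrightarrow> norm (g j x - G x) powr p"
          using p by (intro tendsto_powr' tendsto_intros elim) auto
        then have "(\<lambda>n. ennreal (norm (g j x - g (r n) x) powr p)) \<longlonglongrightarrow> ennreal (norm (g j x - G x) powr p)"
          by (rule tendsto_ennrealI)
        then show ?case by (intro lim_imp_Liminf[symmetric]) auto
      qed
    qed
    also have "\<dots> \<le> liminf (\<lambda>n. \<integral>\<^sup>+x. norm (g j x - g (r n) x) powr p \<partial>M)"
      by (rule nn_integral_liminf) (use m in measurable)
    also have "\<dots> \<le> ennreal e"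
    proof (rule Liminf_le)
      show "\<forall>\<^sub>F n in sequentially. (\<integral>\<^sup>+x. norm (g j x - g (r n) x) powr p \<partial>M) \<le> ennreal e"
      proof (rule eventually_sequentiallyI[of N])
        fix n assume "N \<le> n"
        then have "(LINT x|M. norm (g j x - g (r n) x) powr p) \<le> e"
          using N j r(1)[of n] by (meson less_imp_le order_trans)
        then show "(\<integral>\<^sup>+x. norm (g j x - g (r n) x) powr p \<partial>M) \<le> ennreal e"
          by (subst nn_integral_eq_integral[OF i]) (auto intro: ennreal_leI)
      qed
    qed simp
    finally show ?thesis .
  qed
  have int: "integrable M (\<lambda>x. norm (g j x - G x) powr p) \<and> (LINT x|M. norm (g j x - G x) powr p) \<le> e"
    if "0 < e" "\<forall>j\<ge>N. \<forall>k\<ge>N. (LINT x|M. norm (g j x - g k x) powr p) < e" "N \<le> j" for e N j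
  proof
    have f: "(\<integral>\<^sup>+x. norm (g j x - G x) powr p \<partial>M) \<le> ennreal e" by (rule fatou[OF that])
    show I: "integrable M (\<lambda>x. norm (g j x - G x) powr p)"
      unfolding integrable_iff_bounded using m Gm f by (auto simp: order_le_less_trans)
    show "(LINT x|M. norm (g j x - G x) powr p) \<le> e"
      using f \<open>0 < e\<close> by (subst (asm) nn_integral_eq_integral[OF I]) auto
  qed
  obtain N1 where N1: "\<forall>j\<ge>N1. \<forall>k\<ge>N1. (LINT x|M. norm (g j x - g k x) powr p) < 1" using cauchy[of 1] by auto
  have I: "integrable M (\<lambda>x. norm (g k x - G x) powr p)" for k
  proof (rule Bochner_Integration.integrable_bound)
    show "integrable M (\<lambda>x. 2 powr p * (norm (g k x - g N1 x) powr p + norm (g N1 x - G x) powr p))"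
      using i int[OF zero_less_one N1] by simp
    show "AE x in M. norm (norm (g k x - G x) powr p) \<le> norm (2 powr p * (norm (g k x - g N1 x) powr p + norm (g N1 x - G x) powr p))"
    proof (rule AE_I2)
      fix x
      show "norm (norm (g k x - G x) powr p) \<le> norm (2 powr p * (norm (g k x - g N1 x) powr p + norm (g N1 x - G x) powr p))"
        using norm_add_powr_le[OF p, of "g k x - g N1 x" "g N1 x - G x"] by simp
    qed
  qed (use m Gm in measurable)
  have "(\<lambda>k. LINT x|M. norm (g k x - G x) powr p) \<longlonglongrightarrow> 0"
  proof (rule LIMSEQ_I)
    fix e :: real assume "0 < e"
    then obtain N where N: "\<forall>j\<ge>N. \<forall>k\<ge>N. (LINT x|M. norm (g j x - g k x) powr p) < e / 2" using cauchy[of "e/2"] by auto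
    show "\<exists>N. \<forall>k\<ge>N. norm ((LINT x|M. norm (g k x - G x) powr p) - 0) < e"
    proof (intro exI allI impI)
      fix k assume "N \<le> k"
      then have "(LINT x|M. norm (g k x - G x) powr p) \<le> e / 2" using int[OF _ N] \<open>0 < e\<close> by simp
      moreover have "0 \<le> (LINT x|M. norm (g k x - G x) powr p)" by (intro integral_nonneg_AE) auto
      ultimately show "norm ((LINT x|M. norm (g k x - G x) powr p) - 0) < e" using \<open>0 < e\<close> by simp
    qed
  qed
  with Gm I show ?thesis using that by blast
qed

section \<open>The Poincare inequality\<close>

text \<open>The tangent inequality at \<open>s\<close> and at \<open>t\<close> encloses the difference quotient between the values of
\<open>p * duality_map p\<close> at the two points, so continuity of \<open>duality_map\<close> gives the derivative without
distinguishing the sign of \<open>s\<close>.\<close>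
lemma has_real_derivative_abs_powr:
  fixes s p :: real
  assumes "1 < p"
  shows "((\<lambda>t. \<bar>t\<bar> powr p) has_real_derivative p * duality_map p s) (at s)"
  unfolding has_field_derivative_iff
proof (rule LIM_zero_cancel, rule tendsto_norm_zero_cancel)
  have "(\<lambda>t. p * norm (duality_map p t - duality_map p s)) \<midarrow>s\<rightarrow> p * norm (duality_map p s - duality_map p s)"
    using isCont_duality_map[OF assms, of s] unfolding isCont_def by (intro tendsto_intros)
  then have lim: "(\<lambda>t. p * norm (duality_map p t - duality_map p s)) \<midarrow>s\<rightarrow> 0" by simp
  show "(\<lambda>t. norm ((\<bar>t\<bar> powr p - \<bar>s\<bar> powr p) / (t - s) - p * duality_map p s)) \<midarrow>s\<rightarrow> 0"
  proof (rule tendsto_sandwich[OF _ _ tendsto_const lim])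
    have "norm ((\<bar>t\<bar> powr p - \<bar>s\<bar> powr p) / (t - s) - p * duality_map p s) \<le> p * norm (duality_map p t - duality_map p s)"
      if "t \<noteq> s" for t
    proof -
      let ?d = "\<bar>t\<bar> powr p - \<bar>s\<bar> powr p" and ?J = "duality_map p"
      have 1: "p * ?J s * (t - s) \<le> ?d" using norm_powr_tangent[OF assms, of s t] by simp
      have 2: "?d \<le> p * ?J t * (t - s)" using norm_powr_tangent[OF assms, of t s] by (simp add: algebra_simps)
      have "\<bar>?d - p * ?J s * (t - s)\<bar> \<le> \<bar>p * ?J t * (t - s) - p * ?J s * (t - s)\<bar>" using 1 2 by linarith
      also have "\<dots> = p * \<bar>?J t - ?J s\<bar> * \<bar>t - s\<bar>"
        using assms by (simp add: left_diff_distrib[symmetric] right_diff_distrib[symmetric] abs_mult)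
      finally have "\<bar>?d - p * ?J s * (t - s)\<bar> / \<bar>t - s\<bar> \<le> p * \<bar>?J t - ?J s\<bar>"
        using that by (simp add: divide_le_eq)
      moreover have "?d / (t - s) - p * ?J s = (?d - p * ?J s * (t - s)) / (t - s)" using that by (simp add: field_simps)
      ultimately show ?thesis by (simp add: abs_divide)
    qed
    then show "\<forall>\<^sub>F t in at s. norm ((\<bar>t\<bar> powr p - \<bar>s\<bar> powr p) / (t - s) - p * duality_map p s) \<le> p * norm (duality_map p t - duality_map p s)"
      by (auto simp: eventually_at_filter)
  qed simp
qed

text \<open>Integrate the derivative in direction \<open>b\<close> of \<open>(x \<bullet> b) * \<bar>\<phi> x\<bar> powr p\<close>, whose integral is \<open>0\<close>.
Differentiating the first factor gives \<open>\<bar>\<phi> x\<bar> powr p\<close>; the other term is bounded by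
\<open>p * R * \<bar>\<phi> x\<bar> powr (p - 1) * norm (gradient \<phi> x)\<close>, where \<open>R\<close> bounds the norm on \<open>\<Omega>\<close>, and the
weighted Young inequality lets half of the left-hand side absorb it.\<close>
lemma Poincare_test_functions:
  fixes \<Omega> :: "'a::euclidean_space set"
  assumes p: "1 < p" and \<Omega>: "open \<Omega>" "bounded \<Omega>"
  obtains C where "0 \<le> C" "\<And>\<phi>. \<phi> \<in> test_functions \<Omega> \<Longrightarrow>
    (LINT x|lebesgue_on \<Omega>. \<bar>\<phi> x\<bar> powr p) \<le> C * (LINT x|lebesgue_on \<Omega>. norm (gradient \<phi> x) powr p)"
proof -
  obtain R where R: "0 < R" "\<And>x. x \<in> \<Omega> \<Longrightarrow> norm x \<le> R"
    using \<Omega>(2) by (auto simp: bounded_pos)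
  obtain b :: 'a where b: "b \<in> Basis" using nonempty_Basis by blast
  \<comment> \<open>With this \<open>t\<close> the Young bound gives the integral of \<open>\<bar>\<phi> x\<bar> powr p\<close> the factor \<open>p * R * t = 1/2\<close>.\<close>
  define t where "t = 1 / (2 * p * R)"
  have t: "0 < t" "p * R * t = 1/2" using p R by (auto simp: t_def field_simps)
  define C where "C = 2 * p * R * t powr (1 - p)"
  have "(LINT x|lebesgue_on \<Omega>. \<bar>\<phi> x\<bar> powr p) \<le> C * (LINT x|lebesgue_on \<Omega>. norm (gradient \<phi> x) powr p)"
    if \<phi>: "\<phi> \<in> test_functions \<Omega>" for \<phi>
  proof -
    obtain K where K: "compact K" "K \<subseteq> \<Omega>" "\<And>x. x \<notin> K \<Longrightarrow> \<phi> x = 0" "\<And>x. x \<notin> K \<Longrightarrow> gradient \<phi> x = 0"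
      using test_function_support[OF \<phi>] by blast
    note c\<phi> = continuous_on_test_function[OF \<phi>] and cg = continuous_on_gradient_test_function[OF \<phi>]
    have cJ: "continuous_on UNIV (\<lambda>x. duality_map p (\<phi> x))"
    proof (rule continuous_on_compose2[OF _ c\<phi> subset_UNIV])
      show "continuous_on UNIV (duality_map p :: real \<Rightarrow> real)"
        by (intro continuous_at_imp_continuous_on ballI isCont_duality_map p)
    qed
    have cp: "continuous_on UNIV (\<lambda>x. \<bar>\<phi> x\<bar> powr p)" "continuous_on UNIV (\<lambda>x. norm (gradient \<phi> x) powr p)"
      using p by (intro continuous_on_powr' continuous_on_rabs continuous_on_norm c\<phi> cg continuous_on_const; simp)+
    define D where "D x = (\<bar>\<phi> x\<bar> powr p) *\<^sub>R b + ((x \<bullet> b) * (p * duality_map p (\<phi> x))) *\<^sub>R gradient \<phi> x" for x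
    define e where "e x = (x \<bullet> b) * (p * duality_map p (\<phi> x)) * (gradient \<phi> x \<bullet> b)" for x
    have ce: "continuous_on UNIV e" unfolding e_def by (intro continuous_intros cJ cg)
    have der: "((\<lambda>x. (x \<bullet> b) * \<bar>\<phi> x\<bar> powr p) has_derivative (\<lambda>v. v \<bullet> D x)) (at x)" for x
    proof -
      have 1: "((\<lambda>x. \<bar>\<phi> x\<bar> powr p) has_derivative (\<lambda>v. p * duality_map p (\<phi> x) * (v \<bullet> gradient \<phi> x))) (at x)"
        by (rule has_derivative_compose[OF has_derivative_gradient[OF test_function_differentiable[OF \<phi>]]
            has_real_derivative_abs_powr[OF p, unfolded has_field_derivative_def]])
      have 2: "((\<lambda>x. x \<bullet> b) has_derivative (\<lambda>v. v \<bullet> b)) (at x)" by (auto intro!: derivative_eq_intros)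
      from has_derivative_mult[OF 2 1] show ?thesis
        by (simp add: D_def inner_add_right algebra_simps)
    qed
    have "integral\<^sup>L lborel (\<lambda>x. D x \<bullet> b) = 0"
    proof (rule integral_directional_derivative_eq_0[OF der _ K(1)])
      show "continuous_on UNIV D" unfolding D_def by (intro continuous_intros cJ cg cp)
      show "(x \<bullet> b) * \<bar>\<phi> x\<bar> powr p = 0" if "x \<notin> K" for x using K(3)[OF that] by simp
      show "D x = 0" if "x \<notin> K" for x using K(3,4)[OF that] p by (simp add: D_def duality_map_def)
    qed
    moreover have "(\<lambda>x. D x \<bullet> b) = (\<lambda>x. \<bar>\<phi> x\<bar> powr p + e x)"
      using b by (simp add: D_def e_def inner_add_left)
    moreover have int: "integrable lborel (\<lambda>x. \<bar>\<phi> x\<bar> powr p)" "integrable lborel e" "integrable lborel (\<lambda>x. norm (gradient \<phi> x) powr p)"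
    proof -
      show "integrable lborel (\<lambda>x. \<bar>\<phi> x\<bar> powr p)"
        by (rule integrable_lborel_compact_support[OF cp(1) K(1)]) (simp add: K(3))
      show "integrable lborel e"
        by (rule integrable_lborel_compact_support[OF ce K(1)]) (simp add: K(4) e_def)
      show "integrable lborel (\<lambda>x. norm (gradient \<phi> x) powr p)"
        by (rule integrable_lborel_compact_support[OF cp(2) K(1)]) (simp add: K(4))
    qed
    ultimately have "integral\<^sup>L lborel (\<lambda>x. \<bar>\<phi> x\<bar> powr p) = - integral\<^sup>L lborel e" by simp
    also have "\<dots> = integral\<^sup>L lborel (\<lambda>x. - e x)" by simp
    also have "\<dots> \<le> integral\<^sup>L lborel (\<lambda>x. p * R * (t * \<bar>\<phi> x\<bar> powr p + t powr (1 - p) * norm (gradient \<phi> x) powr p))"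
    proof (rule integral_mono)
      fix x
      show "- e x \<le> p * R * (t * \<bar>\<phi> x\<bar> powr p + t powr (1 - p) * norm (gradient \<phi> x) powr p)"
      proof (cases "x \<in> K")
        case True
        then have xR: "\<bar>x \<bullet> b\<bar> \<le> R" using K(2) R(2)[of x] Basis_le_norm[OF b, of x] by auto
        have gb: "\<bar>gradient \<phi> x \<bullet> b\<bar> \<le> norm (gradient \<phi> x)" by (rule Basis_le_norm[OF b])
        have "- e x \<le> \<bar>x \<bullet> b\<bar> * (p * \<bar>\<phi> x\<bar> powr (p - 1)) * \<bar>gradient \<phi> x \<bullet> b\<bar>"
          using norm_duality_map[of p "\<phi> x"] p unfolding e_def
          by (intro order_trans[OF abs_ge_minus_self]) (simp add: abs_mult)
        also have "\<dots> \<le> R * (p * \<bar>\<phi> x\<bar> powr (p - 1)) * norm (gradient \<phi> x)"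
          using xR gb p R(1) by (intro mult_mono) auto
        also have "\<dots> = p * R * (\<bar>\<phi> x\<bar> powr (p - 1) * norm (gradient \<phi> x))" by simp
        also have "\<dots> \<le> p * R * (t * \<bar>\<phi> x\<bar> powr p + t powr (1 - p) * norm (gradient \<phi> x) powr p)"
          using p R(1) t(1) by (intro mult_left_mono powr_young_weighted) auto
        finally show ?thesis .
      next
        case False
        then show ?thesis using K(3,4)[OF False] by (simp add: e_def)
      qed
    qed (use int in auto)
    also have "\<dots> = p * R * t * integral\<^sup>L lborel (\<lambda>x. \<bar>\<phi> x\<bar> powr p)
        + p * R * t powr (1 - p) * integral\<^sup>L lborel (\<lambda>x. norm (gradient \<phi> x) powr p)"
      using int by (simp add: algebra_simps)
    finally have "integral\<^sup>L lborel (\<lambda>x. \<bar>\<phi> x\<bar> powr p) \<le> C * integral\<^sup>L lborel (\<lambda>x. norm (gradient \<phi> x) powr p)"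
      using t(2) by (simp add: C_def)
    moreover have "(LINT x|lebesgue_on \<Omega>. \<bar>\<phi> x\<bar> powr p) = integral\<^sup>L lborel (\<lambda>x. \<bar>\<phi> x\<bar> powr p)"
    proof (rule integral_lebesgue_on_eq_lborel)
      show "\<bar>\<phi> x\<bar> powr p = 0" if "x \<notin> \<Omega>" for x using K(2,3) that by (metis abs_zero powr_0 subsetD)
    qed (use cp \<Omega> in \<open>auto intro: borel_measurable_continuous_onI\<close>)
    moreover have "(LINT x|lebesgue_on \<Omega>. norm (gradient \<phi> x) powr p) = integral\<^sup>L lborel (\<lambda>x. norm (gradient \<phi> x) powr p)"
    proof (rule integral_lebesgue_on_eq_lborel)
      show "norm (gradient \<phi> x) powr p = 0" if "x \<notin> \<Omega>" for x using K(2,4) that by (metis norm_zero powr_0 subsetD)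
    qed (use cp \<Omega> in \<open>auto intro: borel_measurable_continuous_onI\<close>)
    ultimately show ?thesis by simp
  qed
  moreover have "0 \<le> C" using p R by (simp add: C_def)
  ultimately show ?thesis using that by blast
qed

section \<open>Approximation by test functions\<close>

definition Lp_tendsto :: "'a::euclidean_space set \<Rightarrow> real \<Rightarrow> (nat \<Rightarrow> 'a \<Rightarrow> 'b::euclidean_space) \<Rightarrow> ('a \<Rightarrow> 'b) \<Rightarrow> bool" where
  "Lp_tendsto \<Omega> p g G \<longleftrightarrow> (\<lambda>k. LINT x|lebesgue_on \<Omega>. norm (g k x - G x) powr p) \<longlonglongrightarrow> 0"

lemma Lp_on_diff:
  assumes "0 < p" "G \<in> Lp_on \<Omega> p" "H \<in> Lp_on \<Omega> p"
  shows "(\<lambda>x. G x - H x) \<in> Lp_on \<Omega> p"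
  using Lp_on_lincomb[OF assms, of 1 "-1"] by simp

lemma Lp_onD:
  assumes "G \<in> Lp_on \<Omega> p"
  shows "G \<in> borel_measurable (lebesgue_on \<Omega>)" "integrable (lebesgue_on \<Omega>) (\<lambda>x. norm (G x) powr p)"
  using assms by (auto simp: Lp_on_def)

lemma Lp_tendsto_lincomb:
  assumes p: "0 < p" and g: "\<And>k. g k \<in> Lp_on \<Omega> p" "G \<in> Lp_on \<Omega> p" "Lp_tendsto \<Omega> p g G"
    and h: "\<And>k. h k \<in> Lp_on \<Omega> p" "H \<in> Lp_on \<Omega> p" "Lp_tendsto \<Omega> p h H"
  shows "Lp_tendsto \<Omega> p (\<lambda>k x. a *\<^sub>R g k x + b *\<^sub>R h k x) (\<lambda>x. a *\<^sub>R G x + b *\<^sub>R H x)"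
  unfolding Lp_tendsto_def
proof (rule tendsto_sandwich[OF _ _ tendsto_const])
  let ?M = "lebesgue_on \<Omega>"
  let ?d = "\<lambda>k x. norm (a *\<^sub>R g k x + b *\<^sub>R h k x - (a *\<^sub>R G x + b *\<^sub>R H x)) powr p"
  let ?A = "\<lambda>k. LINT x|?M. norm (g k x - G x) powr p"
  let ?B = "\<lambda>k. LINT x|?M. norm (h k x - H x) powr p"
  have "(\<lambda>k. 2 powr p * (\<bar>a\<bar> powr p * ?A k + \<bar>b\<bar> powr p * ?B k)) \<longlonglongrightarrow> 2 powr p * (\<bar>a\<bar> powr p * 0 + \<bar>b\<bar> powr p * 0)"
    using g(3) h(3) unfolding Lp_tendsto_def by (intro tendsto_intros)
  then show "(\<lambda>k. 2 powr p * (\<bar>a\<bar> powr p * ?A k + \<bar>b\<bar> powr p * ?B k)) \<longlonglongrightarrow> 0" by simp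
  show "\<forall>\<^sub>F k in sequentially. (LINT x|?M. ?d k x)
      \<le> 2 powr p * (\<bar>a\<bar> powr p * ?A k + \<bar>b\<bar> powr p * ?B k)"
  proof (intro always_eventually allI)
    fix k
    have i: "integrable ?M (\<lambda>x. norm (g k x - G x) powr p)" "integrable ?M (\<lambda>x. norm (h k x - H x) powr p)"
      by (rule Lp_onD(2)[OF Lp_on_diff[OF p g(1,2)]] Lp_onD(2)[OF Lp_on_diff[OF p h(1,2)]])+
    have "(LINT x|?M. ?d k x)
       \<le> (LINT x|?M. 2 powr p * (\<bar>a\<bar> powr p * norm (g k x - G x) powr p + \<bar>b\<bar> powr p * norm (h k x - H x) powr p))"
    proof (rule integral_mono)
      show "integrable ?M (\<lambda>x. ?d k x)"
        by (rule Lp_onD(2)[OF Lp_on_diff[OF p Lp_on_lincomb[OF p g(1) h(1)] Lp_on_lincomb[OF p g(2) h(2)]]])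
      fix x
      have "a *\<^sub>R g k x + b *\<^sub>R h k x - (a *\<^sub>R G x + b *\<^sub>R H x) = a *\<^sub>R (g k x - G x) + b *\<^sub>R (h k x - H x)"
        by (simp add: algebra_simps)
      then show "?d k x
        \<le> 2 powr p * (\<bar>a\<bar> powr p * norm (g k x - G x) powr p + \<bar>b\<bar> powr p * norm (h k x - H x) powr p)"
        using norm_add_powr_le[OF p, of "a *\<^sub>R (g k x - G x)" "b *\<^sub>R (h k x - H x)"] by (simp add: powr_mult)
    qed (use i in simp)
    then show "(LINT x|?M. ?d k x)
       \<le> 2 powr p * (\<bar>a\<bar> powr p * ?A k + \<bar>b\<bar> powr p * ?B k)"
      using i by simp
  qed
  show "\<forall>\<^sub>F k in sequentially. 0 \<le> (LINT x|?M. ?d k x)"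
    by (intro always_eventually allI integral_nonneg_AE) auto
qed

lemma sobolev_diff:
  assumes "open \<Omega>" "0 < p" "u \<in> sobolev \<Omega> p" "v \<in> sobolev \<Omega> p"
  shows "(\<lambda>x. u x - v x) \<in> sobolev \<Omega> p"
    and "AE x in lebesgue_on \<Omega>. weak_grad \<Omega> (\<lambda>x. u x - v x) x = weak_grad \<Omega> u x - weak_grad \<Omega> v x"
  using sobolev_lincomb[OF assms, of 1 "-1"] by simp_all

lemma sobolev_norm_test_diff:
  assumes "open \<Omega>" "0 < p" "u \<in> sobolev \<Omega> p" "\<phi> \<in> test_functions \<Omega>"
  shows "sobolev_norm \<Omega> p (\<lambda>x. u x - \<phi> x)
    = ((LINT x|lebesgue_on \<Omega>. norm (\<phi> x - u x) powr p)
       + (LINT x|lebesgue_on \<Omega>. norm (gradient \<phi> x - weak_grad \<Omega> u x) powr p)) powr (1 / p)"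
proof -
  note t = test_function_sobolev[OF assms(1,2,4)]
  note d = sobolev_diff[OF assms(1-3) t(1)]
  have "AE x in lebesgue_on \<Omega>. norm (weak_grad \<Omega> (\<lambda>x. u x - \<phi> x) x) powr p = norm (gradient \<phi> x - weak_grad \<Omega> u x) powr p"
    using d(2) t(2) by eventually_elim (simp add: norm_minus_commute)
  then have "(LINT x|lebesgue_on \<Omega>. norm (weak_grad \<Omega> (\<lambda>x. u x - \<phi> x) x) powr p)
      = (LINT x|lebesgue_on \<Omega>. norm (gradient \<phi> x - weak_grad \<Omega> u x) powr p)"
    using Lp_onD(2)[OF sobolevD(2)[OF assms(1) d(1)]]
       Lp_onD(2)[OF Lp_on_diff[OF assms(2) test_function_Lp(2)[OF assms(1,2,4)] sobolevD(2)[OF assms(1,3)]]]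
    by (intro integral_cong_AE) auto
  then show ?thesis by (simp add: sobolev_norm_def abs_minus_commute)
qed

text \<open>The Sobolev norm of a difference is computed from the chosen weak gradient of the difference; this
form separates function and gradient and refers to the classical gradients of the approximants.\<close>
lemma sobolev0_iff:
  assumes "open \<Omega>" "0 < p"
  shows "u \<in> sobolev0 \<Omega> p \<longleftrightarrow> u \<in> sobolev \<Omega> p \<and>
    (\<exists>\<phi>. (\<forall>k. \<phi> k \<in> test_functions \<Omega>) \<and> Lp_tendsto \<Omega> p \<phi> u \<and> Lp_tendsto \<Omega> p (\<lambda>k. gradient (\<phi> k)) (weak_grad \<Omega> u))"
proof -
  have "(\<lambda>k. sobolev_norm \<Omega> p (\<lambda>x. u x - \<phi> k x)) \<longlonglongrightarrow> 0 \<longleftrightarrow>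
      Lp_tendsto \<Omega> p \<phi> u \<and> Lp_tendsto \<Omega> p (\<lambda>k. gradient (\<phi> k)) (weak_grad \<Omega> u)"
    if u: "u \<in> sobolev \<Omega> p" and \<phi>: "\<And>k. \<phi> k \<in> test_functions \<Omega>" for \<phi>
  proof -
    define A where "A k = (LINT x|lebesgue_on \<Omega>. norm (\<phi> k x - u x) powr p)" for k
    define B where "B k = (LINT x|lebesgue_on \<Omega>. norm (gradient (\<phi> k) x - weak_grad \<Omega> u x) powr p)" for k
    have nn: "0 \<le> A k" "0 \<le> B k" for k unfolding A_def B_def by (auto intro!: integral_nonneg_AE)
    have "(\<lambda>k. sobolev_norm \<Omega> p (\<lambda>x. u x - \<phi> k x)) = (\<lambda>k. (A k + B k) powr (1 / p))"
      using sobolev_norm_test_diff[OF assms u \<phi>] by (simp add: A_def B_def)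
    moreover have "(\<lambda>k. (A k + B k) powr (1 / p)) \<longlonglongrightarrow> 0 \<longleftrightarrow> A \<longlonglongrightarrow> 0 \<and> B \<longlonglongrightarrow> 0"
    proof
      assume "(\<lambda>k. (A k + B k) powr (1 / p)) \<longlonglongrightarrow> 0"
      then have "(\<lambda>k. ((A k + B k) powr (1 / p)) powr p) \<longlonglongrightarrow> 0 powr p"
        using assms(2) by (intro tendsto_powr' tendsto_const) auto
      then have AB: "(\<lambda>k. A k + B k) \<longlonglongrightarrow> 0" using assms(2) nn by (simp add: powr_powr)
      show "A \<longlonglongrightarrow> 0 \<and> B \<longlonglongrightarrow> 0"
        using nn by (auto intro!: tendsto_sandwich[OF _ _ tendsto_const AB])
    next
      assume "A \<longlonglongrightarrow> 0 \<and> B \<longlonglongrightarrow> 0"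
      then have "(\<lambda>k. (A k + B k) powr (1 / p)) \<longlonglongrightarrow> (0 + 0) powr (1 / p)"
        using assms(2) nn by (intro tendsto_powr' tendsto_intros) auto
      then show "(\<lambda>k. (A k + B k) powr (1 / p)) \<longlonglongrightarrow> 0" by simp
    qed
    ultimately show ?thesis by (simp add: Lp_tendsto_def A_def[abs_def] B_def[abs_def])
  qed
  then show ?thesis unfolding sobolev0_def by blast
qed

lemma sobolev0_lincomb:
  assumes "open \<Omega>" "0 < p" "u \<in> sobolev0 \<Omega> p" "v \<in> sobolev0 \<Omega> p"
  shows "(\<lambda>x. a * u x + b * v x) \<in> sobolev0 \<Omega> p"
proof -
  obtain \<phi> where u: "u \<in> sobolev \<Omega> p" and \<phi>: "\<And>k. \<phi> k \<in> test_functions \<Omega>" "Lp_tendsto \<Omega> p \<phi> u"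
      "Lp_tendsto \<Omega> p (\<lambda>k. gradient (\<phi> k)) (weak_grad \<Omega> u)"
    using assms(3) unfolding sobolev0_iff[OF assms(1,2)] by blast
  obtain \<psi> where v: "v \<in> sobolev \<Omega> p" and \<psi>: "\<And>k. \<psi> k \<in> test_functions \<Omega>" "Lp_tendsto \<Omega> p \<psi> v"
      "Lp_tendsto \<Omega> p (\<lambda>k. gradient (\<psi> k)) (weak_grad \<Omega> v)"
    using assms(4) unfolding sobolev0_iff[OF assms(1,2)] by blast
  note w = sobolev_lincomb[OF assms(1,2) u v, of a b]
  note Lt\<phi> = test_function_Lp[OF assms(1,2) \<phi>(1)] and Lt\<psi> = test_function_Lp[OF assms(1,2) \<psi>(1)]
  note Lu = sobolevD[OF assms(1) u] and Lv = sobolevD[OF assms(1) v]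
  let ?\<chi> = "\<lambda>k x. a * \<phi> k x + b * \<psi> k x"
  have "Lp_tendsto \<Omega> p ?\<chi> (\<lambda>x. a * u x + b * v x)"
    using Lp_tendsto_lincomb[OF assms(2) Lt\<phi>(1) Lu(1) \<phi>(2) Lt\<psi>(1) Lv(1) \<psi>(2), of a b] by simp
  moreover have "Lp_tendsto \<Omega> p (\<lambda>k. gradient (?\<chi> k)) (weak_grad \<Omega> (\<lambda>x. a * u x + b * v x))"
  proof -
    have t: "Lp_tendsto \<Omega> p (\<lambda>k x. a *\<^sub>R gradient (\<phi> k) x + b *\<^sub>R gradient (\<psi> k) x) (\<lambda>x. a *\<^sub>R weak_grad \<Omega> u x + b *\<^sub>R weak_grad \<Omega> v x)"
      by (rule Lp_tendsto_lincomb[OF assms(2) Lt\<phi>(2) Lu(2) \<phi>(3) Lt\<psi>(2) Lv(2) \<psi>(3)])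
    have g: "(\<lambda>k. gradient (?\<chi> k)) = (\<lambda>k x. a *\<^sub>R gradient (\<phi> k) x + b *\<^sub>R gradient (\<psi> k) x)"
      using gradient_test_lincomb[OF \<phi>(1) \<psi>(1)] by (simp add: fun_eq_iff)
    have "(LINT x|lebesgue_on \<Omega>. norm (a *\<^sub>R gradient (\<phi> k) x + b *\<^sub>R gradient (\<psi> k) x - weak_grad \<Omega> (\<lambda>x. a * u x + b * v x) x) powr p)
      = (LINT x|lebesgue_on \<Omega>. norm (a *\<^sub>R gradient (\<phi> k) x + b *\<^sub>R gradient (\<psi> k) x - (a *\<^sub>R weak_grad \<Omega> u x + b *\<^sub>R weak_grad \<Omega> v x)) powr p)" for k
      using w(2) Lp_onD(1)[OF Lt\<phi>(2)[of k]] Lp_onD(1)[OF Lt\<psi>(2)[of k]] Lp_onD(1)[OF Lu(2)] Lp_onD(1)[OF Lv(2)]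
        Lp_onD(1)[OF sobolevD(2)[OF assms(1) w(1)]]
      by (intro integral_cong_AE) (auto elim!: eventually_mono)
    then show ?thesis using t unfolding g Lp_tendsto_def by simp
  qed
  moreover have "?\<chi> k \<in> test_functions \<Omega>" for k by (rule test_functions_lincomb[OF \<phi>(1) \<psi>(1)])
  ultimately show ?thesis unfolding sobolev0_iff[OF assms(1,2)]
    by (intro conjI w(1) exI[of _ ?\<chi>] allI)
qed

section \<open>The weighted energy and its minimizers\<close>

lemma p_flux_eq_duality_map: "p_flux \<Omega> p u x = duality_map p (weak_grad \<Omega> u x)"
  by (simp add: p_flux_def duality_map_def)

lemma Linf_plusE:
  assumes "\<gamma> \<in> Linf_plus \<Omega>"
  obtains C c where "0 < C" "0 < c" "\<gamma> \<in> borel_measurable (lebesgue_on \<Omega>)"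
    "AE x in lebesgue_on \<Omega>. \<bar>\<gamma> x\<bar> \<le> C" "AE x in lebesgue_on \<Omega>. c < \<gamma> x"
proof -
  obtain C c where *: "AE x in lebesgue_on \<Omega>. \<bar>\<gamma> x\<bar> \<le> C" "0 < c" "AE x in lebesgue_on \<Omega>. c < \<gamma> x"
      "\<gamma> \<in> borel_measurable (lebesgue_on \<Omega>)"
    using assms by (auto simp: Linf_plus_def)
  have "AE x in lebesgue_on \<Omega>. \<bar>\<gamma> x\<bar> \<le> max C 1" using *(1) by eventually_elim simp
  with that[of "max C 1" c] * show ?thesis by simp
qed

lemma integrable_Linf_plus_mult:
  fixes h :: "'a::euclidean_space \<Rightarrow> real"
  assumes "\<gamma> \<in> Linf_plus \<Omega>" "integrable (lebesgue_on \<Omega>) h"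
  shows "integrable (lebesgue_on \<Omega>) (\<lambda>x. \<gamma> x * h x)"
proof -
  obtain C where C: "0 < C" "AE x in lebesgue_on \<Omega>. \<bar>\<gamma> x\<bar> \<le> C" "\<gamma> \<in> borel_measurable (lebesgue_on \<Omega>)"
    using Linf_plusE[OF assms(1)] by metis
  show ?thesis
  proof (rule Bochner_Integration.integrable_bound)
    show "integrable (lebesgue_on \<Omega>) (\<lambda>x. C * h x)" using assms(2) by simp
    show "AE x in lebesgue_on \<Omega>. norm (\<gamma> x * h x) \<le> norm (C * h x)"
      using C(2) by eventually_elim (use C(1) in \<open>auto simp: abs_mult intro!: mult_right_mono\<close>)
  qed (use C(3) assms(2) in measurable)
qed

lemma integrable_duality_pairing:
  assumes "1 < p" "V \<in> Lp_on \<Omega> p" "W \<in> Lp_on \<Omega> p"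
  shows "integrable (lebesgue_on \<Omega>) (\<lambda>x. duality_map p (V x) \<bullet> W x)"
proof (rule Bochner_Integration.integrable_bound)
  show "integrable (lebesgue_on \<Omega>) (\<lambda>x. norm (V x) powr p + norm (W x) powr p)"
    using assms by (auto dest: Lp_onD(2))
  show "(\<lambda>x. duality_map p (V x) \<bullet> W x) \<in> borel_measurable (lebesgue_on \<Omega>)"
    using borel_measurable_duality_map[OF Lp_onD(1)[OF assms(2)], of p] Lp_onD(1)[OF assms(3)] by measurable
  show "AE x in lebesgue_on \<Omega>. norm (duality_map p (V x) \<bullet> W x) \<le> norm (norm (V x) powr p + norm (W x) powr p)"
  proof (rule AE_I2)
    fix x
    show "norm (duality_map p (V x) \<bullet> W x) \<le> norm (norm (V x) powr p + norm (W x) powr p)"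
      using duality_map_inner_le[of p "V x" "W x"] powr_young_weighted[OF assms(1), of "norm (V x)" "norm (W x)" 1]
      by simp
  qed
qed

abbreviation pairing ::
    "'a::euclidean_space set \<Rightarrow> real \<Rightarrow> ('a \<Rightarrow> real) \<Rightarrow> ('a \<Rightarrow> 'a) \<Rightarrow> ('a \<Rightarrow> 'a) \<Rightarrow> real" where
  "pairing \<Omega> p \<gamma> V W \<equiv> (LINT x|lebesgue_on \<Omega>. \<gamma> x * (duality_map p (V x) \<bullet> W x))"

lemma weighted_duality_pairing_tendsto:
  assumes p: "1 < p" and \<gamma>: "\<gamma> \<in> Linf_plus \<Omega>" and V: "V \<in> Lp_on \<Omega> p"
    and W: "\<And>k. g k \<in> Lp_on \<Omega> p" "W \<in> Lp_on \<Omega> p" "Lp_tendsto \<Omega> p g W"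
  shows "(\<lambda>k. pairing \<Omega> p \<gamma> V (g k))
    \<longlonglongrightarrow> (pairing \<Omega> p \<gamma> V W)"
proof (rule LIM_zero_cancel)
  let ?M = "lebesgue_on \<Omega>"
  have p0: "0 < p" using p by simp
  obtain C where C: "0 < C" "AE x in ?M. \<bar>\<gamma> x\<bar> \<le> C" "\<gamma> \<in> borel_measurable ?M"
    using Linf_plusE[OF \<gamma>] by metis
  have "(\<lambda>k. LINT x|?M. \<gamma> x * (duality_map p (V x) \<bullet> (g k x - W x))) \<longlonglongrightarrow> 0"
  proof (rule integral_tendsto_0_if_powr_tendsto_0[OF p less_imp_le[OF C(1)]])
    show "integrable ?M (\<lambda>x. norm (V x) powr p)" by (rule Lp_onD(2)[OF V])
    show "integrable ?M (\<lambda>x. norm (g k x - W x) powr p)" for k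
      by (rule Lp_onD(2)[OF Lp_on_diff[OF p0 W(1,2)]])
    show "(\<lambda>k. LINT x|?M. norm (g k x - W x) powr p) \<longlonglongrightarrow> 0"
      using W(3) by (simp add: Lp_tendsto_def)
    show "(\<lambda>x. \<gamma> x * (duality_map p (V x) \<bullet> (g k x - W x))) \<in> borel_measurable ?M" for k
      by (intro borel_measurable_integrable integrable_Linf_plus_mult[OF \<gamma>] integrable_duality_pairing[OF p V] Lp_on_diff[OF p0 W(1,2)])
    show "AE x in ?M. norm (\<gamma> x * (duality_map p (V x) \<bullet> (g k x - W x)))
        \<le> C * (norm (V x) powr (p - 1) * norm (g k x - W x))" for k
      using C(2)
    proof eventually_elim
      case (elim x)
      show ?case unfolding real_norm_def abs_mult
        by (intro mult_mono elim duality_map_inner_le) (use C(1) in auto)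
    qed
  qed auto
  moreover have "(LINT x|?M. \<gamma> x * (duality_map p (V x) \<bullet> (g k x - W x)))
     = (pairing \<Omega> p \<gamma> V (g k)) - (pairing \<Omega> p \<gamma> V W)" for k
    unfolding inner_diff_right right_diff_distrib
    by (intro Bochner_Integration.integral_diff integrable_Linf_plus_mult[OF \<gamma>] integrable_duality_pairing[OF p V] W)
  ultimately show "(\<lambda>k. (pairing \<Omega> p \<gamma> V (g k))
      - (pairing \<Omega> p \<gamma> V W)) \<longlonglongrightarrow> 0"
    by simp
qed

definition energy :: "'a::euclidean_space set \<Rightarrow> real \<Rightarrow> ('a \<Rightarrow> real) \<Rightarrow> ('a \<Rightarrow> 'a) \<Rightarrow> real" where
  "energy \<Omega> p \<gamma> V = (LINT x|lebesgue_on \<Omega>. \<gamma> x * norm (V x) powr p)"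

lemma integrable_energy:
  "\<gamma> \<in> Linf_plus \<Omega> \<Longrightarrow> V \<in> Lp_on \<Omega> p \<Longrightarrow> integrable (lebesgue_on \<Omega>) (\<lambda>x. \<gamma> x * norm (V x) powr p)"
  by (intro integrable_Linf_plus_mult Lp_onD(2))

lemma energy_nonneg:
  assumes "\<gamma> \<in> Linf_plus \<Omega>"
  shows "0 \<le> energy \<Omega> p \<gamma> V"
proof -
  obtain c where c: "0 < c" "AE x in lebesgue_on \<Omega>. c < \<gamma> x" using Linf_plusE[OF assms] by metis
  show ?thesis unfolding energy_def
    by (intro integral_nonneg_AE) (use c(2) in eventually_elim, use c(1) in auto)
qed

text \<open>This says that the weighted energy is convex with derivative \<open>p * pairing \<Omega> p \<gamma> V\<close> at \<open>V\<close>.\<close>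
lemma energy_tangent:
  assumes p: "1 < p" and \<gamma>: "\<gamma> \<in> Linf_plus \<Omega>" and V: "V \<in> Lp_on \<Omega> p" and W: "W \<in> Lp_on \<Omega> p"
  shows "energy \<Omega> p \<gamma> V + p * (LINT x|lebesgue_on \<Omega>. \<gamma> x * (duality_map p (V x) \<bullet> (W x - V x))) \<le> energy \<Omega> p \<gamma> W"
proof -
  let ?M = "lebesgue_on \<Omega>"
  have p0: "0 < p" using p by simp
  obtain c where c: "0 < c" "AE x in ?M. c < \<gamma> x" using Linf_plusE[OF \<gamma>] by metis
  have i: "integrable ?M (\<lambda>x. \<gamma> x * (duality_map p (V x) \<bullet> (W x - V x)))"
    by (intro integrable_Linf_plus_mult[OF \<gamma>] integrable_duality_pairing[OF p V] Lp_on_diff[OF p0 W V])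
  have "energy \<Omega> p \<gamma> V + p * (LINT x|?M. \<gamma> x * (duality_map p (V x) \<bullet> (W x - V x)))
     = (LINT x|?M. \<gamma> x * norm (V x) powr p + p * (\<gamma> x * (duality_map p (V x) \<bullet> (W x - V x))))"
    unfolding energy_def using i integrable_energy[OF \<gamma> V] by simp
  also have "\<dots> \<le> energy \<Omega> p \<gamma> W" unfolding energy_def
  proof (rule integral_mono_AE)
    show "AE x in ?M. \<gamma> x * norm (V x) powr p + p * (\<gamma> x * (duality_map p (V x) \<bullet> (W x - V x))) \<le> \<gamma> x * norm (W x) powr p"
      using c(2)
    proof eventually_elim
      case (elim x)
      have "\<gamma> x * (norm (V x) powr p + p * (duality_map p (V x) \<bullet> (W x - V x))) \<le> \<gamma> x * norm (W x) powr p"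
        using elim c(1) by (intro mult_left_mono norm_powr_tangent[OF p]) auto
      then show ?case by (simp add: algebra_simps)
    qed
  qed (use i integrable_energy[OF \<gamma> V] integrable_energy[OF \<gamma> W] in auto)
  finally show ?thesis .
qed

text \<open>The tangent inequalities at \<open>x\<close> and at \<open>y\<close> bound the difference from above and below; the power
of \<open>norm x\<close> in the first of them is then split so that only \<open>y\<close>, which will be a fixed limit, and
the distance remain.\<close>
lemma abs_norm_powr_diff_le:
  fixes x y :: "'a::real_inner"
  assumes p: "1 < p"
  shows "\<bar>norm x powr p - norm y powr p\<bar> \<le> p * 2 powr p * (norm y powr (p - 1) * norm (x - y) + norm (x - y) powr p)"
proof -
  let ?S = "norm y powr (p - 1) * norm (x - y) + norm (x - y) powr p"
  have S: "norm y powr (p - 1) * norm (x - y) \<le> ?S" "0 \<le> ?S" by auto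
  have c: "p \<le> p * 2 powr p" using p ge_one_powr_ge_zero[of 2 p] by simp
  have "norm y powr p - norm x powr p \<le> p * \<bar>duality_map p y \<bullet> (x - y)\<bar>"
    using norm_powr_tangent[OF p, of y x] p
    by (smt (verit) abs_ge_minus_self mult_left_mono mult_minus_right)
  also have "\<dots> \<le> p * (norm y powr (p - 1) * norm (x - y))"
    using p by (intro mult_left_mono duality_map_inner_le) auto
  also have "\<dots> \<le> p * 2 powr p * ?S" using S c p by (intro mult_mono) auto
  finally have 1: "norm y powr p - norm x powr p \<le> p * 2 powr p * ?S" .
  have "norm x powr p - norm y powr p \<le> p * (duality_map p x \<bullet> (x - y))"
    using norm_powr_tangent[OF p, of x y] by (simp add: inner_diff_right algebra_simps)
  also have "\<dots> \<le> p * (norm x powr (p - 1) * norm (x - y))"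
    using p duality_map_inner_le[of p x "x - y"] by (intro mult_left_mono) auto
  also have "norm x powr (p - 1) * norm (x - y) \<le> 2 powr p * ?S"
  proof -
    have "norm x powr (p - 1) \<le> 2 powr (p - 1) * (norm y powr (p - 1) + norm (x - y) powr (p - 1))"
      using norm_add_powr_le[of "p - 1" y "x - y"] p by simp
    also have "\<dots> \<le> 2 powr p * (norm y powr (p - 1) + norm (x - y) powr (p - 1))"
      by (intro mult_right_mono powr_mono) auto
    finally have "norm x powr (p - 1) * norm (x - y)
        \<le> 2 powr p * (norm y powr (p - 1) + norm (x - y) powr (p - 1)) * norm (x - y)"
      by (intro mult_right_mono) auto
    also have "\<dots> = 2 powr p * (norm y powr (p - 1) * norm (x - y) + norm (x - y) powr (p - 1) * norm (x - y))"
      by (simp add: algebra_simps)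
    also have "norm (x - y) powr (p - 1) * norm (x - y) = norm (x - y) powr p"
      by (simp add: powr_mult_base mult.commute)
    finally show ?thesis .
  qed
  finally have 2: "norm x powr p - norm y powr p \<le> p * 2 powr p * ?S" using p by (simp add: mult.assoc)
  show ?thesis using 1 2 by linarith
qed

lemma energy_tendsto:
  assumes p: "1 < p" and \<gamma>: "\<gamma> \<in> Linf_plus \<Omega>"
    and g: "\<And>k. g k \<in> Lp_on \<Omega> p" "V \<in> Lp_on \<Omega> p" "Lp_tendsto \<Omega> p g V"
  shows "(\<lambda>k. energy \<Omega> p \<gamma> (g k)) \<longlonglongrightarrow> energy \<Omega> p \<gamma> V"
proof (rule LIM_zero_cancel, rule tendsto_norm_zero_cancel)
  let ?e = "\<lambda>k x. \<gamma> x * norm (g k x) powr p - \<gamma> x * norm (V x) powr p"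
  let ?M = "lebesgue_on \<Omega>"
  have p0: "0 < p" using p by simp
  obtain C where C: "0 < C" "AE x in ?M. \<bar>\<gamma> x\<bar> \<le> C"
    using Linf_plusE[OF \<gamma>] by metis
  define D where "D = C * (p * 2 powr p)"
  have D: "0 \<le> D" using C p by (simp add: D_def)
  let ?b = "\<lambda>k x. norm (g k x - V x)"
  let ?R = "\<lambda>k. (LINT x|?M. norm (V x) powr (p - 1) * ?b k x) + (LINT x|?M. ?b k x powr p)"
  have ib: "integrable ?M (\<lambda>x. ?b k x powr p)" for k
    by (rule Lp_onD(2)[OF Lp_on_diff[OF p0 g(1,2)]])
  have lim: "(\<lambda>k. LINT x|?M. ?b k x powr p) \<longlonglongrightarrow> 0" using g(3) by (simp add: Lp_tendsto_def)
  have m: "V \<in> borel_measurable ?M" "g k \<in> borel_measurable ?M" for k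
    using g by (auto dest: Lp_onD(1))
  have mm: "(\<lambda>x. norm (V x) powr (p - 1) * ?b k x) \<in> borel_measurable ?M" for k
    using m by measurable
  have im: "integrable ?M (\<lambda>x. norm (V x) powr (p - 1) * ?b k x)" for k
  proof (rule Bochner_Integration.integrable_bound[OF _ mm])
    show "integrable ?M (\<lambda>x. norm (V x) powr p + ?b k x powr p)"
      using ib Lp_onD(2)[OF g(2)] by simp
    show "AE x in ?M. norm (norm (V x) powr (p - 1) * ?b k x) \<le> norm (norm (V x) powr p + ?b k x powr p)"
    proof (rule AE_I2)
      fix x
      show "norm (norm (V x) powr (p - 1) * ?b k x) \<le> norm (norm (V x) powr p + ?b k x powr p)"
        using powr_young_weighted[OF p, of "norm (V x)" "?b k x" 1] by simp
    qed
  qed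
  have lim1: "(\<lambda>k. LINT x|?M. norm (V x) powr (p - 1) * ?b k x) \<longlonglongrightarrow> 0"
    by (rule integral_tendsto_0_if_powr_tendsto_0[OF p zero_le_one, where a = "\<lambda>x. norm (V x)" and b = ?b])
      (use ib lim mm Lp_onD(2)[OF g(2)] in auto)
  show "(\<lambda>k. norm (energy \<Omega> p \<gamma> (g k) - energy \<Omega> p \<gamma> V)) \<longlonglongrightarrow> 0"
  proof (rule tendsto_sandwich[OF _ _ tendsto_const])
    have "(\<lambda>k. D * ?R k) \<longlonglongrightarrow> D * (0 + 0)"
      by (intro tendsto_intros lim lim1)
    then show "(\<lambda>k. D * ?R k) \<longlonglongrightarrow> 0"
      by simp
    show "\<forall>\<^sub>F k in sequentially. norm (energy \<Omega> p \<gamma> (g k) - energy \<Omega> p \<gamma> V)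
       \<le> D * ?R k"
    proof (intro always_eventually allI)
      fix k
      have ie: "integrable ?M (\<lambda>x. ?e k x)"
        using integrable_energy[OF \<gamma> g(1)] integrable_energy[OF \<gamma> g(2)] by (intro Bochner_Integration.integrable_diff)
      have "norm (energy \<Omega> p \<gamma> (g k) - energy \<Omega> p \<gamma> V)
         = norm (LINT x|?M. ?e k x)"
        unfolding energy_def using integrable_energy[OF \<gamma> g(1)] integrable_energy[OF \<gamma> g(2)] by simp
      also have "\<dots> \<le> (LINT x|?M. norm (?e k x))"
        by (rule integral_norm_bound)
      also have "\<dots> \<le> (LINT x|?M. D * (norm (V x) powr (p - 1) * ?b k x + ?b k x powr p))"
      proof (rule integral_mono_AE)
        show "AE x in ?M. norm (?e k x)
            \<le> D * (norm (V x) powr (p - 1) * ?b k x + ?b k x powr p)"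
          using C(2)
        proof eventually_elim
          case (elim x)
          have "norm (?e k x) = \<bar>\<gamma> x\<bar> * \<bar>norm (g k x) powr p - norm (V x) powr p\<bar>"
            by (simp add: right_diff_distrib[symmetric] abs_mult)
          also have "\<dots> \<le> C * (p * 2 powr p * (norm (V x) powr (p - 1) * ?b k x + ?b k x powr p))"
            using C(1) by (intro mult_mono elim abs_norm_powr_diff_le[OF p]) auto
          finally show ?case by (simp add: D_def mult.assoc)
        qed
      qed (use ie im ib in \<open>auto intro!: integrable_norm\<close>)
      also have "\<dots> = D * ?R k"
        using im ib by simp
      finally show "norm (energy \<Omega> p \<gamma> (g k) - energy \<Omega> p \<gamma> V)
       \<le> D * ?R k" .
    qed
  qed simp
qed

text \<open>The equation extends from test functions to their closure \<open>W\<^sub>0\<close> because the flux pairs continuously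
with gradients.\<close>
lemma weak_solution_orthogonal:
  assumes p: "1 < p" and \<Omega>: "open \<Omega>" and \<gamma>: "\<gamma> \<in> Linf_plus \<Omega>"
    and u: "weak_solution \<Omega> p \<gamma> u" and w: "w \<in> sobolev0 \<Omega> p"
  shows "(pairing \<Omega> p \<gamma> (weak_grad \<Omega> u) (weak_grad \<Omega> w)) = 0"
proof -
  have p0: "0 < p" using p by simp
  obtain \<phi> where ws: "w \<in> sobolev \<Omega> p" and \<phi>: "\<And>k. \<phi> k \<in> test_functions \<Omega>"
      "Lp_tendsto \<Omega> p (\<lambda>k. gradient (\<phi> k)) (weak_grad \<Omega> w)"
    using w unfolding sobolev0_iff[OF \<Omega> p0] by blast
  have us: "u \<in> sobolev \<Omega> p" using u by (simp add: weak_solution_def)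
  have "(\<lambda>k. pairing \<Omega> p \<gamma> (weak_grad \<Omega> u) (gradient (\<phi> k)))
    \<longlonglongrightarrow> (pairing \<Omega> p \<gamma> (weak_grad \<Omega> u) (weak_grad \<Omega> w))"
    by (rule weighted_duality_pairing_tendsto[OF p \<gamma> sobolevD(2)[OF \<Omega> us] test_function_Lp(2)[OF \<Omega> p0 \<phi>(1)] sobolevD(2)[OF \<Omega> ws] \<phi>(2)])
  moreover have "(pairing \<Omega> p \<gamma> (weak_grad \<Omega> u) (gradient (\<phi> k))) = 0" for k
    using u \<phi>(1) by (simp add: weak_solution_def p_flux_eq_duality_map)
  ultimately show ?thesis by (simp add: LIMSEQ_const_iff)
qed

lemma weak_solution_pairing_eq:
  assumes p: "1 < p" and \<Omega>: "open \<Omega>" and \<gamma>: "\<gamma> \<in> Linf_plus \<Omega>"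
    and u: "weak_solution \<Omega> p \<gamma> u" and v: "v \<in> sobolev \<Omega> p" "(\<lambda>x. v x - u x) \<in> sobolev0 \<Omega> p"
  shows "(LINT x|lebesgue_on \<Omega>. \<gamma> x * (duality_map p (weak_grad \<Omega> u x) \<bullet> (weak_grad \<Omega> v x - weak_grad \<Omega> u x))) = 0"
    and "(pairing \<Omega> p \<gamma> (weak_grad \<Omega> u) (weak_grad \<Omega> v)) = energy \<Omega> p \<gamma> (weak_grad \<Omega> u)"
proof -
  have p0: "0 < p" using p by simp
  have us: "u \<in> sobolev \<Omega> p" using u by (simp add: weak_solution_def)
  note gu = sobolevD(2)[OF \<Omega> us] and gv = sobolevD(2)[OF \<Omega> v(1)]
  note d = sobolev_diff[OF \<Omega> p0 v(1) us]
  have i: "integrable (lebesgue_on \<Omega>) (\<lambda>x. \<gamma> x * (duality_map p (weak_grad \<Omega> u x) \<bullet> W x))" if "W \<in> Lp_on \<Omega> p" for W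
    by (intro integrable_Linf_plus_mult[OF \<gamma>] integrable_duality_pairing[OF p gu] that)
  have "(LINT x|lebesgue_on \<Omega>. \<gamma> x * (duality_map p (weak_grad \<Omega> u x) \<bullet> (weak_grad \<Omega> v x - weak_grad \<Omega> u x)))
     = (LINT x|lebesgue_on \<Omega>. \<gamma> x * (duality_map p (weak_grad \<Omega> u x) \<bullet> weak_grad \<Omega> (\<lambda>x. v x - u x) x))"
    using d(2) borel_measurable_integrable[OF i[OF Lp_on_diff[OF p0 gv gu]]] borel_measurable_integrable[OF i[OF sobolevD(2)[OF \<Omega> d(1)]]]
    by (intro integral_cong_AE) (auto elim!: eventually_mono)
  also have "\<dots> = 0" by (rule weak_solution_orthogonal[OF p \<Omega> \<gamma> u v(2)])
  finally show 0: "(LINT x|lebesgue_on \<Omega>. \<gamma> x * (duality_map p (weak_grad \<Omega> u x) \<bullet> (weak_grad \<Omega> v x - weak_grad \<Omega> u x))) = 0" .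
  show "(pairing \<Omega> p \<gamma> (weak_grad \<Omega> u) (weak_grad \<Omega> v)) = energy \<Omega> p \<gamma> (weak_grad \<Omega> u)"
    using 0 i[OF gu] i[OF gv] by (simp add: inner_diff_right right_diff_distrib duality_map_inner_self energy_def)
qed

text \<open>The linear term in the tangent inequality vanishes by the equation.\<close>
lemma weak_solution_minimizes_energy:
  assumes p: "1 < p" and \<Omega>: "open \<Omega>" and \<gamma>: "\<gamma> \<in> Linf_plus \<Omega>"
    and u: "weak_solution \<Omega> p \<gamma> u" and v: "v \<in> sobolev \<Omega> p" "(\<lambda>x. v x - u x) \<in> sobolev0 \<Omega> p"
  shows "energy \<Omega> p \<gamma> (weak_grad \<Omega> u) \<le> energy \<Omega> p \<gamma> (weak_grad \<Omega> v)"
proof -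
  have us: "u \<in> sobolev \<Omega> p" using u by (simp add: weak_solution_def)
  show ?thesis
    using energy_tangent[OF p \<gamma> sobolevD(2)[OF \<Omega> us] sobolevD(2)[OF \<Omega> v(1)]] weak_solution_pairing_eq(1)[OF assms]
    by simp
qed

text \<open>The energy is compared at \<open>U + s \<nabla>\<psi>\<close> and \<open>U\<close> through its tangent at \<open>U + s \<nabla>\<psi>\<close> rather than by
differentiating under the integral. Minimality then gives the inequality with \<open>U + s \<nabla>\<psi>\<close> inside
\<open>duality_map\<close> for every \<open>s > 0\<close>, and dominated convergence lets \<open>s\<close> tend to \<open>0\<close>.\<close>
lemma euler_lagrange_le:
  assumes p: "1 < p" and \<Omega>: "open \<Omega>" and \<gamma>: "\<gamma> \<in> Linf_plus \<Omega>" and U: "U \<in> Lp_on \<Omega> p"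
    and min: "\<And>\<psi>. \<psi> \<in> test_functions \<Omega> \<Longrightarrow> energy \<Omega> p \<gamma> U \<le> energy \<Omega> p \<gamma> (\<lambda>x. U x + gradient \<psi> x)"
    and \<psi>: "\<psi> \<in> test_functions \<Omega>"
  shows "0 \<le> (pairing \<Omega> p \<gamma> U (gradient \<psi>))"
proof -
  let ?M = "lebesgue_on \<Omega>"
  have p0: "0 < p" using p by simp
  obtain C where C: "0 < C" "AE x in ?M. \<bar>\<gamma> x\<bar> \<le> C" "\<gamma> \<in> borel_measurable ?M"
    using Linf_plusE[OF \<gamma>] by metis
  define s where "s n = inverse (real (Suc n))" for n
  have s: "0 < s n" "s n \<le> 1" for n by (auto simp: s_def inverse_le_1_iff)
  have s0: "s \<longlonglongrightarrow> 0" unfolding s_def by (rule LIMSEQ_inverse_real_of_nat)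
  note D = test_function_Lp(2)[OF \<Omega> p0 \<psi>]
  define V where "V n x = U x + s n *\<^sub>R gradient \<psi> x" for n x
  have V: "V n \<in> Lp_on \<Omega> p" for n
    unfolding V_def using Lp_on_lincomb[OF p0 U D, of 1 "s n"] by simp
  have i: "integrable ?M (\<lambda>x. \<gamma> x * (duality_map p (W x) \<bullet> gradient \<psi> x))" if "W \<in> Lp_on \<Omega> p" for W
    by (intro integrable_Linf_plus_mult[OF \<gamma>] integrable_duality_pairing[OF p that] D)
  have pos: "0 \<le> (pairing \<Omega> p \<gamma> (V n) (gradient \<psi>))" for n
  proof -
    have st: "(\<lambda>x. s n * \<psi> x) \<in> test_functions \<Omega>"
      using test_functions_lincomb[OF \<psi> \<psi>, of "s n" 0] by simp
    have gs: "gradient (\<lambda>x. s n * \<psi> x) x = s n *\<^sub>R gradient \<psi> x" for x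
      by (rule gradient_cmult[OF test_function_differentiable[OF \<psi>]])
    have "energy \<Omega> p \<gamma> U \<le> energy \<Omega> p \<gamma> (V n)"
      using min[OF st] by (simp add: gs V_def[abs_def])
    moreover have "energy \<Omega> p \<gamma> (V n) + p * (LINT x|?M. \<gamma> x * (duality_map p (V n x) \<bullet> (U x - V n x))) \<le> energy \<Omega> p \<gamma> U"
      by (rule energy_tangent[OF p \<gamma> V U])
    moreover have "(LINT x|?M. \<gamma> x * (duality_map p (V n x) \<bullet> (U x - V n x)))
       = - s n * (pairing \<Omega> p \<gamma> (V n) (gradient \<psi>))"
    proof -
      have "(\<lambda>x. \<gamma> x * (duality_map p (V n x) \<bullet> (U x - V n x))) = (\<lambda>x. - s n * (\<gamma> x * (duality_map p (V n x) \<bullet> gradient \<psi> x)))"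
        unfolding fun_eq_iff by (auto simp: V_def)
      then show ?thesis by (simp only: integral_mult_right_zero)
    qed
    ultimately have "0 \<le> p * (s n * (pairing \<Omega> p \<gamma> (V n) (gradient \<psi>)))"
      by simp
    then show ?thesis using p0 s(1)[of n] by (simp add: zero_le_mult_iff)
  qed
  have "(\<lambda>n. pairing \<Omega> p \<gamma> (V n) (gradient \<psi>))
      \<longlonglongrightarrow> (pairing \<Omega> p \<gamma> U (gradient \<psi>))"
  proof (rule integral_dominated_convergence)
    show "integrable ?M (\<lambda>x. C * (2 powr p * (norm (U x) powr p + norm (gradient \<psi> x) powr p) + norm (gradient \<psi> x) powr p))"
      using Lp_onD(2)[OF U] Lp_onD(2)[OF D] by simp
    show "AE x in ?M. (\<lambda>n. \<gamma> x * (duality_map p (V n x) \<bullet> gradient \<psi> x)) \<longlonglongrightarrow> \<gamma> x * (duality_map p (U x) \<bullet> gradient \<psi> x)"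
    proof (rule AE_I2)
      fix x
      have "(\<lambda>n. V n x) \<longlonglongrightarrow> U x + 0 *\<^sub>R gradient \<psi> x"
        unfolding V_def by (intro tendsto_intros s0)
      then have "(\<lambda>n. duality_map p (V n x)) \<longlonglongrightarrow> duality_map p (U x)"
        using isCont_tendsto_compose[OF isCont_duality_map[OF p]] by fastforce
      then show "(\<lambda>n. \<gamma> x * (duality_map p (V n x) \<bullet> gradient \<psi> x)) \<longlonglongrightarrow> \<gamma> x * (duality_map p (U x) \<bullet> gradient \<psi> x)"
        by (intro tendsto_intros)
    qed
    show "AE x in ?M. norm (\<gamma> x * (duality_map p (V n x) \<bullet> gradient \<psi> x))
        \<le> C * (2 powr p * (norm (U x) powr p + norm (gradient \<psi> x) powr p) + norm (gradient \<psi> x) powr p)" for n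
      using C(2)
    proof eventually_elim
      case (elim x)
      have "norm (V n x) powr p \<le> 2 powr p * (norm (U x) powr p + norm (s n *\<^sub>R gradient \<psi> x) powr p)"
        unfolding V_def by (rule norm_add_powr_le[OF p0])
      also have "norm (s n *\<^sub>R gradient \<psi> x) powr p \<le> norm (gradient \<psi> x) powr p"
        using s[of n] p0 by (intro powr_mono2) (auto simp: mult_left_le_one_le)
      finally have VU: "norm (V n x) powr p \<le> 2 powr p * (norm (U x) powr p + norm (gradient \<psi> x) powr p)" by simp
      have "\<bar>duality_map p (V n x) \<bullet> gradient \<psi> x\<bar> \<le> norm (V n x) powr (p - 1) * norm (gradient \<psi> x)"
        by (rule duality_map_inner_le)
      also have "\<dots> \<le> norm (V n x) powr p + norm (gradient \<psi> x) powr p"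
        using powr_young_weighted[OF p, of "norm (V n x)" "norm (gradient \<psi> x)" 1] by simp
      also have "\<dots> \<le> 2 powr p * (norm (U x) powr p + norm (gradient \<psi> x) powr p) + norm (gradient \<psi> x) powr p"
        using VU by simp
      finally show ?case unfolding real_norm_def abs_mult
        by (intro mult_mono elim) (use C(1) in auto)
    qed
  qed (use i[OF U] i[OF V] in auto)
  then show ?thesis using pos by (intro LIMSEQ_le_const) auto
qed

lemma euler_lagrange:
  assumes p: "1 < p" and \<Omega>: "open \<Omega>" and \<gamma>: "\<gamma> \<in> Linf_plus \<Omega>" and U: "U \<in> Lp_on \<Omega> p"
    and min: "\<And>\<psi>. \<psi> \<in> test_functions \<Omega> \<Longrightarrow> energy \<Omega> p \<gamma> U \<le> energy \<Omega> p \<gamma> (\<lambda>x. U x + gradient \<psi> x)"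
    and \<psi>: "\<psi> \<in> test_functions \<Omega>"
  shows "(pairing \<Omega> p \<gamma> U (gradient \<psi>)) = 0"
proof -
  have n: "(\<lambda>x. - \<psi> x) \<in> test_functions \<Omega>"
    using test_functions_lincomb[OF \<psi> \<psi>, of "-1" 0] by simp
  have "gradient (\<lambda>x. - \<psi> x) x = - gradient \<psi> x" for x
    using gradient_cmult[OF test_function_differentiable[OF \<psi>], of "-1"] by simp
  then show ?thesis
    using euler_lagrange_le[OF p \<Omega> \<gamma> U min \<psi>] euler_lagrange_le[OF p \<Omega> \<gamma> U min n] by simp
qed

section \<open>Existence of weak solutions\<close>

lemma integrable_one_bounded_open:
  fixes \<Omega> :: "'a::euclidean_space set"
  assumes "open \<Omega>" "bounded \<Omega>"
  shows "integrable (lebesgue_on \<Omega>) (\<lambda>x. 1::real)"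
proof -
  have "\<Omega> \<in> lmeasurable" using assms by (simp add: bounded_set_imp_lmeasurable)
  then have "integrable lebesgue (indicator \<Omega> :: 'a \<Rightarrow> real)"
    by (intro integrable_real_indicator) (auto simp: fmeasurable_def)
  then show ?thesis using assms(1) by (simp add: integrable_restrict_space)
qed

lemma integral_scaleR_bounded_tendsto:
  fixes g :: "nat \<Rightarrow> 'a::euclidean_space \<Rightarrow> 'b::euclidean_space" and c :: "'a \<Rightarrow> real"
  assumes p: "1 < p" and \<Omega>: "open \<Omega>" "bounded \<Omega>"
    and g: "\<And>k. g k \<in> Lp_on \<Omega> p" "G \<in> Lp_on \<Omega> p" "Lp_tendsto \<Omega> p g G"
    and c: "c \<in> borel_measurable (lebesgue_on \<Omega>)" "\<And>x. \<bar>c x\<bar> \<le> M"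
    and i: "\<And>k. integrable (lebesgue_on \<Omega>) (\<lambda>x. c x *\<^sub>R g k x)" "integrable (lebesgue_on \<Omega>) (\<lambda>x. c x *\<^sub>R G x)"
  shows "(\<lambda>k. LINT x|lebesgue_on \<Omega>. c x *\<^sub>R g k x) \<longlonglongrightarrow> (LINT x|lebesgue_on \<Omega>. c x *\<^sub>R G x)"
proof (rule LIM_zero_cancel)
  let ?M = "lebesgue_on \<Omega>"
  have p0: "0 < p" using p by simp
  have M: "0 \<le> M" using c(2)[of undefined] by simp
  have "(\<lambda>k. LINT x|?M. c x *\<^sub>R (g k x - G x)) \<longlonglongrightarrow> 0"
  proof (rule integral_tendsto_0_if_powr_tendsto_0[OF p M, where a = "\<lambda>_. 1"])
    show "integrable ?M (\<lambda>x. 1 powr p)" using integrable_one_bounded_open[OF \<Omega>] by simp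
    show "integrable ?M (\<lambda>x. norm (g k x - G x) powr p)" for k
      by (rule Lp_onD(2)[OF Lp_on_diff[OF p0 g(1,2)]])
    show "(\<lambda>k. LINT x|?M. norm (g k x - G x) powr p) \<longlonglongrightarrow> 0" using g(3) by (simp add: Lp_tendsto_def)
    show "(\<lambda>x. c x *\<^sub>R (g k x - G x)) \<in> borel_measurable ?M" for k
      using Lp_onD(1)[OF g(1)] Lp_onD(1)[OF g(2)] c(1) by measurable
    show "AE x in ?M. norm (c x *\<^sub>R (g k x - G x)) \<le> M * (1 powr (p - 1) * norm (g k x - G x))" for k
      using c(2) by (intro AE_I2) (auto intro: mult_right_mono)
  qed auto
  then show "(\<lambda>k. (LINT x|?M. c x *\<^sub>R g k x) - (LINT x|?M. c x *\<^sub>R G x)) \<longlonglongrightarrow> 0"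
    using i by (simp add: scaleR_diff_right)
qed

text \<open>Both sides of the defining identity converge, since \<open>\<Omega>\<close>, test functions and their gradients are bounded.\<close>
lemma has_weak_gradient_Lp_limit:
  fixes \<Omega> :: "'a::euclidean_space set"
  assumes p: "1 < p" and \<Omega>: "open \<Omega>" "bounded \<Omega>"
    and u: "\<And>k. u k \<in> Lp_on \<Omega> p" "w \<in> Lp_on \<Omega> p" "Lp_tendsto \<Omega> p u w"
    and D: "\<And>k. D k \<in> Lp_on \<Omega> p" "W \<in> Lp_on \<Omega> p" "Lp_tendsto \<Omega> p D W"
    and wg: "\<And>k. has_weak_gradient \<Omega> (u k) (D k)"
  shows "has_weak_gradient \<Omega> w W"
  unfolding has_weak_gradient_def
proof (intro conjI ballI)
  let ?M = "lebesgue_on \<Omega>"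
  have p1: "1 \<le> p" using p by simp
  note l = Lp_on_imp_locally_integrable[OF p1 _ \<Omega>(1)]
  show "locally_integrable_on w \<Omega>" "locally_integrable_on W \<Omega>" using l u(2) D(2) by blast+
  fix \<psi> assume \<psi>: "\<psi> \<in> test_functions \<Omega>"
  obtain K where K: "compact K" "\<And>x. x \<notin> K \<Longrightarrow> \<psi> x = 0" "\<And>x. x \<notin> K \<Longrightarrow> gradient \<psi> x = 0"
    using test_function_support[OF \<psi>] by blast
  note c\<psi> = continuous_on_test_function[OF \<psi>] and cg = continuous_on_gradient_test_function[OF \<psi>]
  have "compact (\<psi> ` K)" "compact (gradient \<psi> ` K)"
    using c\<psi> cg K(1) compact_continuous_image continuous_on_subset subset_UNIV by metis+
  then obtain M1 M2 where M: "\<And>x. x \<in> K \<Longrightarrow> \<bar>\<psi> x\<bar> \<le> M1" "\<And>x. x \<in> K \<Longrightarrow> norm (gradient \<psi> x) \<le> M2"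
    by (metis bounded_iff compact_imp_bounded imageI real_norm_def)
  have B1: "\<bar>\<psi> x\<bar> \<le> max M1 0" for x using M(1)[of x] K(2)[of x] by (cases "x \<in> K") auto
  have B2: "norm (gradient \<psi> x) \<le> max M2 0" for x using M(2)[of x] K(3)[of x] by (cases "x \<in> K") auto
  have m\<psi>: "\<psi> \<in> borel_measurable ?M"
    and mg: "gradient \<psi> \<in> borel_measurable ?M"
    using test_function_Lp[OF \<Omega>(1) _ \<psi>, of p] p by (auto dest: Lp_onD(1))
  have limD: "(\<lambda>k. LINT x|?M. \<psi> x *\<^sub>R D k x) \<longlonglongrightarrow> (LINT x|?M. \<psi> x *\<^sub>R W x)"
    by (rule integral_scaleR_bounded_tendsto[OF p \<Omega> D m\<psi> B1])
      (intro integrable_test_scaleR[OF l[OF D(1)] \<psi> \<Omega>(1)] integrable_test_scaleR[OF l[OF D(2)] \<psi> \<Omega>(1)])+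
  have limu: "(\<lambda>k. LINT x|?M. u k x *\<^sub>R gradient \<psi> x) \<longlonglongrightarrow> (LINT x|?M. w x *\<^sub>R gradient \<psi> x)"
  proof -
    have iu: "integrable ?M (\<lambda>x. u k x *\<^sub>R gradient \<psi> x)" for k
      by (rule integrable_scaleR_gradient_test[OF l[OF u(1)] \<psi> \<Omega>(1)])
    have iw: "integrable ?M (\<lambda>x. w x *\<^sub>R gradient \<psi> x)"
      by (rule integrable_scaleR_gradient_test[OF l[OF u(2)] \<psi> \<Omega>(1)])
    have comp: "integral\<^sup>L ?M (\<lambda>x. v x *\<^sub>R gradient \<psi> x)
        = (\<Sum>b\<in>Basis. (LINT x|?M. (gradient \<psi> x \<bullet> b) *\<^sub>R v x) *\<^sub>R b)"
      if "integrable ?M (\<lambda>x. v x *\<^sub>R gradient \<psi> x)" for v :: "'a \<Rightarrow> real"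
    proof -
      have "integral\<^sup>L ?M (\<lambda>x. v x *\<^sub>R gradient \<psi> x)
         = (\<Sum>b\<in>Basis. (integral\<^sup>L ?M (\<lambda>x. v x *\<^sub>R gradient \<psi> x) \<bullet> b) *\<^sub>R b)"
        by (simp only: euclidean_representation)
      also have "\<dots> = (\<Sum>b\<in>Basis. (LINT x|?M. (gradient \<psi> x \<bullet> b) *\<^sub>R v x) *\<^sub>R b)"
        using that by (simp add: integral_inner_left[symmetric] mult.commute del: integral_inner_left)
      finally show ?thesis .
    qed
    have "(\<lambda>k. LINT x|?M. (gradient \<psi> x \<bullet> b) *\<^sub>R u k x) \<longlonglongrightarrow> (LINT x|?M. (gradient \<psi> x \<bullet> b) *\<^sub>R w x)"
      if b: "b \<in> Basis" for b
    proof (rule integral_scaleR_bounded_tendsto[OF p \<Omega> u])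
      show "(\<lambda>x. gradient \<psi> x \<bullet> b) \<in> borel_measurable ?M" using mg by measurable
      show "\<bar>gradient \<psi> x \<bullet> b\<bar> \<le> max M2 0" for x
        using Basis_le_norm[OF b, of "gradient \<psi> x"] B2[of x] by linarith
      have "integrable ?M (\<lambda>x. (u k x *\<^sub>R gradient \<psi> x) \<bullet> b)" for k
        using iu by (rule integrable_inner_left)
      then show "integrable ?M (\<lambda>x. (gradient \<psi> x \<bullet> b) *\<^sub>R u k x)" for k by (simp add: mult.commute)
      have "integrable ?M (\<lambda>x. (w x *\<^sub>R gradient \<psi> x) \<bullet> b)"
        using iw by (rule integrable_inner_left)
      then show "integrable ?M (\<lambda>x. (gradient \<psi> x \<bullet> b) *\<^sub>R w x)" by (simp add: mult.commute)
    qed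
    then show ?thesis unfolding comp[OF iu] comp[OF iw] by (intro tendsto_intros)
  qed
  have parts: "(LINT x|?M. u k x *\<^sub>R gradient \<psi> x) = - (LINT x|?M. \<psi> x *\<^sub>R D k x)" for k
    using wg[of k] \<psi> by (simp add: has_weak_gradient_def)
  show "(LINT x|?M. w x *\<^sub>R gradient \<psi> x) = - (LINT x|?M. \<psi> x *\<^sub>R W x)"
    by (rule LIMSEQ_unique[OF limu[unfolded parts] tendsto_minus[OF limD]])
qed

lemma test_functions_zero: "(\<lambda>x. 0) \<in> test_functions \<Omega>"
  by (simp add: test_functions_def times_cont_diff_const)

lemma energy_uniform_convexity:
  fixes \<Omega> :: "'a::euclidean_space set"
  assumes p: "1 < p" and \<gamma>: "\<gamma> \<in> Linf_plus \<Omega>" and \<epsilon>: "0 < \<epsilon>"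
  obtains C where "0 \<le> C" "\<And>V W. V \<in> Lp_on \<Omega> p \<Longrightarrow> W \<in> Lp_on \<Omega> p \<Longrightarrow>
    energy \<Omega> p \<gamma> (\<lambda>x. V x - W x) \<le> \<epsilon> * (energy \<Omega> p \<gamma> V + energy \<Omega> p \<gamma> W)
      + C * ((energy \<Omega> p \<gamma> V + energy \<Omega> p \<gamma> W) / 2 - energy \<Omega> p \<gamma> (\<lambda>x. (1/2) *\<^sub>R (V x + W x)))"
proof -
  have p0: "0 < p" using p by simp
  obtain c where c: "0 < c" "AE x in lebesgue_on \<Omega>. c < \<gamma> x" using Linf_plusE[OF \<gamma>] by metis
  obtain C where C: "0 \<le> C" "\<And>a b :: 'a.
    norm (a - b) powr p \<le> \<epsilon> * (norm a powr p + norm b powr p)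
      + C * ((norm a powr p + norm b powr p) / 2 - norm ((1/2) *\<^sub>R (a + b)) powr p)"
    using uniform_convexity_powr[OF p \<epsilon>] by metis
  show ?thesis
  proof (rule that[OF C(1)])
    fix V W :: "'a \<Rightarrow> 'a" assume VW: "V \<in> Lp_on \<Omega> p" "W \<in> Lp_on \<Omega> p"
    let ?E = "\<lambda>V x. \<gamma> x * norm (V x) powr p"
    let ?m = "\<lambda>x. (1/2) *\<^sub>R (V x + W x)"
    have m: "?m \<in> Lp_on \<Omega> p" using Lp_on_lincomb[OF p0 VW, of "1/2" "1/2"] by (simp add: scaleR_add_right)
    note i = integrable_energy[OF \<gamma> VW(1)] integrable_energy[OF \<gamma> VW(2)] integrable_energy[OF \<gamma> m]
      integrable_energy[OF \<gamma> Lp_on_diff[OF p0 VW]]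
    have "energy \<Omega> p \<gamma> (\<lambda>x. V x - W x)
      \<le> (LINT x|lebesgue_on \<Omega>. \<epsilon> * (?E V x + ?E W x) + C * ((?E V x + ?E W x) / 2 - ?E ?m x))"
      unfolding energy_def
    proof (rule integral_mono_AE)
      show "AE x in lebesgue_on \<Omega>. \<gamma> x * norm (V x - W x) powr p
          \<le> \<epsilon> * (?E V x + ?E W x) + C * ((?E V x + ?E W x) / 2 - ?E ?m x)"
        using c(2)
      proof eventually_elim
        case (elim x)
        have "\<gamma> x * norm (V x - W x) powr p \<le> \<gamma> x * (\<epsilon> * (norm (V x) powr p + norm (W x) powr p)
            + C * ((norm (V x) powr p + norm (W x) powr p) / 2 - norm (?m x) powr p))"
          using elim c(1) by (intro mult_left_mono C(2)) auto
        also have "\<dots> = \<epsilon> * (?E V x + ?E W x) + C * ((?E V x + ?E W x) / 2 - ?E ?m x)"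
          by (simp only: algebra_simps add_divide_distrib times_divide_eq_right)
        finally show ?case .
      qed
      show "integrable (lebesgue_on \<Omega>) (\<lambda>x. \<epsilon> * (?E V x + ?E W x) + C * ((?E V x + ?E W x) / 2 - ?E ?m x))"
        by (intro Bochner_Integration.integrable_add Bochner_Integration.integrable_diff integrable_mult_right impI integrable_divide i)
    qed (rule i)
    also have "\<dots> = \<epsilon> * (energy \<Omega> p \<gamma> V + energy \<Omega> p \<gamma> W)
      + C * ((energy \<Omega> p \<gamma> V + energy \<Omega> p \<gamma> W) / 2 - energy \<Omega> p \<gamma> ?m)"
      unfolding energy_def using i
      by (simp only: Bochner_Integration.integral_add Bochner_Integration.integral_diff integral_mult_right_zero
          integral_divide_zero Bochner_Integration.integrable_add Bochner_Integration.integrable_diff integrable_mult_right integrable_divide)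
    finally show "energy \<Omega> p \<gamma> (\<lambda>x. V x - W x) \<le> \<epsilon> * (energy \<Omega> p \<gamma> V + energy \<Omega> p \<gamma> W)
      + C * ((energy \<Omega> p \<gamma> V + energy \<Omega> p \<gamma> W) / 2 - energy \<Omega> p \<gamma> (\<lambda>x. (1/2) *\<^sub>R (V x + W x)))" .
  qed
qed

text \<open>The midpoint of two members of the sequence is again admissible, so its energy is at least the
infimum \<open>m\<close>. When both energies are near \<open>m\<close> the convexity defect is therefore small, and
uniform convexity forces the gradients together. This gives strong convergence directly, with no
detour through weak compactness.\<close>
lemma minimizing_sequence_gradients_Cauchy:
  fixes F :: "'a::euclidean_space \<Rightarrow> 'a"
  assumes p: "1 < p" and \<Omega>: "open \<Omega>" and \<gamma>: "\<gamma> \<in> Linf_plus \<Omega>" and F: "F \<in> Lp_on \<Omega> p"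
    and \<phi>: "\<And>k. \<phi> k \<in> test_functions \<Omega>"
    and low: "\<And>\<psi>. \<psi> \<in> test_functions \<Omega> \<Longrightarrow> m \<le> energy \<Omega> p \<gamma> (\<lambda>x. F x + gradient \<psi> x)"
    and lim: "(\<lambda>k. energy \<Omega> p \<gamma> (\<lambda>x. F x + gradient (\<phi> k) x)) \<longlonglongrightarrow> m"
    and e: "0 < e"
  shows "\<exists>N. \<forall>j\<ge>N. \<forall>k\<ge>N. (LINT x|lebesgue_on \<Omega>. norm (gradient (\<phi> j) x - gradient (\<phi> k) x) powr p) < e"
proof -
  let ?M = "lebesgue_on \<Omega>"
  have p0: "0 < p" using p by simp
  obtain c where c: "0 < c" "AE x in ?M. c < \<gamma> x" using Linf_plusE[OF \<gamma>] by metis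
  define V where "V k x = F x + gradient (\<phi> k) x" for k x
  define E where "E k = energy \<Omega> p \<gamma> (V k)" for k
  have V: "V k \<in> Lp_on \<Omega> p" for k
    unfolding V_def by (rule Lp_on_add[OF p0 F test_function_Lp(2)[OF \<Omega> p0 \<phi>]])
  have E: "E \<longlonglongrightarrow> m" using lim unfolding E_def V_def .
  have m0: "0 \<le> m"
    by (rule LIMSEQ_le_const[OF E]) (auto simp: E_def intro!: energy_nonneg[OF \<gamma>])
  \<comment> \<open>Energies below \<open>m + 1\<close> then contribute at most \<open>e * c / 2\<close> through the \<open>\<epsilon>\<close>-term, where \<open>c\<close> bounds \<open>\<gamma>\<close> from below.\<close>
  define \<epsilon> where "\<epsilon> = e * c / (4 * (m + 1))"
  have \<epsilon>: "0 < \<epsilon>" using e c m0 by (simp add: \<epsilon>_def)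
  obtain C where C: "0 \<le> C" "\<And>V W. V \<in> Lp_on \<Omega> p \<Longrightarrow> W \<in> Lp_on \<Omega> p \<Longrightarrow>
    energy \<Omega> p \<gamma> (\<lambda>x. V x - W x) \<le> \<epsilon> * (energy \<Omega> p \<gamma> V + energy \<Omega> p \<gamma> W)
      + C * ((energy \<Omega> p \<gamma> V + energy \<Omega> p \<gamma> W) / 2 - energy \<Omega> p \<gamma> (\<lambda>x. (1/2) *\<^sub>R (V x + W x)))"
    by (rule energy_uniform_convexity[OF p \<gamma> \<epsilon>]) (rule that)
  define \<delta> where "\<delta> = min 1 (e * c / (4 * (C + 1)))"
  have \<delta>: "0 < \<delta>" "\<delta> \<le> 1" "C * \<delta> < e * c / 2"
  proof -
    show "0 < \<delta>" "\<delta> \<le> 1" using e c C by (auto simp: \<delta>_def)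
    have "C * \<delta> \<le> C * (e * c / (4 * (C + 1)))" using C by (intro mult_left_mono) (auto simp: \<delta>_def)
    also have "\<dots> < e * c / 2"
    proof -
      have "C / (4 * (C + 1)) < 1 / 2" using C(1) by (simp add: divide_less_eq)
      then have "(e * c) * (C / (4 * (C + 1))) < (e * c) * (1 / 2)"
        using e c(1) by (intro mult_strict_left_mono) auto
      then show ?thesis by (simp add: mult.commute)
    qed
    finally show "C * \<delta> < e * c / 2" .
  qed
  have "\<forall>\<^sub>F k in sequentially. E k < m + \<delta>" using E \<delta>(1) by (intro order_tendstoD) auto
  then obtain N where N: "\<And>k. k \<ge> N \<Longrightarrow> E k < m + \<delta>" by (auto simp: eventually_sequentially)
  show ?thesis
  proof (intro exI allI impI)
    fix j k assume jk: "N \<le> j" "N \<le> k"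
    have mid: "m \<le> energy \<Omega> p \<gamma> (\<lambda>x. (1/2) *\<^sub>R (V j x + V k x))"
    proof -
      let ?\<psi> = "\<lambda>x. (1/2) * \<phi> j x + (1/2) * \<phi> k x"
      have "(\<lambda>x. F x + gradient ?\<psi> x) = (\<lambda>x. (1/2) *\<^sub>R (V j x + V k x))"
      proof
        fix x
        have "F x + ((1/2) *\<^sub>R gradient (\<phi> j) x + (1/2) *\<^sub>R gradient (\<phi> k) x)
            = (1/2) *\<^sub>R F x + (1/2) *\<^sub>R F x + ((1/2) *\<^sub>R gradient (\<phi> j) x + (1/2) *\<^sub>R gradient (\<phi> k) x)"
          by (simp add: scaleR_add_left[symmetric])
        then show "F x + gradient ?\<psi> x = (1/2) *\<^sub>R (V j x + V k x)"
          unfolding gradient_test_lincomb[OF \<phi> \<phi>] V_def by (simp add: scaleR_add_right)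
      qed
      then show ?thesis using low[OF test_functions_lincomb[OF \<phi>[of j] \<phi>[of k], of "1/2" "1/2"]] by (simp only:)
    qed
    have ij: "integrable ?M (\<lambda>x. norm (V j x - V k x) powr p)"
      by (rule Lp_onD(2)[OF Lp_on_diff[OF p0 V V]])
    have "c * (LINT x|?M. norm (V j x - V k x) powr p) = (LINT x|?M. c * norm (V j x - V k x) powr p)"
      by simp
    also have "\<dots> \<le> energy \<Omega> p \<gamma> (\<lambda>x. V j x - V k x)" unfolding energy_def
    proof (rule integral_mono_AE)
      show "AE x in ?M. c * norm (V j x - V k x) powr p \<le> \<gamma> x * norm (V j x - V k x) powr p"
        using c(2) by eventually_elim (auto intro!: mult_right_mono)
    qed (use ij integrable_energy[OF \<gamma> Lp_on_diff[OF p0 V V]] in auto)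
    also have "\<dots> \<le> \<epsilon> * (E j + E k) + C * ((E j + E k) / 2 - energy \<Omega> p \<gamma> (\<lambda>x. (1/2) *\<^sub>R (V j x + V k x)))"
      unfolding E_def by (rule C(2)[OF V V])
    also have "\<dots> \<le> \<epsilon> * (2 * (m + 1)) + C * \<delta>"
    proof (intro add_mono mult_left_mono)
      have "E l \<le> m + 1" if "N \<le> l" for l using N[OF that] \<delta>(2) by simp
      from this[OF jk(1)] this[OF jk(2)] show "E j + E k \<le> 2 * (m + 1)" by simp
      show "(E j + E k) / 2 - energy \<Omega> p \<gamma> (\<lambda>x. (1/2) *\<^sub>R (V j x + V k x)) \<le> \<delta>"
        using N[OF jk(1)] N[OF jk(2)] mid by argo
    qed (use \<epsilon> C(1) in auto)
    also have "\<dots> < e * c"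
    proof -
      have "\<epsilon> * (2 * (m + 1)) = e * c / 2" using m0 by (simp add: \<epsilon>_def field_simps)
      then show ?thesis using \<delta>(3) by linarith
    qed
    finally have "c * (LINT x|?M. norm (V j x - V k x) powr p) < c * e" by (simp add: mult.commute)
    then have "(LINT x|?M. norm (V j x - V k x) powr p) < e" using c(1) by simp
    then show "(LINT x|?M. norm (gradient (\<phi> j) x - gradient (\<phi> k) x) powr p) < e"
      by (simp add: V_def)
  qed
qed

lemma Lp_limit_in_Lp_on:
  assumes p0: "0 < p" and g: "g \<in> Lp_on \<Omega> p" and G: "G \<in> borel_measurable (lebesgue_on \<Omega>)"
    and d: "integrable (lebesgue_on \<Omega>) (\<lambda>x. norm (g x - G x) powr p)"
  shows "G \<in> Lp_on \<Omega> p"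
proof -
  have "(\<lambda>x. g x - G x) \<in> Lp_on \<Omega> p"
    using d G Lp_onD(1)[OF g] by (auto simp: Lp_on_def)
  from Lp_on_diff[OF p0 g this] show ?thesis by simp
qed

text \<open>The direct method: take \<open>f + \<phi> k\<close> with test functions \<open>\<phi> k\<close> whose energies approach the infimum.
The gradients converge by uniform convexity, the \<open>\<phi> k\<close> themselves by the Poincare inequality, and
the limit \<open>w\<close> lies in \<open>W\<^sub>0\<close> by construction. Continuity of the energy makes \<open>f + w\<close> a minimizer
among all perturbations by test functions, so it satisfies the Euler-Lagrange equation.\<close>
theorem weak_solution_exists:
  fixes \<Omega> :: "'a::euclidean_space set"
  assumes p: "1 < p" and \<Omega>: "open \<Omega>" "bounded \<Omega>" and \<gamma>: "\<gamma> \<in> Linf_plus \<Omega>" and f: "f \<in> sobolev \<Omega> p"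
  obtains u where "weak_solution \<Omega> p \<gamma> u" "(\<lambda>x. u x - f x) \<in> sobolev0 \<Omega> p"
proof -
  let ?T = "test_functions \<Omega>"
  let ?M = "lebesgue_on \<Omega>"
  have p0: "0 < p" using p by simp
  define F where "F = weak_grad \<Omega> f"
  have F: "F \<in> Lp_on \<Omega> p" unfolding F_def by (rule sobolevD(2)[OF \<Omega>(1) f])
  define I where "I \<psi> = energy \<Omega> p \<gamma> (\<lambda>x. F x + gradient \<psi> x)" for \<psi>
  define m where "m = Inf (I ` ?T)"
  have ne: "I ` ?T \<noteq> {}" using test_functions_zero by blast
  have bdd: "bdd_below (I ` ?T)"
    by (intro bdd_belowI[of _ 0]) (auto simp: I_def energy_nonneg[OF \<gamma>])
  have low: "m \<le> I \<psi>" if "\<psi> \<in> ?T" for \<psi>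
    unfolding m_def by (rule cInf_lower[OF imageI[OF that] bdd])
  have "\<exists>\<phi>\<in>?T. I \<phi> < m + inverse (real (Suc k))" for k
    using cInf_lessD[OF ne, of "m + inverse (real (Suc k))"] unfolding m_def[symmetric] by auto
  then obtain \<phi> where \<phi>: "\<And>k. \<phi> k \<in> ?T" "\<And>k. I (\<phi> k) < m + inverse (real (Suc k))" by metis
  have lim: "(\<lambda>k. I (\<phi> k)) \<longlonglongrightarrow> m"
  proof (rule tendsto_sandwich)
    show "\<forall>\<^sub>F k in sequentially. m \<le> I (\<phi> k)" by (intro always_eventually allI low \<phi>(1))
    show "\<forall>\<^sub>F k in sequentially. I (\<phi> k) \<le> m + inverse (real (Suc k))"
      using \<phi>(2) by (intro always_eventually allI less_imp_le)
    show "(\<lambda>k. m + inverse (real (Suc k))) \<longlonglongrightarrow> m" by (rule LIMSEQ_inverse_real_of_nat_add)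
  qed (rule tendsto_const)
  note L\<phi> = test_function_Lp[OF \<Omega>(1) p0 \<phi>(1)]
  have cauchy_grad: "\<exists>N. \<forall>j\<ge>N. \<forall>k\<ge>N. (LINT x|?M. norm (gradient (\<phi> j) x - gradient (\<phi> k) x) powr p) < e"
    if "0 < e" for e
    by (rule minimizing_sequence_gradients_Cauchy[OF p \<Omega>(1) \<gamma> F \<phi>(1) low[unfolded I_def] lim[unfolded I_def] that])
  obtain C where C: "0 \<le> C" "\<And>\<psi>. \<psi> \<in> ?T \<Longrightarrow>
    (LINT x|?M. \<bar>\<psi> x\<bar> powr p) \<le> C * (LINT x|?M. norm (gradient \<psi> x) powr p)"
    using Poincare_test_functions[OF p \<Omega>] by metis
  have cauchy: "\<exists>N. \<forall>j\<ge>N. \<forall>k\<ge>N. (LINT x|?M. norm (\<phi> j x - \<phi> k x) powr p) < e"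
    if e: "0 < e" for e
  proof -
    obtain N where N: "\<forall>j\<ge>N. \<forall>k\<ge>N. (LINT x|?M. norm (gradient (\<phi> j) x - gradient (\<phi> k) x) powr p) < e / (C + 1)"
      using cauchy_grad[of "e / (C + 1)"] e C(1) by auto
    show ?thesis
    proof (intro exI allI impI)
      fix j k assume jk: "N \<le> j" "N \<le> k"
      let ?d = "LINT x|?M. norm (gradient (\<phi> j) x - gradient (\<phi> k) x) powr p"
      have t: "(\<lambda>x. \<phi> j x - \<phi> k x) \<in> ?T"
        using test_functions_lincomb[OF \<phi>(1)[of j] \<phi>(1)[of k], of 1 "-1"] by simp
      have g: "gradient (\<lambda>x. \<phi> j x - \<phi> k x) x = gradient (\<phi> j) x - gradient (\<phi> k) x" for x
        using gradient_test_lincomb[OF \<phi>(1)[of j] \<phi>(1)[of k], of 1 "-1"] by simp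
      have "(LINT x|?M. norm (\<phi> j x - \<phi> k x) powr p) \<le> C * ?d"
        using C(2)[OF t] by (simp add: g)
      also have "\<dots> \<le> (C + 1) * ?d" by (intro mult_right_mono integral_nonneg_AE) auto
      also have "\<dots> < (C + 1) * (e / (C + 1))"
        using N jk C(1) by (intro mult_strict_left_mono) auto
      finally show "(LINT x|?M. norm (\<phi> j x - \<phi> k x) powr p) < e" using C(1) by simp
    qed
  qed
  obtain W where W: "W \<in> borel_measurable ?M"
      "\<And>k. integrable ?M (\<lambda>x. norm (gradient (\<phi> k) x - W x) powr p)"
      "(\<lambda>k. LINT x|?M. norm (gradient (\<phi> k) x - W x) powr p) \<longlonglongrightarrow> 0"
    by (rule Lp_complete[OF p0 Lp_onD(1)[OF L\<phi>(2)] Lp_onD(2)[OF Lp_on_diff[OF p0 L\<phi>(2) L\<phi>(2)]]]) (erule cauchy_grad, rule that)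
  obtain w where w: "w \<in> borel_measurable ?M"
      "\<And>k. integrable ?M (\<lambda>x. norm (\<phi> k x - w x) powr p)"
      "(\<lambda>k. LINT x|?M. norm (\<phi> k x - w x) powr p) \<longlonglongrightarrow> 0"
    by (rule Lp_complete[OF p0 Lp_onD(1)[OF L\<phi>(1)] Lp_onD(2)[OF Lp_on_diff[OF p0 L\<phi>(1) L\<phi>(1)]]]) (erule cauchy, rule that)
  have WL: "W \<in> Lp_on \<Omega> p" by (rule Lp_limit_in_Lp_on[OF p0 L\<phi>(2) W(1,2)])
  have wL: "w \<in> Lp_on \<Omega> p" by (rule Lp_limit_in_Lp_on[OF p0 L\<phi>(1) w(1,2)])
  have WT: "Lp_tendsto \<Omega> p (\<lambda>k. gradient (\<phi> k)) W" using W(3) by (simp add: Lp_tendsto_def)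
  have wT: "Lp_tendsto \<Omega> p \<phi> w" using w(3) by (simp add: Lp_tendsto_def)
  have wW: "has_weak_gradient \<Omega> w W"
    by (rule has_weak_gradient_Lp_limit[OF p \<Omega> L\<phi>(1) wL wT L\<phi>(2) WL WT test_function_has_weak_gradient[OF \<phi>(1) \<Omega>(1)]])
  note ws = sobolevI[OF \<Omega>(1) wL WL wW]
  have w0: "w \<in> sobolev0 \<Omega> p"
  proof -
    have "(LINT x|?M. norm (gradient (\<phi> k) x - weak_grad \<Omega> w x) powr p)
       = (LINT x|?M. norm (gradient (\<phi> k) x - W x) powr p)" for k
      using ws(2) borel_measurable_integrable[OF W(2)]
        borel_measurable_integrable[OF Lp_onD(2)[OF Lp_on_diff[OF p0 L\<phi>(2) sobolevD(2)[OF \<Omega>(1) ws(1)]]]]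
      by (intro integral_cong_AE) (auto elim!: eventually_mono)
    then have "Lp_tendsto \<Omega> p (\<lambda>k. gradient (\<phi> k)) (weak_grad \<Omega> w)" using W(3) by (simp add: Lp_tendsto_def)
    then show ?thesis unfolding sobolev0_iff[OF \<Omega>(1) p0] using ws(1) \<phi>(1) wT by blast
  qed
  define U where "U x = F x + W x" for x
  have U: "U \<in> Lp_on \<Omega> p" unfolding U_def by (rule Lp_on_add[OF p0 F WL])
  have conv: "Lp_tendsto \<Omega> p (\<lambda>k x. F x + gradient (\<phi> k) x + gradient \<psi> x) (\<lambda>x. U x + gradient \<psi> x)" for \<psi>
    using W(3) by (simp add: Lp_tendsto_def U_def algebra_simps)
  have EU: "I' \<longlonglongrightarrow> energy \<Omega> p \<gamma> (\<lambda>x. U x + gradient \<psi> x)"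
    if "\<psi> \<in> ?T" "I' = (\<lambda>k. energy \<Omega> p \<gamma> (\<lambda>x. F x + gradient (\<phi> k) x + gradient \<psi> x))" for \<psi> I'
    unfolding that(2)
    by (rule energy_tendsto[OF p \<gamma> Lp_on_add[OF p0 Lp_on_add[OF p0 F L\<phi>(2)] test_function_Lp(2)[OF \<Omega>(1) p0 that(1)]]
          Lp_on_add[OF p0 U test_function_Lp(2)[OF \<Omega>(1) p0 that(1)]] conv])
  have "energy \<Omega> p \<gamma> U = m"
  proof -
    have "(\<lambda>k. I (\<phi> k)) \<longlonglongrightarrow> energy \<Omega> p \<gamma> U"
      using EU[OF test_functions_zero refl] by (simp add: I_def gradient_const)
    then show ?thesis using lim LIMSEQ_unique by blast
  qed
  moreover have "m \<le> energy \<Omega> p \<gamma> (\<lambda>x. U x + gradient \<psi> x)" if \<psi>: "\<psi> \<in> ?T" for \<psi>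
  proof (rule LIMSEQ_le_const[OF EU[OF \<psi> refl]], intro exI allI impI)
    fix k
    have t: "(\<lambda>x. 1 * \<phi> k x + 1 * \<psi> x) \<in> ?T" by (rule test_functions_lincomb[OF \<phi>(1) \<psi>])
    show "m \<le> energy \<Omega> p \<gamma> (\<lambda>x. F x + gradient (\<phi> k) x + gradient \<psi> x)"
      using low[OF t] unfolding I_def gradient_test_lincomb[OF \<phi>(1) \<psi>] by (simp add: add.assoc)
  qed
  ultimately have EL: "(pairing \<Omega> p \<gamma> U (gradient \<psi>)) = 0" if "\<psi> \<in> ?T" for \<psi>
    using that by (intro euler_lagrange[OF p \<Omega>(1) \<gamma> U]) simp_all
  define u where "u x = f x + w x" for x
  have us: "u \<in> sobolev \<Omega> p" and gu: "AE x in ?M. weak_grad \<Omega> u x = U x"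
  proof -
    note s = sobolev_lincomb[OF \<Omega>(1) p0 f ws(1), of 1 1]
    have eq: "(\<lambda>x. 1 * f x + 1 * w x) = u" by (simp add: u_def fun_eq_iff)
    show "u \<in> sobolev \<Omega> p" using s(1) unfolding eq .
    show "AE x in ?M. weak_grad \<Omega> u x = U x"
      using s(2) ws(2) unfolding eq by eventually_elim (simp add: U_def F_def)
  qed
  have "weak_solution \<Omega> p \<gamma> u"
    unfolding weak_solution_def p_flux_eq_duality_map
  proof (intro conjI ballI)
    fix \<psi> assume \<psi>: "\<psi> \<in> ?T"
    note D = test_function_Lp(2)[OF \<Omega>(1) p0 \<psi>]
    have i: "(\<lambda>x. \<gamma> x * (duality_map p (V x) \<bullet> gradient \<psi> x)) \<in> borel_measurable ?M" if "V \<in> Lp_on \<Omega> p" for V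
      by (intro borel_measurable_integrable integrable_Linf_plus_mult[OF \<gamma>] integrable_duality_pairing[OF p that D])
    have "(pairing \<Omega> p \<gamma> (weak_grad \<Omega> u) (gradient \<psi>))
       = (pairing \<Omega> p \<gamma> U (gradient \<psi>))"
      using gu i[OF U] i[OF sobolevD(2)[OF \<Omega>(1) us]] by (intro integral_cong_AE) (auto elim!: eventually_mono)
    then show "(pairing \<Omega> p \<gamma> (weak_grad \<Omega> u) (gradient \<psi>)) = 0"
      using EL[OF \<psi>] by simp
  qed (rule us)
  moreover have "(\<lambda>x. u x - f x) \<in> sobolev0 \<Omega> p" using w0 by (simp add: u_def)
  ultimately show ?thesis by (rule that)
qed

section \<open>The Dirichlet-to-Neumann map\<close>

text \<open>The definite description is meaningful because its value does not depend on the choices: replacing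
the second representative changes the pairing by a test with an element of \<open>W\<^sub>0\<close>, and two weak
solutions with the same boundary data have the same energy, each being a minimizer.\<close>
theorem DN_map_diagonal:
  assumes p: "1 < p" and \<Omega>: "open \<Omega>" and \<gamma>: "\<gamma> \<in> Linf_plus \<Omega>" and f: "f \<in> sobolev \<Omega> p"
    and u: "weak_solution \<Omega> p \<gamma> u" "(\<lambda>x. u x - f x) \<in> sobolev0 \<Omega> p"
  shows "DN_map \<Omega> p \<gamma> (boundary_class \<Omega> p f) (boundary_class \<Omega> p f) = energy \<Omega> p \<gamma> (weak_grad \<Omega> u)"
proof -
  have p0: "0 < p" using p by simp
  have us: "u \<in> sobolev \<Omega> p" using u(1) by (simp add: weak_solution_def)
  have mem: "v \<in> boundary_class \<Omega> p f \<longleftrightarrow> v \<in> sobolev \<Omega> p \<and> (\<lambda>x. f x - v x) \<in> sobolev0 \<Omega> p" for v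
    using f by (auto simp: boundary_class_def boundary_rel_def)
  have diff: "(\<lambda>x. v x - w x) \<in> sobolev0 \<Omega> p" if "v \<in> boundary_class \<Omega> p f" "w \<in> boundary_class \<Omega> p f" for v w
    using sobolev0_lincomb[OF \<Omega> p0, of "\<lambda>x. f x - w x" "\<lambda>x. f x - v x" 1 "-1"] that by (simp add: mem)
  have uF: "u \<in> boundary_class \<Omega> p f"
    using us sobolev0_lincomb[OF \<Omega> p0 u(2) u(2), of "-1" 0] by (simp add: mem)
  have F: "boundary_class \<Omega> p f \<in> boundary_space \<Omega> p"
    unfolding boundary_class_def boundary_space_def using f by (rule quotientI)
  have "(THE c. \<exists>u v. weak_solution \<Omega> p \<gamma> u \<and> u \<in> boundary_class \<Omega> p f \<and> v \<in> boundary_class \<Omega> p f \<and>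
          c = (LINT x|lebesgue_on \<Omega>. \<gamma> x * (p_flux \<Omega> p u x \<bullet> weak_grad \<Omega> v x))) = energy \<Omega> p \<gamma> (weak_grad \<Omega> u)"
    unfolding p_flux_eq_duality_map
  proof (rule the_equality)
    show "\<exists>u' v. weak_solution \<Omega> p \<gamma> u' \<and> u' \<in> boundary_class \<Omega> p f \<and> v \<in> boundary_class \<Omega> p f \<and>
       energy \<Omega> p \<gamma> (weak_grad \<Omega> u) = (pairing \<Omega> p \<gamma> (weak_grad \<Omega> u') (weak_grad \<Omega> v))"
      using u(1) uF by (intro exI[of _ u]) (simp add: energy_def duality_map_inner_self)
    fix c assume "\<exists>u' v. weak_solution \<Omega> p \<gamma> u' \<and> u' \<in> boundary_class \<Omega> p f \<and> v \<in> boundary_class \<Omega> p f \<and>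
       c = (pairing \<Omega> p \<gamma> (weak_grad \<Omega> u') (weak_grad \<Omega> v))"
    then obtain u' v where *: "weak_solution \<Omega> p \<gamma> u'" "u' \<in> boundary_class \<Omega> p f" "v \<in> boundary_class \<Omega> p f"
      "c = (pairing \<Omega> p \<gamma> (weak_grad \<Omega> u') (weak_grad \<Omega> v))" by blast
    have "c = energy \<Omega> p \<gamma> (weak_grad \<Omega> u')"
      unfolding *(4) using *(3) by (intro weak_solution_pairing_eq(2)[OF p \<Omega> \<gamma> *(1)] diff *(2,3)) (simp add: mem)
    moreover have "energy \<Omega> p \<gamma> (weak_grad \<Omega> u') \<le> energy \<Omega> p \<gamma> (weak_grad \<Omega> u)"
      by (intro weak_solution_minimizes_energy[OF p \<Omega> \<gamma> *(1) us] diff uF *(2))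
    moreover have "energy \<Omega> p \<gamma> (weak_grad \<Omega> u) \<le> energy \<Omega> p \<gamma> (weak_grad \<Omega> u')"
      using *(2) by (intro weak_solution_minimizes_energy[OF p \<Omega> \<gamma> u(1)] diff uF *(2)) (simp add: mem)
    ultimately show "c = energy \<Omega> p \<gamma> (weak_grad \<Omega> u)" by simp
  qed
  then show ?thesis using F by (simp add: DN_map_def)
qed

lemma duality_map_scaleR:
  assumes "0 < r"
  shows "duality_map p (r *\<^sub>R a) = r powr (p - 1) *\<^sub>R duality_map p a"
proof -
  have "r powr (p - 2) * r = r powr (p - 1)" using assms powr_add[of r "p - 2" 1] by simp
  then show ?thesis using assms by (simp add: duality_map_def powr_mult mult.commute mult.left_commute)
qed

text \<open>The tangent inequality at \<open>r *\<^sub>R a\<close> for \<open>r = (s / t) powr (1 / (p - 1))\<close>, multiplied by \<open>t\<close>. This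
\<open>r\<close> is the one for which \<open>t *\<^sub>R duality_map p (r *\<^sub>R a) = s *\<^sub>R duality_map p a\<close>, so that the term
linear in \<open>b\<close> carries the weight \<open>s\<close>.\<close>
lemma weighted_norm_powr_tangent:
  fixes a b :: "'a::real_inner" and s t p :: real
  assumes p: "1 < p" and s: "0 < s" and t: "0 < t"
  shows "s * norm a powr p + p * (s * (duality_map p a \<bullet> (b - a)))
      + (p - 1) * (s / t powr (1 / (p - 1)) * (t powr (1 / (p - 1)) - s powr (1 / (p - 1))) * norm a powr p)
    \<le> t * norm b powr p"
proof -
  define r where "r = (s / t) powr (1 / (p - 1))"
  have r: "0 < r" "r powr (p - 1) = s / t" using s t p by (auto simp: r_def powr_powr)
  have rp: "r powr p = r * (s / t)" using r powr_add[of r 1 "p - 1"] by simp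
  have frac: "s / t powr (1 / (p - 1)) * (t powr (1 / (p - 1)) - s powr (1 / (p - 1))) = s * (1 - r)"
    using s t by (simp add: r_def powr_divide field_simps)
  let ?A = "norm a powr p" and ?J = "duality_map p a \<bullet> b"
  have "norm (r *\<^sub>R a) powr p + p * (duality_map p (r *\<^sub>R a) \<bullet> (b - r *\<^sub>R a)) \<le> norm b powr p"
    by (rule norm_powr_tangent[OF p])
  moreover have "norm (r *\<^sub>R a) powr p = r * (s / t) * ?A"
    using r(1) by (simp add: powr_mult rp)
  moreover have "duality_map p (r *\<^sub>R a) \<bullet> (b - r *\<^sub>R a) = s / t * (?J - r * ?A)"
    by (simp only: duality_map_scaleR[OF r(1)] r(2) inner_scaleR_left inner_diff_right inner_scaleR_right duality_map_inner_self)
      (simp only: right_diff_distrib mult.left_commute)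
  ultimately have "r * (s / t) * ?A + p * (s / t * (?J - r * ?A)) \<le> norm b powr p"
    by (simp only:)
  then have "t * (r * (s / t) * ?A + p * (s / t * (?J - r * ?A))) \<le> t * norm b powr p"
    using t by (intro mult_left_mono) auto
  also have "t * (r * (s / t) * ?A + p * (s / t * (?J - r * ?A))) = r * s * ?A + p * (s * (?J - r * ?A))"
    using t by (simp add: field_simps)
  also have "\<dots> = s * ?A + p * (s * (duality_map p a \<bullet> (b - a))) + (p - 1) * (s * (1 - r) * ?A)"
    by (simp add: inner_diff_right duality_map_inner_self algebra_simps)
  finally show ?thesis by (simp only: frac)
qed

theorem lemma2p1:
  fixes \<Omega> :: "(real ^ 'n) set" and p :: real
    and \<sigma>0 \<sigma>1 f u0 :: "real ^ 'n \<Rightarrow> real"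
  assumes "open \<Omega>" and "bounded \<Omega>" and "1 < p"
    and "\<sigma>0 \<in> Linf_plus \<Omega>" and "\<sigma>1 \<in> Linf_plus \<Omega>"
    and "f \<in> sobolev \<Omega> p"
    and "weak_solution \<Omega> p \<sigma>0 u0"
    and "(\<lambda>x. u0 x - f x) \<in> sobolev0 \<Omega> p"
  shows "(p - 1) * (LINT x|lebesgue_on \<Omega>.
            \<sigma>0 x / \<sigma>1 x powr (1 / (p - 1)) *
            (\<sigma>1 x powr (1 / (p - 1)) - \<sigma>0 x powr (1 / (p - 1))) *
            norm (weak_grad \<Omega> u0 x) powr p)
         \<le> (DN_map \<Omega> p \<sigma>1 - DN_map \<Omega> p \<sigma>0) (boundary_class \<Omega> p f) (boundary_class \<Omega> p f) \<and>
         (DN_map \<Omega> p \<sigma>1 - DN_map \<Omega> p \<sigma>0) (boundary_class \<Omega> p f) (boundary_class \<Omega> p f)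
         \<le> (LINT x|lebesgue_on \<Omega>. (\<sigma>1 x - \<sigma>0 x) * norm (weak_grad \<Omega> u0 x) powr p)"
proof -
  let ?M = "lebesgue_on \<Omega>"
  note \<Omega> = assms(1) and p = assms(3) and \<sigma>0 = assms(4) and \<sigma>1 = assms(5) and u0 = assms(7)
  have p0: "0 < p" using p by simp
  obtain u1 where u1: "weak_solution \<Omega> p \<sigma>1 u1" "(\<lambda>x. u1 x - f x) \<in> sobolev0 \<Omega> p"
    using weak_solution_exists[OF p \<Omega> assms(2) \<sigma>1 assms(6)] by blast
  have s0: "u0 \<in> sobolev \<Omega> p" and s1: "u1 \<in> sobolev \<Omega> p"
    using u0 u1(1) by (simp_all add: weak_solution_def)
  have d10: "(\<lambda>x. u1 x - u0 x) \<in> sobolev0 \<Omega> p" and d01: "(\<lambda>x. u0 x - u1 x) \<in> sobolev0 \<Omega> p"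
    using sobolev0_lincomb[OF \<Omega> p0 u1(2) assms(8), of 1 "-1"] sobolev0_lincomb[OF \<Omega> p0 assms(8) u1(2), of 1 "-1"] by simp_all
  let ?G0 = "weak_grad \<Omega> u0" and ?G1 = "weak_grad \<Omega> u1"
  note G0 = sobolevD(2)[OF \<Omega> s0] and G1 = sobolevD(2)[OF \<Omega> s1]
  have DN: "(DN_map \<Omega> p \<sigma>1 - DN_map \<Omega> p \<sigma>0) (boundary_class \<Omega> p f) (boundary_class \<Omega> p f)
      = energy \<Omega> p \<sigma>1 ?G1 - energy \<Omega> p \<sigma>0 ?G0"
    by (simp add: DN_map_diagonal[OF p \<Omega> \<sigma>1 assms(6) u1] DN_map_diagonal[OF p \<Omega> \<sigma>0 assms(6) u0 assms(8)])
  have upper: "energy \<Omega> p \<sigma>1 ?G1 - energy \<Omega> p \<sigma>0 ?G0 \<le> (LINT x|?M. (\<sigma>1 x - \<sigma>0 x) * norm (?G0 x) powr p)"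
  proof -
    have "(LINT x|?M. (\<sigma>1 x - \<sigma>0 x) * norm (?G0 x) powr p) = energy \<Omega> p \<sigma>1 ?G0 - energy \<Omega> p \<sigma>0 ?G0"
      using integrable_energy[OF \<sigma>1 G0] integrable_energy[OF \<sigma>0 G0] by (simp add: energy_def left_diff_distrib)
    then show ?thesis using weak_solution_minimizes_energy[OF p \<Omega> \<sigma>1 u1(1) s0 d01] by simp
  qed
  define q where "q = 1 / (p - 1)"
  have q: "0 < q" using p by (simp add: q_def)
  let ?h = "\<lambda>x. \<sigma>0 x / \<sigma>1 x powr q * (\<sigma>1 x powr q - \<sigma>0 x powr q) * norm (?G0 x) powr p"
  let ?L = "\<lambda>x. \<sigma>0 x * norm (?G0 x) powr p + p * (\<sigma>0 x * (duality_map p (?G0 x) \<bullet> (?G1 x - ?G0 x))) + (p - 1) * ?h x"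
  obtain C0 c0 where C0: "0 < C0" "0 < c0" "\<sigma>0 \<in> borel_measurable ?M"
    "AE x in ?M. \<bar>\<sigma>0 x\<bar> \<le> C0" "AE x in ?M. c0 < \<sigma>0 x" using Linf_plusE[OF \<sigma>0] by metis
  obtain C1 c1 where C1: "0 < C1" "0 < c1" "\<sigma>1 \<in> borel_measurable ?M"
    "AE x in ?M. \<bar>\<sigma>1 x\<bar> \<le> C1" "AE x in ?M. c1 < \<sigma>1 x" using Linf_plusE[OF \<sigma>1] by metis
  have hi: "integrable ?M ?h"
  proof (rule Bochner_Integration.integrable_bound)
    let ?B = "C0 / c1 powr q * (C1 powr q + C0 powr q)"
    show "integrable ?M (\<lambda>x. ?B * norm (?G0 x) powr p)" using Lp_onD(2)[OF G0] by simp
    show "?h \<in> borel_measurable ?M" using C0(3) C1(3) Lp_onD(1)[OF G0] by measurable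
    show "AE x in ?M. norm (?h x) \<le> norm (?B * norm (?G0 x) powr p)"
      using C0(4,5) C1(4,5)
    proof eventually_elim
      case (elim x)
      have 1: "\<sigma>0 x / \<sigma>1 x powr q \<le> C0 / c1 powr q"
        using elim C0 C1 q by (intro frac_le powr_mono2) auto
      have "\<sigma>0 x powr q \<le> C0 powr q" "\<sigma>1 x powr q \<le> C1 powr q"
        using elim C0 C1 q by (auto intro!: powr_mono2)
      then have 2: "\<bar>\<sigma>1 x powr q - \<sigma>0 x powr q\<bar> \<le> C1 powr q + C0 powr q"
        using powr_ge_zero[of "\<sigma>0 x" q] powr_ge_zero[of "\<sigma>1 x" q] by linarith
      have 0: "0 \<le> \<sigma>0 x / \<sigma>1 x powr q" using elim C0 by auto
      have "norm (?h x) = \<sigma>0 x / \<sigma>1 x powr q * \<bar>\<sigma>1 x powr q - \<sigma>0 x powr q\<bar> * norm (?G0 x) powr p"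
        using 0 by (simp only: real_norm_def abs_mult abs_of_nonneg powr_ge_zero)
      also have "\<dots> \<le> ?B * norm (?G0 x) powr p"
        using 0 1 2 by (intro mult_right_mono mult_mono) auto
      also have "\<dots> \<le> norm (?B * norm (?G0 x) powr p)" unfolding real_norm_def by (rule abs_ge_self)
      finally show ?case .
    qed
  qed
  have orth: "(LINT x|?M. \<sigma>0 x * (duality_map p (?G0 x) \<bullet> (?G1 x - ?G0 x))) = 0"
    by (rule weak_solution_pairing_eq(1)[OF p \<Omega> \<sigma>0 u0 s1 d10])
  have i1: "integrable ?M (\<lambda>x. \<sigma>0 x * (duality_map p (?G0 x) \<bullet> (?G1 x - ?G0 x)))"
    by (intro integrable_Linf_plus_mult[OF \<sigma>0] integrable_duality_pairing[OF p G0] Lp_on_diff[OF p0 G1 G0])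
  have "energy \<Omega> p \<sigma>0 ?G0 + (p - 1) * (LINT x|?M. ?h x)
     = energy \<Omega> p \<sigma>0 ?G0 + p * (LINT x|?M. \<sigma>0 x * (duality_map p (?G0 x) \<bullet> (?G1 x - ?G0 x))) + (p - 1) * (LINT x|?M. ?h x)"
    by (simp add: orth)
  also have "\<dots> = (LINT x|?M. ?L x)"
    unfolding energy_def using integrable_energy[OF \<sigma>0 G0] i1 hi
    by (simp only: Bochner_Integration.integral_add integral_mult_right_zero Bochner_Integration.integrable_add integrable_mult_right)
  also have "\<dots> \<le> energy \<Omega> p \<sigma>1 ?G1" unfolding energy_def
  proof (rule integral_mono_AE)
    show "integrable ?M (\<lambda>x. ?L x)"
      by (intro Bochner_Integration.integrable_add integrable_mult_right impI integrable_energy[OF \<sigma>0 G0] i1 hi)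
    show "AE x in ?M. ?L x
        \<le> \<sigma>1 x * norm (?G1 x) powr p"
      using C0(5) C1(5)
    proof eventually_elim
      case (elim x)
      then have "0 < \<sigma>0 x" "0 < \<sigma>1 x" using C0(2) C1(2) by linarith+
      then show ?case unfolding q_def by (rule weighted_norm_powr_tangent[OF p])
    qed
  qed (rule integrable_energy[OF \<sigma>1 G1])
  finally have lower: "(p - 1) * (LINT x|?M. ?h x) \<le> energy \<Omega> p \<sigma>1 ?G1 - energy \<Omega> p \<sigma>0 ?G0" by simp
  show ?thesis unfolding DN using lower upper unfolding q_def by blast
qed

end
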